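(* Let $G=\Gamma\times H_D$ be a finitely generated class 2 nilpotent group with infinite cyclic derived subgroup, where $\Gamma$ is a finitely generated abelian group of torsion-free rank $s$ and $D=(\delta_1,\ldots,\delta_{r-1})\in(\mathbb{N}_+)^{r-1}$ satisfies $\delta_i\mid\delta_{i+1}$ for each $i$, so that $G$ has Heisenberg rank $r\geq 1$. Then the conjugacy growth function of $G$ satisfies \[c_G(n)\sim\begin{cases} n^{s+2}\log n & r=1, \\ n^{s+2r} & r\geq 2.\end{cases}\]
   Context: Notation: $\mathbb{N}$ is the set of non-negative integers, $\mathbb{N}_+$ the positive integers, $[g,h]=ghg^{-1}h^{-1}$. The group $H_D$: let $H_1=\langle a,b\mid [[a,b],a],[[a,b],b]\rangle$ be the first Heisenberg group. Take $r$ copies of $H_1$, the $i$-th generated by $a_i,b_i$, with $c_i=[a_i,b_i]$. For $D=(\delta_1,\ldots,\delta_{r-1})\in(\mathbb{N}_+)^{r-1}$ with $\delta_i\mid\delta_{i+1}$, the group $H_D$ is the iterated central product obtained by identifying $c_i=c_1^{\delta_{i-1}}$ for $2\le i\le r$, i.e. the quotient of the direct product of the $r$ copies by the central subgroup generated by the elements $c_i c_1^{-\delta_{i-1}}$, $2\leq i\leq r$. For $r=1$, $D$ is empty and $H_D=H_1$. The Heisenberg rank of $\Gamma\times H_D$ is the number $r$ of copies of $H_1$. Conjugacy growth: for a group $G$ with finite generating set $S$, $|g|_S$ is word length with respect to $S\cup S^{-1}$; the length of a conjugacy class $\kappa$ is $|\kappa|_S=\min\{|g|_S : g\in\kappa\}$,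 and $c_{G,S}(n)$ is the number of conjugacy classes $\kappa$ with $|\kappa|_S\leq n$. Equivalence: for functions $f,g$ on $\mathbb{N}$ with non-negative values, $f\preccurlyeq g$ means there exists $\lambda>1$ (take it to be an integer so that $\lambda n\in\mathbb{N}$) with $f(n)\leq\lambda g(\lambda n)+\lambda$ for all $n\in\mathbb{N}$; $f\sim g$ means $f\preccurlyeq g$ and $g\preccurlyeq f$. The equivalence class of $c_{G,S}$ does not depend on the choice of finite generating set $S$, so one writes $c_G$. The function $n^{d}\log n$ is read as $0$ at $n=0$. *)

theory Defs
  imports "HOL-Algebra.Algebra" "HOL-Analysis.Analysis"
begin

section \<open>Group presentations\<close>

text \<open>A letter \<open>(x, True)\<close> stands for the generator \<open>x\<close>, and \<open>(x, False)\<close> for its inverse.\<close>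

type_synonym 'x word = "('x \<times> bool) list"

definition word_inv :: "'x word \<Rightarrow> 'x word" where
  "word_inv w = rev (map (\<lambda>(x, e). (x, \<not> e)) w)"

definition word_comm :: "'x word \<Rightarrow> 'x word \<Rightarrow> 'x word" where
  "word_comm u v = u @ v @ word_inv u @ word_inv v"

inductive word_cong :: "'x word set \<Rightarrow> 'x word \<Rightarrow> 'x word \<Rightarrow> bool" for R where
  refl: "word_cong R u u"
| sym: "word_cong R u v \<Longrightarrow> word_cong R v u"
| trans: "word_cong R u v \<Longrightarrow> word_cong R v w \<Longrightarrow> word_cong R u w"
| cancel: "word_cong R (u @ [(x, e), (x, \<not> e)] @ v) (u @ v)"
| relator: "w \<in> R \<Longrightarrow> word_cong R (u @ w @ v) (u @ v)"

definition word_class :: "'x word set \<Rightarrow> 'x word \<Rightarrow> 'x word set" where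
  "word_class R u = {v. word_cong R u v}"

text \<open>The group with generating set the whole type \<open>'x\<close> and set of relators \<open>R\<close>.\<close>

definition presented_group :: "'x word set \<Rightarrow> 'x word set monoid" where
  "presented_group R =
     \<lparr>carrier = range (word_class R),
      monoid.mult = (\<lambda>U V. \<Union>u\<in>U. \<Union>v\<in>V. word_class R (u @ v)),
      one = word_class R []\<rparr>"

section \<open>The groups $H_1$ and $H_D$\<close>

datatype heis_gen = Gen_a | Gen_b

abbreviation letter_a :: "heis_gen word" where "letter_a \<equiv> [(Gen_a, True)]"
abbreviation letter_b :: "heis_gen word" where "letter_b \<equiv> [(Gen_b, True)]"

definition heis_relators :: "heis_gen word set" where
  "heis_relators = {word_comm (word_comm letter_a letter_b) letter_a,
                    word_comm (word_comm letter_a letter_b) letter_b}"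

definition heisenberg :: "heis_gen word set monoid" where
  "heisenberg = presented_group heis_relators"

definition heis_a :: "heis_gen word set" where
  "heis_a = word_class heis_relators letter_a"

definition heis_b :: "heis_gen word set" where
  "heis_b = word_class heis_relators letter_b"

definition commutator :: "('g, 'm) monoid_scheme \<Rightarrow> 'g \<Rightarrow> 'g \<Rightarrow> 'g" where
  "commutator G g h = g \<otimes>\<^bsub>G\<^esub> h \<otimes>\<^bsub>G\<^esub> inv\<^bsub>G\<^esub> g \<otimes>\<^bsub>G\<^esub> inv\<^bsub>G\<^esub> h"

abbreviation heis_power :: "nat \<Rightarrow> (nat \<Rightarrow> heis_gen word set) monoid" where
  "heis_power r \<equiv> product_group {1..r} (\<lambda>_. heisenberg)"

definition heis_copy :: "nat \<Rightarrow> nat \<Rightarrow> heis_gen word set \<Rightarrow> (nat \<Rightarrow> heis_gen word set)" where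
  "heis_copy r i x = (\<lambda>j\<in>{1..r}. if j = i then x else \<one>\<^bsub>heisenberg\<^esub>)"

definition heis_c :: "nat \<Rightarrow> nat \<Rightarrow> (nat \<Rightarrow> heis_gen word set)" where
  "heis_c r i = commutator (heis_power r) (heis_copy r i heis_a) (heis_copy r i heis_b)"

text \<open>The tuple \<open>D = (\<delta>\<^sub>1, \<dots>, \<delta>\<^bsub>r-1\<^esub>)\<close> is a list of length \<open>r - 1\<close>. Lists are indexed from 0,
  so \<open>\<delta>\<^bsub>i-1\<^esub>\<close> is \<open>D ! (i - 2)\<close>.\<close>

definition H_D :: "nat list \<Rightarrow> (nat \<Rightarrow> heis_gen word set) set monoid" where
  "H_D D = (let r = length D + 1; P = heis_power r in
     P Mod generate P {heis_c r i \<otimes>\<^bsub>P\<^esub> inv\<^bsub>P\<^esub> (heis_c r 1 [^]\<^bsub>P\<^esub> (D ! (i - 2))) | i. i \<in> {2..r}})"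

section \<open>Finite generation and torsion-free rank\<close>

definition finite_generating_set :: "('g, 'm) monoid_scheme \<Rightarrow> 'g set \<Rightarrow> bool" where
  "finite_generating_set G S \<longleftrightarrow> finite S \<and> S \<subseteq> carrier G \<and> generate G S = carrier G"

definition finitely_generated :: "('g, 'm) monoid_scheme \<Rightarrow> bool" where
  "finitely_generated G \<longleftrightarrow> (\<exists>S. finite_generating_set G S)"

definition int_independent :: "('g, 'm) monoid_scheme \<Rightarrow> 'g set \<Rightarrow> bool" where
  "int_independent G B \<longleftrightarrow> finite B \<and> B \<subseteq> carrier G \<and>
     (\<forall>k :: 'g \<Rightarrow> int. (\<Otimes>\<^bsub>G\<^esub>b\<in>B. b [^]\<^bsub>G\<^esub> k b) = \<one>\<^bsub>G\<^esub> \<longrightarrow> (\<forall>b\<in>B. k b = 0))"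

definition has_torsion_free_rank :: "('g, 'm) monoid_scheme \<Rightarrow> nat \<Rightarrow> bool" where
  "has_torsion_free_rank G s \<longleftrightarrow>
     (\<exists>B. int_independent G B \<and> card B = s) \<and> (\<forall>B. int_independent G B \<longrightarrow> card B \<le> s)"

section \<open>Conjugacy growth\<close>

definition word_length :: "('g, 'm) monoid_scheme \<Rightarrow> 'g set \<Rightarrow> 'g \<Rightarrow> nat" where
  "word_length G S g =
     (LEAST n. \<exists>w. length w = n \<and> set w \<subseteq> S \<union> m_inv G ` S \<and> foldr (\<otimes>\<^bsub>G\<^esub>) w \<one>\<^bsub>G\<^esub> = g)"

definition conjugacy_classes :: "('g, 'm) monoid_scheme \<Rightarrow> 'g set set" where
  "conjugacy_classes G =
     orbits G (carrier G) (\<lambda>g. \<lambda>h\<in>carrier G. g \<otimes>\<^bsub>G\<^esub> h \<otimes>\<^bsub>G\<^esub> inv\<^bsub>G\<^esub> g)"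

definition class_length :: "('g, 'm) monoid_scheme \<Rightarrow> 'g set \<Rightarrow> 'g set \<Rightarrow> nat" where
  "class_length G S \<kappa> = (INF g\<in>\<kappa>. word_length G S g)"

definition conj_growth :: "('g, 'm) monoid_scheme \<Rightarrow> 'g set \<Rightarrow> nat \<Rightarrow> nat" where
  "conj_growth G S n = card {\<kappa> \<in> conjugacy_classes G. class_length G S \<kappa> \<le> n}"

section \<open>Equivalence of growth functions\<close>

definition growth_le :: "(nat \<Rightarrow> real) \<Rightarrow> (nat \<Rightarrow> real) \<Rightarrow> bool" (infix \<open>\<preceq>g\<close> 50) where
  "f \<preceq>g g \<longleftrightarrow> (\<exists>l::nat. l > 1 \<and> (\<forall>n. f n \<le> real l * g (l * n) + real l))"

definition growth_equiv :: "(nat \<Rightarrow> real) \<Rightarrow> (nat \<Rightarrow> real) \<Rightarrow> bool" (infix \<open>\<sim>g\<close> 50) where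
  "f \<sim>g g \<longleftrightarrow> f \<preceq>g g \<and> g \<preceq>g f"

end

theory Submission
  imports Defs
begin

text \<open>
  An element of \<open>\<Gamma> \<times> H\<^sub>D\<close> has coordinates \<open>(q, v, z)\<close> with \<open>q \<in> \<Gamma>\<close>, \<open>v \<in> \<int>\<^bsup>2r\<^esup>\<close> and \<open>z \<in> \<int>\<close>
  the exponent of the central element \<open>c\<^sub>1\<close>. Conjugation fixes \<open>q\<close> and \<open>v\<close> and changes \<open>z\<close> by an arbitrary
  multiple of the content of \<open>v\<close>, the gcd of the coordinates of \<open>v\<close> weighted by \<open>1, \<delta>\<^sub>1, \<dots>, \<delta>\<^bsub>r-1\<^esub>\<close>.
  A word of length \<open>n\<close> has \<open>v\<close> of size \<open>O(n)\<close> and \<open>z\<close> of size \<open>O(n\<^sup>2)\<close>, and there are about \<open>n\<^sup>s\<close>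
  possibilities for \<open>q\<close>. So, up to equivalence, the conjugacy growth is \<open>n\<^sup>s\<close> times the sum of the contents of the
  nonzero vectors in a box of side \<open>n\<close> (the central classes contribute only \<open>n\<^bsup>s+2\<^esup>\<close>). Sorting vectors by their
  gcd \<open>d\<close>, this sum is comparable to \<open>\<Sum>d\<le>n. d (n/d)\<^bsup>2r\<^esup>\<close>, which is \<open>n\<^sup>2 log n\<close> for \<open>r = 1\<close> and \<open>n\<^bsup>2r\<^esup>\<close>
  otherwise.
\<close>

section \<open>Sums of greatest common divisors\<close>

text \<open>The presentation of \<open>heisenberg\<close> gives no direct hold on its elements: the
  relators might collapse the group. Evaluating words in integer matrices separates classes, and a
  normal form collected letter by letter shows that equal evaluation already implies congruence.
  After that, only coordinates and one bilinear form are used.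

  The two estimates are deliberately asymmetric. From above, vectors with gcd \<open>d\<close> are
  counted among all vectors with coordinates divisible by \<open>d\<close>. From below, the gcd has
  to be exact, but only for pairs: for \<open>r \<ge> 2\<close> one class per vector already gives
  the right order, so coprimality in higher dimension never enters. The weights need no finer
  analysis either: from above they merely enlarge the box, and from below the plain gcd divides the
  content.

  Torsion in \<open>\<Gamma>\<close>, and generating sets with more than \<open>s\<close> elements,
  are treated without the structure theorem: a maximal independent set and finitely many translates
  of its span suffice. The constants inside the logarithm disappear in the dilation of the argument
  that the equivalence permits.\<close>

lemma card_multiples_atLeastAtMost:
  fixes d n :: nat
  assumes "d > 0"
  shows "card {x\<in>{1..n}. d dvd x} = n div d"
proof -
  have "{x\<in>{1..n}. d dvd x} = (\<lambda>j. d * j) ` {1..n div d}"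
    using assms by (auto simp: less_eq_div_iff_mult_less_eq mult.commute elim!: dvdE)
  thus ?thesis
    using assms by (simp add: card_image inj_on_def)
qed

text \<open>Telescoping against \<open>1 / (k - 1) - 1 / k\<close>. What matters is a bound below 1:
  the non-coprime pairs then leave a positive proportion of all pairs.\<close>

lemma sum_inverse_squares_from_2:
  assumes "m \<ge> 1"
  shows "(\<Sum>k=2..m. 1 / real k ^ 2) \<le> 3/4"
proof -
  \<comment> \<open>The summand \<open>- 1 / real m\<close> makes the induction telescope; at
    \<open>m = 2\<close> both sides are 1/4.\<close>
  have "(\<Sum>k=2..m. 1 / real k ^ 2) \<le> 3/4 - 1 / real m" if "m \<ge> 2" for m
    using that
  proof (induction m rule: dec_induct)
    case (step n)
    have "1 / real (Suc n) ^ 2 \<le> 1 / real n - 1 / real (Suc n)"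
    proof -
      have "1 / real (Suc n) ^ 2 \<le> 1 / (real n * real (Suc n))"
        using step by (intro divide_left_mono) (auto simp: power2_eq_square)
      also have "\<dots> = 1 / real n - 1 / real (Suc n)"
        using step by (simp add: field_simps)
      finally show ?thesis .
    qed
    thus ?case using step by simp
  qed simp
  moreover have "3/4 - 1 / real m \<le> 3/4" by simp
  ultimately have "(\<Sum>k=2..m. 1 / real k ^ 2) \<le> 3/4" if "m \<ge> 2"
    using that order.trans by blast
  thus ?thesis using assms by (cases "m = 1") auto
qed

text \<open>A pair that is not coprime has a common divisor \<open>k \<ge> 2\<close>, and \<open>\<Sum>k\<ge>2. 1/k\<^sup>2 \<le> 3/4\<close>.\<close>

lemma card_coprime_pairs_ge:
  "real (card {(x,y). x \<in> {1..m} \<and> y \<in> {1..m} \<and> coprime x (y::nat)}) \<ge> real m ^ 2 / 4"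
    (is "real (card ?C) \<ge> _")
proof (cases "m = 0")
  case False
  define N where "N k = {x\<in>{1..m}. k dvd x} \<times> {y\<in>{1..m}. k dvd y}" for k :: nat
  have finC: "finite ?C" by (rule finite_subset[of _ "{1..m} \<times> {1..m}"]) auto
  have finN: "finite (N k)" for k unfolding N_def by auto
  have cardN: "card (N k) = (m div k) ^ 2" if "k > 0" for k
    using card_multiples_atLeastAtMost[OF that, of m]
    by (simp add: N_def card_cartesian_product power2_eq_square)
  have "{1..m} \<times> {1..m} \<subseteq> ?C \<union> (\<Union>k\<in>{2..m}. N k)"
  proof
    fix p assume p: "p \<in> {1..m} \<times> {1..m}"
    obtain x y where [simp]: "p = (x,y)" by (cases p)
    have xy: "x \<ge> 1" "x \<le> m" "y \<ge> 1" "y \<le> m" using p by auto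
    show "p \<in> ?C \<union> (\<Union>k\<in>{2..m}. N k)"
    proof (cases "coprime x y")
      case False
      have "gcd x y \<noteq> 1" "gcd x y \<noteq> 0"
        using False xy by (auto simp: coprime_iff_gcd_eq_1)
      moreover have "gcd x y \<le> m"
        using xy gcd_le1_nat[of x y] by linarith
      ultimately have "gcd x y \<in> {2..m}" unfolding atLeastAtMost_iff by linarith
      moreover have "p \<in> N (gcd x y)"
        using xy by (auto simp: N_def)
      ultimately show ?thesis by blast
    qed (use xy in auto)
  qed
  hence "card ({1..m} \<times> {1..m}) \<le> card (?C \<union> (\<Union>k\<in>{2..m}. N k))"
    using finC finN by (intro card_mono) auto
  also have "\<dots> \<le> card ?C + card (\<Union>k\<in>{2..m}. N k)" by (rule card_Un_le)
  also have "card (\<Union>k\<in>{2..m}. N k) \<le> (\<Sum>k=2..m. card (N k))"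
    by (rule card_UN_le) auto
  finally have "m ^ 2 \<le> card ?C + (\<Sum>k=2..m. card (N k))"
    by (simp add: card_cartesian_product power2_eq_square)
  hence "real (m ^ 2) \<le> real (card ?C + (\<Sum>k=2..m. card (N k)))"
    by (rule of_nat_mono)
  hence "real m ^ 2 \<le> real (card ?C) + (\<Sum>k=2..m. real (card (N k)))"
    by simp
  also have "(\<Sum>k=2..m. real (card (N k))) \<le> (\<Sum>k=2..m. real m ^ 2 * (1 / real k ^ 2))"
  proof (rule sum_mono)
    fix k assume "k \<in> {2..m}"
    hence "real (card (N k)) = real (m div k) ^ 2" by (simp add: cardN)
    also have "\<dots> \<le> (real m / real k) ^ 2"
      by (intro power_mono of_nat_div_le_of_nat) auto
    finally show "real (card (N k)) \<le> real m ^ 2 * (1 / real k ^ 2)"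
      by (simp add: power_divide)
  qed
  also have "\<dots> = real m ^ 2 * (\<Sum>k=2..m. 1 / real k ^ 2)"
    by (simp add: sum_distrib_left)
  also have "\<dots> \<le> real m ^ 2 * (3/4)"
    using False by (intro mult_left_mono sum_inverse_squares_from_2) auto
  finally show ?thesis by simp
qed simp

text \<open>Pairs with gcd exactly \<open>d\<close> are \<open>d\<close> times the coprime pairs in
  the box of side \<open>n div d\<close>, so \<open>d\<close> contributes order
  \<open>n^2 / d\<close> and the harmonic sum appears. The 16 is 4 from the density of coprime pairs
  times 4 from replacing \<open>n div d\<close> by \<open>n / (2 * d)\<close>.\<close>

lemma sum_gcd_ge:
  "(\<Sum>(x,y)\<in>{1..n} \<times> {1..n}. real (gcd x (y::nat))) \<ge> real n ^ 2 * ln (real n) / 16"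
proof (cases "n = 0")
  case False
  define B where "B = {1..n} \<times> {1..n}"
  have gB: "(\<lambda>(x,y). gcd x y) ` B \<subseteq> {1..n}"
  proof clarify
    fix x y assume "(x,y) \<in> B"
    hence "x \<ge> 1" "x \<le> n" by (auto simp: B_def)
    moreover have "gcd x y \<le> x" "gcd x y \<noteq> 0" using \<open>x \<ge> 1\<close> gcd_le1_nat[of x y] by auto
    ultimately show "gcd x y \<in> {1..n}" using \<open>x \<le> n\<close> by (simp only: atLeastAtMost_iff) linarith
  qed
  have card_ge: "real (card {p\<in>B. (\<lambda>(x,y). gcd x y) p = d}) \<ge> (real n / (2 * real d)) ^ 2 / 4"
    if d: "d \<in> {1..n}" for d
  proof -
    define C where "C = {(x,y). x \<in> {1..n div d} \<and> y \<in> {1..n div d} \<and> coprime x (y::nat)}"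
    have "inj_on (\<lambda>(x,y). (d * x, d * y)) C"
      using d by (auto simp: inj_on_def)
    moreover have "(\<lambda>(x,y). (d * x, d * y)) ` C \<subseteq> {p\<in>B. (\<lambda>(x,y). gcd x y) p = d}"
      using d by (auto simp: C_def B_def less_eq_div_iff_mult_less_eq mult.commute
                       gcd_mult_right gcd_mult_left coprime_iff_gcd_eq_1 gcd.commute)
    ultimately have "card C \<le> card {p\<in>B. (\<lambda>(x,y). gcd x y) p = d}"
      by (intro card_inj_on_le[where f = "\<lambda>(x,y). (d * x, d * y)"]) (auto simp: B_def)
    \<comment> \<open>Since \<open>d \<le> n\<close>, the quotient is at least 1, so rounding down
      loses at most a factor 2.\<close>
    moreover have "real n / (2 * real d) \<le> real (n div d)"
    proof -
      have "real n / real d < real (n div d) + 1"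
        using d by (metis atLeastAtMost_iff floor_divide_of_nat_eq less_le_not_le linorder_not_less
           of_int_of_nat_eq of_nat_div real_of_int_floor_add_one_gt)
      moreover have "real (n div d) \<ge> 1"
        using d by (simp add: div_greater_zero_iff Suc_le_eq)
      ultimately show ?thesis by (simp add: field_simps)
    qed
    hence "(real n / (2 * real d)) ^ 2 / 4 \<le> real (n div d) ^ 2 / 4"
      by (intro divide_right_mono power_mono) auto
    moreover have "real (n div d) ^ 2 / 4 \<le> real (card C)"
      unfolding C_def by (rule card_coprime_pairs_ge)
    ultimately show ?thesis by linarith
  qed
  have "ln (real n) \<le> harm n"
    using ln_le_harm[of n] False by (smt (verit) ln_less_cancel_iff of_nat_0_less_iff not_gr_zero)
  hence "real n ^ 2 * ln (real n) / 16 \<le> real n ^ 2 * harm n / 16"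
    by (intro divide_right_mono mult_left_mono) auto
  also have "\<dots> = (\<Sum>d=1..n. real d * ((real n / (2 * real d)) ^ 2 / 4))"
    unfolding harm_def sum_distrib_left sum_divide_distrib
    by (intro sum.cong) (auto simp: field_simps power2_eq_square)
  also have "\<dots> \<le> (\<Sum>d=1..n. real d * real (card {p\<in>B. (\<lambda>(x,y). gcd x y) p = d}))"
    by (intro sum_mono mult_left_mono card_ge) auto
  also have "\<dots> = (\<Sum>d=1..n. \<Sum>p\<in>{p\<in>B. (\<lambda>(x,y). gcd x y) p = d}. real ((\<lambda>(x,y). gcd x y) p))"
    by (intro sum.cong) (auto simp: mult.commute)
  also have "\<dots> = (\<Sum>p\<in>B. real ((\<lambda>(x,y). gcd x y) p))"
    by (rule sum.group[OF _ _ gB]) (auto simp: B_def)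
  also have "\<dots> = (\<Sum>(x,y)\<in>B. real (gcd x y))"
    by (simp add: case_prod_beta)
  finally show ?thesis by (simp add: B_def)
qed simp

section \<open>Gcd sums over symmetric boxes, from above\<close>

lemma card_multiples_symmetric_interval:
  fixes d n :: nat
  assumes "d > 0"
  shows "card {x\<in>{-int n..int n}. int d dvd x} = 2 * (n div d) + 1"
proof -
  have "{x\<in>{-int n..int n}. int d dvd x} = (\<lambda>j. int d * j) ` {-int (n div d)..int (n div d)}"
  proof (intro equalityI subsetI)
    fix x assume "x \<in> {x\<in>{-int n..int n}. int d dvd x}"
    hence "int d dvd x" and x: "\<bar>x\<bar> \<le> int n" by auto
    then obtain j where j: "x = int d * j" by (elim dvdE)
    have "d * nat \<bar>j\<bar> \<le> n" using x unfolding j by (simp add: abs_mult flip: of_nat_le_iff[where 'a = int])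
    hence "nat \<bar>j\<bar> \<le> n div d"
      using assms by (simp add: less_eq_div_iff_mult_less_eq mult.commute)
    hence "\<bar>j\<bar> \<le> int (n div d)" by linarith
    thus "x \<in> (\<lambda>j. int d * j) ` {-int (n div d)..int (n div d)}" using j by (auto simp: abs_le_iff)
  next
    fix x assume "x \<in> (\<lambda>j. int d * j) ` {-int (n div d)..int (n div d)}"
    then obtain j where j: "x = int d * j" "\<bar>j\<bar> \<le> int (n div d)"
      unfolding image_iff abs_le_iff by fastforce
    hence "\<bar>x\<bar> \<le> int d * int (n div d)" by (simp add: abs_mult mult_left_mono)
    also have "\<dots> = int (d * (n div d))" by simp
    also have "\<dots> \<le> int n" by (subst of_nat_le_iff) simp
    finally show "x \<in> {x\<in>{-int n..int n}. int d dvd x}" using j by auto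
  qed
  thus ?thesis
    using assms by (simp add: card_image inj_on_def)
qed

text \<open>Vectors with gcd \<open>d\<close> are counted among all vectors with coordinates
  divisible by \<open>d\<close>; in the application this overcount costs only a constant factor.
  Without the zero vector the gcds lie in \<open>{1..N}\<close>, over which the sum is
  grouped.\<close>

lemma sum_Gcd_le:
  fixes I :: "'i set" and N :: nat
  assumes "finite I"
  defines "U \<equiv> {u \<in> I \<rightarrow>\<^sub>E {-int N..int N}. \<exists>i\<in>I. u i \<noteq> 0}"
  shows "(\<Sum>u\<in>U. nat (Gcd (u ` I))) \<le> (\<Sum>d=1..N. d * (2 * (N div d) + 1) ^ card I)"
proof -
  have finU: "finite U"
    unfolding U_def using assms(1) by (intro finite_subset[OF _ finite_PiE[of I "\<lambda>_. {-int N..int N}"]]) auto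
  have gU: "(\<lambda>u. nat (Gcd (u ` I))) ` U \<subseteq> {1..N}"
  proof clarify
    fix u assume "u \<in> U"
    then obtain i where i: "i \<in> I" "u i \<noteq> 0" "\<bar>u i\<bar> \<le> int N" by (auto simp: U_def PiE_iff abs_le_iff)
    have dvd: "Gcd (u ` I) dvd u i" using i by auto
    hence "Gcd (u ` I) \<le> \<bar>u i\<bar>" using i(2) by (simp add: dvd_imp_le_int zdvd_imp_le)
    moreover have "Gcd (u ` I) > 0"
      using dvd i(2) by (metis Gcd_int_greater_eq_0 dvd_0_left order_le_less)
    ultimately show "nat (Gcd (u ` I)) \<in> {1..N}" using i(3) by auto
  qed
  have "(\<Sum>u\<in>U. nat (Gcd (u ` I))) = (\<Sum>d=1..N. \<Sum>u\<in>{u\<in>U. nat (Gcd (u ` I)) = d}. nat (Gcd (u ` I)))"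
    by (rule sum.group[symmetric, OF finU _ gU]) auto
  also have "\<dots> = (\<Sum>d=1..N. d * card {u\<in>U. nat (Gcd (u ` I)) = d})"
    by (intro sum.cong) auto
  also have "\<dots> \<le> (\<Sum>d=1..N. d * (2 * (N div d) + 1) ^ card I)"
  proof (intro sum_mono mult_left_mono)
    fix d assume d: "d \<in> {1..N}"
    have "card {u\<in>U. nat (Gcd (u ` I)) = d} \<le> card (I \<rightarrow>\<^sub>E {x\<in>{-int N..int N}. int d dvd x})"
    proof (rule card_mono)
      show "{u\<in>U. nat (Gcd (u ` I)) = d} \<subseteq> I \<rightarrow>\<^sub>E {x\<in>{-int N..int N}. int d dvd x}"
      proof
        fix u assume u: "u \<in> {u\<in>U. nat (Gcd (u ` I)) = d}"
        have "Gcd (u ` I) = int d" using u by auto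
        hence "int d dvd u i" if "i \<in> I" for i using that by (metis Gcd_dvd imageI)
        thus "u \<in> I \<rightarrow>\<^sub>E {x\<in>{-int N..int N}. int d dvd x}" using u by (auto simp: U_def PiE_iff)
      qed
      have "finite {x\<in>{-int N..int N}. int d dvd x}"
        by (rule finite_subset[of _ "{-int N..int N}"]) auto
      thus "finite (I \<rightarrow>\<^sub>E {x\<in>{-int N..int N}. int d dvd x})" using assms(1) by (intro finite_PiE)
    qed
    also have "\<dots> = (2 * (N div d) + 1) ^ card I"
      using d assms(1) card_multiples_symmetric_interval[of d N] by (simp add: card_PiE)
    finally show "card {u\<in>U. nat (Gcd (u ` I)) = d} \<le> (2 * (N div d) + 1) ^ card I" .
  qed auto
  finally show ?thesis .
qed

text \<open>The difference of \<open>harm n\<close> and \<open>ln n\<close> decreases, and it is 1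
  at \<open>n = 1\<close>.\<close>

lemma harm_le_ln: "n \<ge> 1 \<Longrightarrow> harm n \<le> 1 + ln (real n)"
proof (induction n rule: dec_induct)
  case base show ?case by (simp add: harm_expand)
next
  case (step n)
  \<comment> \<open>The decreasing sequence is indexed from 0 with entries at \<open>Suc n\<close>,
    hence the argument \<open>n - 1\<close>.\<close>
  have "harm (Suc n) - ln (real (Suc n)) \<le> harm n - ln (real n)"
    using decseq_harm_diff_ln[THEN decseqD, of "n - 1" n] step by simp
  thus ?case using step by simp
qed

text \<open>The dichotomy of the theorem originates here. For \<open>d \<le> N\<close> one has
  \<open>2 * (N div d) + 1 \<le> 3 * N / d\<close>, which leaves \<open>(3 * N) ^ (2 * r)\<close>
  times the sum of \<open>1 / d ^ (2 * r - 1)\<close>: harmonic for \<open>r = 1\<close>, convergent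
  for \<open>r \<ge> 2\<close>.\<close>

lemma sum_Gcd_le_power:
  fixes I :: "'i set" and N r :: nat
  assumes "finite I" "card I = 2 * r" "r \<ge> 1" "N \<ge> 1"
  shows "real (\<Sum>u\<in>{u \<in> I \<rightarrow>\<^sub>E {-int N..int N}. \<exists>i\<in>I. u i \<noteq> 0}. nat (Gcd (u ` I)))
    \<le> (3 * real N) ^ (2 * r) * (if r = 1 then 1 + ln (real N) else 2)"
proof -
  have "real (\<Sum>u\<in>{u \<in> I \<rightarrow>\<^sub>E {-int N..int N}. \<exists>i\<in>I. u i \<noteq> 0}. nat (Gcd (u ` I)))
     \<le> real (\<Sum>d=1..N. d * (2 * (N div d) + 1) ^ (2 * r))"
    using sum_Gcd_le[OF assms(1), of N] unfolding assms(2) by (rule of_nat_mono)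
  also have "\<dots> = (\<Sum>d=1..N. real d * (2 * real (N div d) + 1) ^ (2 * r))"
    by (simp add: add.commute)
  also have "\<dots> \<le> (\<Sum>d=1..N. real d * (3 * real N / real d) ^ (2 * r))"
  proof (intro sum_mono mult_left_mono power_mono)
    fix d assume d: "d \<in> {1..N}"
    have "real (N div d) \<le> real N / real d" by (rule of_nat_div_le_of_nat)
    moreover have "1 \<le> real N / real d" using d by simp
    ultimately show "2 * real (N div d) + 1 \<le> 3 * real N / real d" by simp
  qed auto
  also have "\<dots> = (3 * real N) ^ (2 * r) * (\<Sum>d=1..N. 1 / real d ^ (2 * r - 1))"
    unfolding sum_distrib_left
  proof (rule sum.cong)
    fix d assume d: "d \<in> {1..N}"
    have "real d ^ (2 * r) = real d * real d ^ (2 * r - 1)"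
      using assms(3) by (metis power_eq_if mult_is_0 not_one_le_zero zero_neq_numeral)
    thus "real d * (3 * real N / real d) ^ (2 * r) = (3 * real N) ^ (2 * r) * (1 / real d ^ (2 * r - 1))"
      using d by (simp add: power_divide)
  qed simp
  also have "\<dots> \<le> (3 * real N) ^ (2 * r) * (if r = 1 then 1 + ln (real N) else 2)"
  proof (rule mult_left_mono)
    show "(\<Sum>d=1..N. 1 / real d ^ (2 * r - 1)) \<le> (if r = 1 then 1 + ln (real N) else 2)"
    proof (cases "r = 1")
      case True
      thus ?thesis using harm_le_ln[OF assms(4)] by (simp add: harm_def divide_inverse)
    next
      case False
      \<comment> \<open>The exponent is at least 3 here, and comparison with squares suffices: the
        term at \<open>d = 1\<close> plus 3/4 stays below 2.\<close>
      have "(\<Sum>d=1..N. 1 / real d ^ (2 * r - 1)) \<le> (\<Sum>d=1..N. 1 / real d ^ 2)"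
        using False assms(3) by (intro sum_mono divide_left_mono power_increasing) auto
      also have "\<dots> = 1 + (\<Sum>d=2..N. 1 / real d ^ 2)"
        using assms(4) by (subst sum.atLeast_Suc_atMost) (auto simp: numeral_2_eq_2)
      also have "\<dots> \<le> 2" using sum_inverse_squares_from_2[OF assms(4)] by simp
      finally show ?thesis using False by simp
    qed
  qed auto
  finally show ?thesis .
qed

section \<open>Growth of finitely generated abelian groups\<close>

context comm_group
begin

lemma m_exchange:
  assumes "a \<in> carrier G" "b \<in> carrier G" "c \<in> carrier G" "d \<in> carrier G"
  shows "(a \<otimes> b) \<otimes> (c \<otimes> d) = (a \<otimes> c) \<otimes> (b \<otimes> d)"
  using assms by (simp add: m_ac)

lemma finprod_int_pow_add:
  fixes k l :: "'a \<Rightarrow> int"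
  assumes "B \<subseteq> carrier G"
  shows "(\<Otimes>b\<in>B. b [^] (k b + l b)) = (\<Otimes>b\<in>B. b [^] k b) \<otimes> (\<Otimes>b\<in>B. b [^] l b)"
proof -
  have "(\<Otimes>b\<in>B. b [^] (k b + l b)) = (\<Otimes>b\<in>B. b [^] k b \<otimes> b [^] l b)"
    using assms by (intro finprod_cong') (auto simp: int_pow_mult)
  also have "\<dots> = (\<Otimes>b\<in>B. b [^] k b) \<otimes> (\<Otimes>b\<in>B. b [^] l b)"
    using assms by (intro finprod_multf) auto
  finally show ?thesis .
qed

lemma finprod_int_pow_pow:
  fixes k :: "'a \<Rightarrow> int" and q :: int
  assumes "finite B" "B \<subseteq> carrier G"
  shows "(\<Otimes>b\<in>B. b [^] k b) [^] q = (\<Otimes>b\<in>B. b [^] (k b * q))"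
  using assms
proof (induction B rule: finite_induct)
  case (insert b B)
  have "(\<lambda>b. b [^] k b) \<in> B \<rightarrow> carrier G" "(\<lambda>b. b [^] (k b * q)) \<in> B \<rightarrow> carrier G"
    using insert.prems by auto
  thus ?case
    using insert by (simp add: int_pow_distrib int_pow_pow)
qed simp

lemma finprod_int_pow_single:
  fixes e :: int
  assumes "finite B" "B \<subseteq> carrier G" "t \<in> B"
  shows "t [^] e = (\<Otimes>b\<in>B. b [^] (if b = t then e else 0))"
proof -
  have "(\<Otimes>b\<in>B. b [^] (if b = t then e else 0)) = (\<Otimes>b\<in>B. if t = b then b [^] e else \<one>)"
    using assms by (intro finprod_cong') auto
  also have "\<dots> = t [^] e" using assms by (intro finprod_singleton) auto
  finally show ?thesis by simp
qed

text \<open>In an abelian group only the exponent sums of a word matter, and each changes by at most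
  1 per letter.\<close>

lemma foldr_word_eq_finprod:
  assumes "finite T" "T \<subseteq> carrier G" "set w \<subseteq> T \<union> m_inv G ` T"
  shows "\<exists>k::'a \<Rightarrow> int. (\<forall>t\<in>T. \<bar>k t\<bar> \<le> int (length w)) \<and>
           foldr (\<otimes>) w \<one> = (\<Otimes>t\<in>T. t [^] k t)"
  using assms(3)
proof (induction w)
  case Nil
  have "(\<Otimes>t\<in>T. t [^] (0::int)) = \<one>"
    using assms by (intro finprod_one_eqI) auto
  thus ?case by (intro exI[of _ "\<lambda>_. 0"]) simp
next
  case (Cons a w)
  have "set w \<subseteq> T \<union> m_inv G ` T" using Cons.prems by simp
  from Cons.IH[OF this] obtain k :: "'a \<Rightarrow> int" where k: "\<forall>t\<in>T. \<bar>k t\<bar> \<le> int (length w)"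
    and w: "foldr (\<otimes>) w \<one> = (\<Otimes>t\<in>T. t [^] k t)" by (elim exE conjE) (rule that)
  obtain t where t: "t \<in> T" "a = t \<or> a = inv t" using Cons.prems by auto
  hence tc: "t \<in> carrier G" using assms(2) by blast
  obtain e :: int where e: "\<bar>e\<bar> \<le> 1" "a = t [^] e"
  proof (cases "a = t")
    case True
    show thesis by (rule that[of 1]) (use True tc in simp_all)
  next
    case False
    have "t [^] (-1::int) = inv t" using int_pow_neg[OF tc, of 1] tc by simp
    thus thesis using False t(2) by (intro that[of "-1"]) simp_all
  qed
  have "foldr (\<otimes>) (a # w) \<one> = (\<Otimes>b\<in>T. b [^] (if b = t then e else 0)) \<otimes> (\<Otimes>t\<in>T. t [^] k t)"
    by (simp only: foldr.simps o_apply w e(2) finprod_int_pow_single[OF assms(1,2) t(1)])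
  also have "\<dots> = (\<Otimes>b\<in>T. b [^] ((if b = t then e else 0) + k b))"
    by (rule finprod_int_pow_add[OF assms(2), symmetric])
  finally have eq: "foldr (\<otimes>) (a # w) \<one> = (\<Otimes>b\<in>T. b [^] ((if b = t then e else 0) + k b))" .
  have "\<forall>b\<in>T. \<bar>(if b = t then e else 0) + k b\<bar> \<le> int (length (a # w))"
  proof
    fix b assume "b \<in> T"
    hence "\<bar>k b\<bar> \<le> int (length w)" using k by blast
    thus "\<bar>(if b = t then e else 0) + k b\<bar> \<le> int (length (a # w))" using e(1) by auto
  qed
  thus ?case using eq by (intro exI[of _ "\<lambda>b. (if b = t then e else 0) + k b"] conjI)
qed

lemma int_independentD:
  fixes k :: "'a \<Rightarrow> int"
  assumes "int_independent G B" "(\<Otimes>b\<in>B. b [^] k b) = \<one>"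
  shows "\<forall>b\<in>B. k b = 0"
proof -
  have "\<forall>k :: 'a \<Rightarrow> int. (\<Otimes>b\<in>B. b [^] k b) = \<one> \<longrightarrow> (\<forall>b\<in>B. k b = 0)"
    using assms(1) unfolding int_independent_def by (elim conjE)
  from this[THEN spec, of k] assms(2) show ?thesis by (rule mp)
qed

lemma not_int_independentE:
  assumes "\<not> int_independent G B" "finite B" "B \<subseteq> carrier G"
  obtains k :: "'a \<Rightarrow> int" where "(\<Otimes>b\<in>B. b [^] k b) = \<one>" "\<not> (\<forall>b\<in>B. k b = 0)"
proof -
  have "\<not> (\<forall>k :: 'a \<Rightarrow> int. (\<Otimes>b\<in>B. b [^] k b) = \<one> \<longrightarrow> (\<forall>b\<in>B. k b = 0))"
    using assms unfolding int_independent_def by (simp only: simp_thms)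
  then obtain k :: "'a \<Rightarrow> int" where "\<not> ((\<Otimes>b\<in>B. b [^] k b) = \<one> \<longrightarrow> (\<forall>b\<in>B. k b = 0))"
    by (simp only: not_all) (elim exE)
  hence "(\<Otimes>b\<in>B. b [^] k b) = \<one> \<and> \<not> (\<forall>b\<in>B. k b = 0)"
    by (rule not_imp[THEN iffD1])
  thus thesis by (elim conjE) (rule that)
qed

text \<open>Dividing the two products gives a relation with exponents \<open>k b - l b\<close>. It
  serves to count elements from below: different exponent vectors give different elements.\<close>

lemma int_independent_inj:
  fixes k l :: "'a \<Rightarrow> int"
  assumes "int_independent G B"
    and eq: "(\<Otimes>b\<in>B. b [^] k b) = (\<Otimes>b\<in>B. b [^] l b)" and "b \<in> B"
  shows "k b = l b"
proof -
  have B: "finite B" "B \<subseteq> carrier G" using assms(1) by (auto simp: int_independent_def)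
  hence cl: "(\<Otimes>b\<in>B. b [^] k b) \<in> carrier G" for k :: "'a \<Rightarrow> int"
    by (intro finprod_closed) auto
  have "(\<Otimes>b\<in>B. b [^] (k b + (- l b))) \<otimes> (\<Otimes>b\<in>B. b [^] l b) = (\<Otimes>b\<in>B. b [^] (k b + (- l b) + l b))"
    using B(2) by (simp only: finprod_int_pow_add)
  also have "\<dots> = \<one> \<otimes> (\<Otimes>b\<in>B. b [^] l b)"
    by (simp only: eq l_one[OF cl] add.assoc left_minus add_0_right)
  finally have "(\<Otimes>b\<in>B. b [^] (k b + (- l b))) = \<one>"
    by (rule iffD1[OF right_cancel[OF cl cl one_closed]])
  hence "\<forall>b\<in>B. k b + (- l b) = 0"
    by (rule int_independentD[OF assms(1)])
  thus ?thesis using \<open>b \<in> B\<close> by simp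
qed

text \<open>\<open>B\<close> has the maximal size, so adjoining \<open>t\<close> creates a
  nontrivial relation. Its coefficient at \<open>t\<close> is nonzero, since otherwise it would be a
  relation within \<open>B\<close>.\<close>

lemma power_in_span_of_maximal_independent:
  assumes "has_torsion_free_rank G s" "int_independent G B" "card B = s" "t \<in> carrier G"
  shows "\<exists>m::int. m > 0 \<and> (\<exists>l::'a \<Rightarrow> int. t [^] m = (\<Otimes>b\<in>B. b [^] l b))"
proof -
  have B: "finite B" "B \<subseteq> carrier G" using assms(2) by (auto simp: int_independent_def)
  hence cl: "(\<Otimes>b\<in>B. b [^] k b) \<in> carrier G" for k :: "'a \<Rightarrow> int"
    by (intro finprod_closed) auto
  show ?thesis
  \<comment> \<open>For \<open>t\<close> in \<open>B\<close> nothing is adjoined and maximality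
    gives no information, so that case is settled directly.\<close>
  proof (cases "t \<in> B")
    case True
    have "t [^] (1::int) = (\<Otimes>b\<in>B. b [^] (if b = t then 1 else 0 :: int))"
      by (rule finprod_int_pow_single[OF B True])
    hence "\<exists>l::'a \<Rightarrow> int. t [^] (1::int) = (\<Otimes>b\<in>B. b [^] l b)"
      by (rule exI[of _ "\<lambda>b. if b = t then 1 else 0"])
    thus ?thesis by (intro exI[of _ 1] conjI[OF zero_less_one])
  next
    case False
    have "card (insert t B) = Suc s" using False B(1) assms(3) by simp
    hence "\<not> int_independent G (insert t B)"
      using assms(1) unfolding has_torsion_free_rank_def by (metis Suc_n_not_le_n)
    moreover have "finite (insert t B)" "insert t B \<subseteq> carrier G" using B assms(4) by simp_all
    ultimately obtain k :: "'a \<Rightarrow> int" where k: "(\<Otimes>b\<in>insert t B. b [^] k b) = \<one>" "\<not> (\<forall>b\<in>insert t B. k b = 0)"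
      by (rule not_int_independentE)
    have eq: "t [^] k t \<otimes> (\<Otimes>b\<in>B. b [^] k b) = \<one>"
      using k(1) False B assms(4) by (subst (asm) finprod_insert) auto
    have kt: "k t \<noteq> 0"
    proof
      assume "k t = 0"
      hence "(\<Otimes>b\<in>B. b [^] k b) = \<one>" using eq by (simp only: int_pow_0 l_one[OF cl])
      hence "\<forall>b\<in>B. k b = 0" by (rule int_independentD[OF assms(2)])
      thus False using k(2) \<open>k t = 0\<close> by blast
    qed
    have "t [^] (k t * q) = (\<Otimes>b\<in>B. b [^] (k b * (-q)))" for q
    proof -
      have "t [^] k t = inv (\<Otimes>b\<in>B. b [^] k b)"
        by (rule inv_equality[OF eq cl int_pow_closed[OF assms(4)], symmetric])
      also have "\<dots> = (\<Otimes>b\<in>B. b [^] k b) [^] (-1::int)"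
        by (simp only: int_pow_neg[OF cl] int_pow_1[OF cl])
      finally have "t [^] (k t * q) = ((\<Otimes>b\<in>B. b [^] k b) [^] (-1::int)) [^] q"
        by (simp only: int_pow_pow[OF assms(4), symmetric])
      also have "\<dots> = (\<Otimes>b\<in>B. b [^] k b) [^] (-q)"
        by (simp only: int_pow_pow[OF cl] mult_minus1)
      finally show ?thesis by (simp only: finprod_int_pow_pow[OF B])
    qed
    \<comment> \<open>Multiplying the relation by the sign of \<open>k t\<close> makes the exponent
      of \<open>t\<close> equal to \<open>\<bar>k t\<bar>\<close>, hence positive.\<close>
    from this[of "sgn (k t)"] have "t [^] \<bar>k t\<bar> = (\<Otimes>b\<in>B. b [^] (k b * - sgn (k t)))"
      by (simp only: abs_sgn)
    hence "\<exists>l::'a \<Rightarrow> int. t [^] \<bar>k t\<bar> = (\<Otimes>b\<in>B. b [^] l b)"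
      by (rule exI[of _ "\<lambda>b. k b * - sgn (k t)"])
    thus ?thesis using kt by (intro exI[of _ "\<bar>k t\<bar>"]) simp
  qed
qed

text \<open>Reducing each exponent modulo \<open>m\<close>, where \<open>t [^] m\<close> lies in the span of \<open>B\<close>, leaves only finitely
  many cosets of the span.\<close>

lemma bounded_products_near_span:
  assumes "finite T" "T \<subseteq> carrier G" and B: "finite B" "B \<subseteq> carrier G"
    and "\<forall>t\<in>T. \<exists>m::int. m > 0 \<and> (\<exists>l::'a \<Rightarrow> int. t [^] m = (\<Otimes>b\<in>B. b [^] l b))"
  shows "\<exists>F L. finite F \<and> F \<subseteq> carrier G \<and>
    (\<forall>n. \<forall>k::'a \<Rightarrow> int. (\<forall>t\<in>T. \<bar>k t\<bar> \<le> int n) \<longrightarrow>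
      (\<exists>f\<in>F. \<exists>j::'a \<Rightarrow> int. (\<forall>b\<in>B. \<bar>j b\<bar> \<le> int (L * n)) \<and>
        (\<Otimes>t\<in>T. t [^] k t) = f \<otimes> (\<Otimes>b\<in>B. b [^] j b)))"
  using assms(1,2,5)
proof (induction T rule: finite_induct)
  case empty
  have "(\<Otimes>b\<in>B. b [^] (0::int)) = \<one>"
    using B by (intro finprod_one_eqI) auto
  hence eq: "(\<Otimes>t\<in>{}. t [^] k t) = \<one> \<otimes> (\<Otimes>b\<in>B. b [^] (0::int))" for k :: "'a \<Rightarrow> int"
    by simp
  show ?case
  proof (rule exI[of _ "{\<one>}"], rule exI[of _ 0], intro conjI allI impI)
    fix n and k :: "'a \<Rightarrow> int"
    show "\<exists>f\<in>{\<one>}. \<exists>j::'a \<Rightarrow> int. (\<forall>b\<in>B. \<bar>j b\<bar> \<le> int (0 * n)) \<and>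
        (\<Otimes>t\<in>{}. t [^] k t) = f \<otimes> (\<Otimes>b\<in>B. b [^] j b)"
      by (rule bexI[of _ \<one>], rule exI[of _ "\<lambda>_. 0"], rule conjI[OF _ eq]) auto
  qed auto
next
  case (insert t T)
  have cl: "(\<Otimes>b\<in>B. b [^] k b) \<in> carrier G" for k :: "'a \<Rightarrow> int"
    using B by (intro finprod_closed) auto
  have t: "t \<in> carrier G" "T \<subseteq> carrier G" using insert.prems by auto
  have span_T: "\<forall>t\<in>T. \<exists>m::int. m > 0 \<and> (\<exists>l::'a \<Rightarrow> int. t [^] m = (\<Otimes>b\<in>B. b [^] l b))"
    by (rule ballI) (rule bspec[OF insert.prems(2) insertI2])
  obtain F L where F: "finite F" "F \<subseteq> carrier G"
    and FL: "\<forall>n. \<forall>k::'a \<Rightarrow> int. (\<forall>t\<in>T. \<bar>k t\<bar> \<le> int n) \<longrightarrow>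
      (\<exists>f\<in>F. \<exists>j::'a \<Rightarrow> int. (\<forall>b\<in>B. \<bar>j b\<bar> \<le> int (L * n)) \<and>
        (\<Otimes>t\<in>T. t [^] k t) = f \<otimes> (\<Otimes>b\<in>B. b [^] j b))"
    using insert.IH[OF t(2) span_T] by (elim exE conjE) (rule that)
  obtain m :: int and l :: "'a \<Rightarrow> int" where m: "m > 0" and l: "t [^] m = (\<Otimes>b\<in>B. b [^] l b)"
    using bspec[OF insert.prems(2) insertI1] by (elim exE conjE) (rule that)
  define M where "M = nat (\<Sum>b\<in>B. \<bar>l b\<bar>)"
  have M: "\<bar>l b\<bar> \<le> int M" if "b \<in> B" for b
  proof -
    have "\<bar>l b\<bar> \<le> (\<Sum>b\<in>B. \<bar>l b\<bar>)" using that B by (intro member_le_sum) auto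
    thus ?thesis by (simp add: M_def)
  qed
  define F' where "F' = (\<lambda>(i,f). t [^] i \<otimes> f) ` ({0..<m} \<times> F)"
  show ?case
  proof (intro exI[of _ F'] exI[of _ "L + M"] conjI allI impI)
    show "finite F'" "F' \<subseteq> carrier G" using F t by (auto simp: F'_def)
    fix n and k :: "'a \<Rightarrow> int"
    assume k: "\<forall>t\<in>insert t T. \<bar>k t\<bar> \<le> int n"
    hence kT: "\<forall>t\<in>T. \<bar>k t\<bar> \<le> int n" by blast
    obtain f j where f: "f \<in> F" and j: "\<forall>b\<in>B. \<bar>j b\<bar> \<le> int (L * n)"
      and eq: "(\<Otimes>t\<in>T. t [^] k t) = f \<otimes> (\<Otimes>b\<in>B. b [^] j b)"
      using FL[THEN spec, THEN spec, THEN mp, OF kT] by (elim bexE exE conjE) (rule that)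
    define q where "q = k t div m"
    have fc: "f \<in> carrier G" using f F by auto
    have "t [^] k t = t [^] (k t mod m) \<otimes> (t [^] m) [^] q"
      unfolding q_def using t by (simp add: int_pow_pow flip: int_pow_mult)
    also have "(t [^] m) [^] q = (\<Otimes>b\<in>B. b [^] (l b * q))"
      unfolding l by (rule finprod_int_pow_pow[OF B])
    finally have tk: "t [^] k t = t [^] (k t mod m) \<otimes> (\<Otimes>b\<in>B. b [^] (l b * q))" .
    have "(\<Otimes>t\<in>insert t T. t [^] k t) = t [^] k t \<otimes> (\<Otimes>t\<in>T. t [^] k t)"
      using insert.hyps t by (subst finprod_insert) auto
    also have "\<dots> = (t [^] (k t mod m) \<otimes> f) \<otimes> ((\<Otimes>b\<in>B. b [^] (l b * q)) \<otimes> (\<Otimes>b\<in>B. b [^] j b))"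
      unfolding eq tk using cl fc t by (intro m_exchange) auto
    also have "\<dots> = (t [^] (k t mod m) \<otimes> f) \<otimes> (\<Otimes>b\<in>B. b [^] (l b * q + j b))"
      using B by (simp add: finprod_int_pow_add)
    finally have 1: "(\<Otimes>t\<in>insert t T. t [^] k t) = (t [^] (k t mod m) \<otimes> f) \<otimes> (\<Otimes>b\<in>B. b [^] (l b * q + j b))" .
    \<comment> \<open>\<open>div\<close> rounds downwards, so a negative \<open>k t\<close> is
      compared through \<open>k t * m \<le> k t\<close> instead of by monotonicity in the
      divisor.\<close>
    have "\<bar>q\<bar> \<le> \<bar>k t\<bar>"
    proof (cases "k t \<ge> 0")
      case True
      thus ?thesis
        unfolding q_def using m zdiv_mono2[of "k t" 1 m] by (simp add: pos_imp_zdiv_nonneg_iff)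
    next
      case False
      have "k t * m \<le> k t * 1" using m False by (intro mult_left_mono_neg) auto
      hence "(k t * m) div m \<le> k t div m" using m by (intro zdiv_mono1) auto
      moreover have "q < 0" unfolding q_def using False m by (simp add: pos_imp_zdiv_neg_iff)
      ultimately show ?thesis using m False by (simp add: q_def)
    qed
    moreover have "\<bar>k t\<bar> \<le> int n" using k by blast
    ultimately have q: "\<bar>q\<bar> \<le> int n" by linarith
    have 2: "\<bar>l b * q + j b\<bar> \<le> int ((L + M) * n)" if b: "b \<in> B" for b
    proof -
      have "\<bar>l b * q\<bar> \<le> int M * int n"
        unfolding abs_mult using M[OF b] q by (intro mult_mono) auto
      moreover have "\<bar>j b\<bar> \<le> int L * int n" using j b by simp
      moreover have "int ((L + M) * n) = int L * int n + int M * int n" by (simp add: algebra_simps)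
      ultimately show ?thesis using abs_triangle_ineq[of "l b * q" "j b"] by linarith
    qed
    have 3: "t [^] (k t mod m) \<otimes> f \<in> F'"
      using m f by (auto simp: F'_def intro!: image_eqI[of _ _ "(k t mod m, f)"])
    show "\<exists>f\<in>F'. \<exists>j::'a \<Rightarrow> int. (\<forall>b\<in>B. \<bar>j b\<bar> \<le> int ((L + M) * n)) \<and>
        (\<Otimes>t\<in>insert t T. t [^] k t) = f \<otimes> (\<Otimes>b\<in>B. b [^] j b)"
    proof (rule bexI[OF _ 3], rule exI[of _ "\<lambda>b. l b * q + j b"], rule conjI)
      show "\<forall>b\<in>B. \<bar>l b * q + j b\<bar> \<le> int ((L + M) * n)" by (rule ballI) (rule 2)
    qed (rule 1)
  qed
qed

text \<open>Counting exponent vectors over \<open>T\<close> directly would give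
  \<open>card T\<close> as the power of \<open>n\<close>. Finitely many translates of the span of a
  maximal independent set give the rank \<open>s\<close> instead. The form \<open>n + 1\<close>
  keeps the bound valid at \<open>n = 0\<close>.\<close>

lemma card_bounded_products_le:
  assumes "has_torsion_free_rank G s" "finite T" "T \<subseteq> carrier G"
  shows "\<exists>C. \<forall>n. finite {(\<Otimes>t\<in>T. t [^] k t) | k::'a \<Rightarrow> int. \<forall>t\<in>T. \<bar>k t\<bar> \<le> int n} \<and>
     card {(\<Otimes>t\<in>T. t [^] k t) | k::'a \<Rightarrow> int. \<forall>t\<in>T. \<bar>k t\<bar> \<le> int n} \<le> C * (n + 1) ^ s"
proof -
  obtain B where indep: "int_independent G B" and cB: "card B = s"
    using assms(1) by (auto simp: has_torsion_free_rank_def)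
  have B: "finite B" "B \<subseteq> carrier G" using indep by (auto simp: int_independent_def)
  have span_T: "\<forall>t\<in>T. \<exists>m::int. m > 0 \<and> (\<exists>l::'a \<Rightarrow> int. t [^] m = (\<Otimes>b\<in>B. b [^] l b))"
    by (intro ballI power_in_span_of_maximal_independent[OF assms(1) indep cB] subsetD[OF assms(3)])
  obtain F L where F: "finite F" "F \<subseteq> carrier G"
    and FL: "\<forall>n. \<forall>k::'a \<Rightarrow> int. (\<forall>t\<in>T. \<bar>k t\<bar> \<le> int n) \<longrightarrow>
      (\<exists>f\<in>F. \<exists>j::'a \<Rightarrow> int. (\<forall>b\<in>B. \<bar>j b\<bar> \<le> int (L * n)) \<and>
        (\<Otimes>t\<in>T. t [^] k t) = f \<otimes> (\<Otimes>b\<in>B. b [^] j b))"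
    using bounded_products_near_span[OF assms(2,3) B span_T]
    by (elim exE conjE) (rule that)
  have "finite {(\<Otimes>t\<in>T. t [^] k t) | k::'a \<Rightarrow> int. \<forall>t\<in>T. \<bar>k t\<bar> \<le> int n} \<and>
     card {(\<Otimes>t\<in>T. t [^] k t) | k::'a \<Rightarrow> int. \<forall>t\<in>T. \<bar>k t\<bar> \<le> int n} \<le> (card F * (2 * L + 1) ^ s) * (n + 1) ^ s"
    (is "finite ?A \<and> card ?A \<le> _") for n
  proof -
    define P where "P = F \<times> (B \<rightarrow>\<^sub>E {-int (L * n)..int (L * n)})"
    define h where "h = (\<lambda>(f, j::'a \<Rightarrow> int). f \<otimes> (\<Otimes>b\<in>B. b [^] j b))"
    have finP: "finite P" unfolding P_def using F B by (intro finite_cartesian_product finite_PiE) auto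
    have sub: "?A \<subseteq> h ` P"
    proof
      fix a assume "a \<in> ?A"
      then obtain k :: "'a \<Rightarrow> int" where ak: "a = (\<Otimes>t\<in>T. t [^] k t)"
        and k: "\<forall>t\<in>T. \<bar>k t\<bar> \<le> int n" by (elim CollectE exE conjE) (rule that)
      obtain f and j :: "'a \<Rightarrow> int" where f: "f \<in> F" and j: "\<forall>b\<in>B. \<bar>j b\<bar> \<le> int (L * n)"
        and a: "a = f \<otimes> (\<Otimes>b\<in>B. b [^] j b)"
        using FL[THEN spec, THEN spec, THEN mp, OF k] unfolding ak[symmetric] by (elim bexE exE conjE) (rule that)
      \<comment> \<open>Restricting \<open>j\<close> to \<open>B\<close> puts it into a finite set
        of extensional functions.\<close>
      have "(\<Otimes>b\<in>B. b [^] j b) = (\<Otimes>b\<in>B. b [^] restrict j B b)"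
        using B by (intro finprod_cong') auto
      hence "a = h (f, restrict j B)" using a by (simp add: h_def)
      moreover have "(f, restrict j B) \<in> P" using f j by (force simp: P_def abs_le_iff)
      ultimately show "a \<in> h ` P" by blast
    qed
    have "card ?A \<le> card P"
      using sub finP by (meson card_image_le card_mono finite_imageI order_trans)
    also have "card P = card F * (2 * (L * n) + 1) ^ s"
    proof -
      have "card {-int (L * n)..int (L * n)} = 2 * (L * n) + 1" by (simp add: nat_eq_iff)
      thus ?thesis unfolding P_def card_cartesian_product using B cB by (simp only: card_PiE prod_constant)
    qed
    also have "\<dots> \<le> card F * ((2 * L + 1) * (n + 1)) ^ s"
      by (intro mult_left_mono power_mono) (auto simp: algebra_simps)
    finally show ?thesis using finite_subset[OF sub] finP by (simp only: power_mult_distrib mult.assoc finite_imageI simp_thms)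
  qed
  thus ?thesis by (intro exI[of _ "card F * (2 * L + 1) ^ s"] allI)
qed

end

section \<open>Presented groups and the Heisenberg group\<close>

lemma word_cong_append:
  "word_cong R u v \<Longrightarrow> word_cong R (a @ u @ b) (a @ v @ b)"
proof (induction rule: word_cong.induct)
  case (cancel u x e v)
  show ?case using word_cong.cancel[of R "a @ u" x e "v @ b"] by simp
next
  case (relator w u v)
  show ?case using word_cong.relator[OF relator, of "a @ u" "v @ b"] by simp
qed (auto intro: word_cong.intros)

lemma word_class_eq_iff: "word_class R u = word_class R v \<longleftrightarrow> word_cong R u v"
  unfolding word_class_def by (auto intro: word_cong.intros)

lemma carrier_presented_group: "carrier (presented_group R) = range (word_class R)"
  by (simp add: presented_group_def)

lemma one_presented_group: "\<one>\<^bsub>presented_group R\<^esub> = word_class R []"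
  by (simp add: presented_group_def)

text \<open>The product is defined as a union over all representatives, so all the classes in this
  union have to be shown to coincide.\<close>

lemma mult_presented_group:
  "word_class R u \<otimes>\<^bsub>presented_group R\<^esub> word_class R v = word_class R (u @ v)"
proof -
  have "word_class R (u' @ v') = word_class R (u @ v)"
    if "u' \<in> word_class R u" "v' \<in> word_class R v" for u' v'
  proof -
    have "word_cong R (u @ v) (u' @ v)" "word_cong R (u' @ v) (u' @ v')"
      using that word_cong_append[of R u u' "[]" v] word_cong_append[of R v v' u' "[]"]
      by (auto simp: word_class_def)
    thus ?thesis unfolding word_class_eq_iff by (blast intro: word_cong.intros)
  qed
  moreover have "u \<in> word_class R u" "v \<in> word_class R v"
    by (auto simp: word_class_def intro: word_cong.refl)
  ultimately have "(\<Union>u'\<in>word_class R u. \<Union>v'\<in>word_class R v. word_class R (u' @ v')) = word_class R (u @ v)"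
    by blast
  thus ?thesis by (simp add: presented_group_def)
qed

lemma word_inv_Cons: "word_inv ((x, e) # w) = word_inv w @ [(x, \<not> e)]"
  by (simp add: word_inv_def)

lemma word_inv_left: "word_cong R (word_inv w @ w) []"
proof (induction w)
  case (Cons p w)
  obtain x e where p: "p = (x, e)" by (cases p)
  have "word_cong R (word_inv w @ [(x, \<not> e), (x, \<not> \<not> e)] @ w) (word_inv w @ w)"
    by (rule word_cong.cancel)
  thus ?case using Cons by (auto simp: p word_inv_Cons intro: word_cong.trans)
qed (simp add: word_inv_def word_cong.refl)

lemma group_presented_group: "group (presented_group R)"
proof (rule groupI)
  fix V assume "V \<in> carrier (presented_group R)"
  then obtain w where V: "V = word_class R w" by (auto simp: carrier_presented_group)
  show "\<exists>U\<in>carrier (presented_group R). U \<otimes>\<^bsub>presented_group R\<^esub> V = \<one>\<^bsub>presented_group R\<^esub>"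
    unfolding V one_presented_group
    by (rule bexI[of _ "word_class R (word_inv w)"])
       (auto simp: mult_presented_group word_class_eq_iff word_inv_left carrier_presented_group)
qed (auto simp: carrier_presented_group one_presented_group mult_presented_group)

lemma inv_presented_group:
  "inv\<^bsub>presented_group R\<^esub> (word_class R w) = word_class R (word_inv w)"
  by (rule group.inv_equality[OF group_presented_group])
     (auto simp: mult_presented_group one_presented_group word_class_eq_iff word_inv_left carrier_presented_group)

lemma word_class_word_comm:
  "word_class R (word_comm u v) = commutator (presented_group R) (word_class R u) (word_class R v)"
  by (simp add: commutator_def word_comm_def mult_presented_group inv_presented_group)

lemma commutator_relator:
  assumes "word_comm u v \<in> R"
  shows "word_class R u \<otimes>\<^bsub>presented_group R\<^esub> word_class R v
       = word_class R v \<otimes>\<^bsub>presented_group R\<^esub> word_class R u"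
proof -
  interpret group "presented_group R" by (rule group_presented_group)
  define U V where "U = word_class R u" and "V = word_class R v"
  have UV: "U \<in> carrier (presented_group R)" "V \<in> carrier (presented_group R)"
    by (auto simp: U_def V_def carrier_presented_group)
  have "word_class R (word_comm u v) = word_class R []"
    using word_cong.relator[OF assms, of "[]" "[]"] by (simp add: word_class_eq_iff)
  hence "commutator (presented_group R) U V = \<one>\<^bsub>presented_group R\<^esub>"
    by (simp add: word_class_word_comm one_presented_group U_def V_def)
  hence "(U \<otimes>\<^bsub>presented_group R\<^esub> V) \<otimes>\<^bsub>presented_group R\<^esub> inv\<^bsub>presented_group R\<^esub> (V \<otimes>\<^bsub>presented_group R\<^esub> U)
     = \<one>\<^bsub>presented_group R\<^esub>"
    using UV by (simp add: commutator_def inv_mult_group m_assoc)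
  hence "U \<otimes>\<^bsub>presented_group R\<^esub> V = V \<otimes>\<^bsub>presented_group R\<^esub> U"
    using UV by (metis inv_closed inv_inv inv_equality m_closed)
  thus ?thesis by (simp add: U_def V_def)
qed

text \<open>Upper unitriangular integer 3x3 matrices with corner entry \<open>z\<close>; the model
  against which the presentation is tested.\<close>

definition int_heis :: "(int \<times> int \<times> int) monoid" where
  "int_heis = \<lparr>carrier = UNIV,
     monoid.mult = (\<lambda>(x, y, z) (x', y', z'). (x + x', y + y', z + z' + x * y')),
     one = (0, 0, 0)\<rparr>"

lemma carrier_int_heis [simp]: "carrier int_heis = UNIV"
  and mult_int_heis [simp]: "(x, y, z) \<otimes>\<^bsub>int_heis\<^esub> (x', y', z') = (x + x', y + y', z + z' + x * y')"
  and one_int_heis [simp]: "\<one>\<^bsub>int_heis\<^esub> = (0, 0, 0)"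
  by (simp_all add: int_heis_def)

lemma group_int_heis: "group int_heis"
proof (rule groupI)
  fix p assume "p \<in> carrier int_heis"
  obtain x y z where p: "p = (x, y, z)" by (cases p)
  show "\<exists>q\<in>carrier int_heis. q \<otimes>\<^bsub>int_heis\<^esub> p = \<one>\<^bsub>int_heis\<^esub>"
    by (rule bexI[of _ "(-x, -y, x * y - z)"]) (auto simp: p)
qed (auto simp: algebra_simps)

lemma inv_int_heis [simp]: "inv\<^bsub>int_heis\<^esub> (x, y, z) = (-x, -y, x * y - z)"
  by (rule group.inv_equality[OF group_int_heis]) auto

text \<open>In general the corner entry of an \<open>n\<close>-th power has the extra summand
  \<open>n * (n - 1) / 2 * x * y\<close>, which the hypothesis removes. Generators and central
  elements satisfy it.\<close>

lemma int_heis_int_pow: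
  assumes "x * y = 0"
  shows "(x, y, z) [^]\<^bsub>int_heis\<^esub> (n::int) = (n * x, n * y, n * z)"
proof -
  interpret group int_heis by (rule group_int_heis)
  have nat: "(x, y, z) [^]\<^bsub>int_heis\<^esub> (k::nat) = (int k * x, int k * y, int k * z)" for k
    using assms by (induction k) (auto simp: algebra_simps)
  show ?thesis
  proof (cases "n \<ge> 0")
    case True
    thus ?thesis using nat[of "nat n"] by (simp add: int_pow_def2 del: pow_nat)
  next
    case False
    thus ?thesis using nat[of "nat (-n)"] assms by (simp add: int_pow_def2 del: pow_nat)
  qed
qed

section \<open>Words evaluated in integer matrices, and normal forms\<close>

fun heis_letter :: "heis_gen \<times> bool \<Rightarrow> int \<times> int \<times> int" where
  "heis_letter (Gen_a, e) = (if e then 1 else -1, 0, 0)"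
| "heis_letter (Gen_b, e) = (0, if e then 1 else -1, 0)"

definition heis_eval :: "heis_gen word \<Rightarrow> int \<times> int \<times> int" where
  "heis_eval w = foldr (\<lambda>l p. heis_letter l \<otimes>\<^bsub>int_heis\<^esub> p) w \<one>\<^bsub>int_heis\<^esub>"

lemma heis_eval_Nil: "heis_eval [] = \<one>\<^bsub>int_heis\<^esub>"
  and heis_eval_Cons: "heis_eval (l # w) = heis_letter l \<otimes>\<^bsub>int_heis\<^esub> heis_eval w"
  by (simp_all add: heis_eval_def)

lemma heis_eval_append: "heis_eval (u @ v) = heis_eval u \<otimes>\<^bsub>int_heis\<^esub> heis_eval v"
proof -
  interpret group int_heis by (rule group_int_heis)
  show ?thesis
    by (induction u) (simp_all add: heis_eval_Nil heis_eval_Cons m_assoc del: one_int_heis)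
qed

text \<open>Both relators evaluate to the identity, so evaluation descends to classes. This
  direction excludes a collapse of the presentation: different evaluations mean different
  classes.\<close>

lemma heis_eval_cong:
  "word_cong heis_relators u v \<Longrightarrow> heis_eval u = heis_eval v"
proof (induction rule: word_cong.induct)
  case (cancel u x e v)
  interpret group int_heis by (rule group_int_heis)
  have "heis_eval [(x, e), (x, \<not> e)] = \<one>\<^bsub>int_heis\<^esub>"
    by (cases x) (auto simp: heis_eval_Nil heis_eval_Cons)
  thus ?case by (simp add: heis_eval_append del: one_int_heis append_Cons)
next
  case (relator w u v)
  interpret group int_heis by (rule group_int_heis)
  have "heis_eval w = \<one>\<^bsub>int_heis\<^esub>"
    using relator
    by (auto simp: heis_relators_def word_comm_def word_inv_def heis_eval_Nil heis_eval_Cons)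
  thus ?case by (simp add: heis_eval_append del: one_int_heis)
qed auto

text \<open>Conjugation by \<open>d\<close> is a homomorphism sending \<open>b\<close> to
  \<open>b \<otimes> e\<close>, and a power of a product of commuting elements splits. With
  \<open>e\<close> a commutator this is the price of moving a generator past a power; with
  \<open>e = \<one>\<close> it is plain commutation.\<close>

lemma (in group) conj_int_pow:
  fixes n :: int
  assumes "d \<in> carrier G" "b \<in> carrier G" "e \<in> carrier G"
    and "d \<otimes> b = b \<otimes> e \<otimes> d" "b \<otimes> e = e \<otimes> b"
  shows "d \<otimes> b [^] n = b [^] n \<otimes> e [^] n \<otimes> d"
proof -
  have hom: "(\<lambda>x. d \<otimes> x \<otimes> inv d) \<in> hom G G"
    using assms by (auto simp: hom_def m_assoc inv_solve_left)
  have "d \<otimes> b \<otimes> inv d = b \<otimes> e"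
    using assms by (metis inv_solve_right m_closed)
  hence "d \<otimes> b [^] n \<otimes> inv d = (b \<otimes> e) [^] n"
    using hom_int_pow[OF hom assms(2) is_group is_group, of n] by simp
  also have "\<dots> = b [^] n \<otimes> e [^] n"
    using assms by (intro int_pow_mult_distrib) auto
  finally show ?thesis
    using assms by (metis inv_solve_right int_pow_closed m_closed)
qed

lemma (in group) int_pow_commute:
  fixes m n :: int
  assumes "x \<in> carrier G" "y \<in> carrier G" "x \<otimes> y = y \<otimes> x"
  shows "x [^] m \<otimes> y [^] n = y [^] n \<otimes> x [^] m"
proof -
  have *: "x \<otimes> y [^] n = y [^] n \<otimes> x"
    if "x \<in> carrier G" "y \<in> carrier G" "x \<otimes> y = y \<otimes> x" for x y and n :: int
    using conj_int_pow[of x y \<one> n] that by simp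
  show ?thesis
    using *[of "y [^] n" x m] *[of x y n] assms by simp
qed

lemma (in group) commutator_mult:
  assumes "x \<in> carrier G" "y \<in> carrier G"
  shows "commutator G x y \<otimes> y \<otimes> x = x \<otimes> y"
proof -
  have "z \<otimes> inv w \<otimes> w = z" if "w \<in> carrier G" "z \<in> carrier G" for w z
    using that by (simp add: m_assoc)
  thus ?thesis using assms by (simp add: commutator_def)
qed

lemma group_heisenberg: "group heisenberg"
  unfolding heisenberg_def by (rule group_presented_group)

lemma heis_ab_carrier [simp]: "heis_a \<in> carrier heisenberg" "heis_b \<in> carrier heisenberg"
  by (simp_all add: heis_a_def heis_b_def heisenberg_def carrier_presented_group)

abbreviation heis_central :: "heis_gen word set" where
  "heis_central \<equiv> commutator heisenberg heis_a heis_b"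

lemma heis_central_commutes:
  shows "heis_central \<in> carrier heisenberg"
    and "heis_central \<otimes>\<^bsub>heisenberg\<^esub> heis_a = heis_a \<otimes>\<^bsub>heisenberg\<^esub> heis_central"
    and "heis_central \<otimes>\<^bsub>heisenberg\<^esub> heis_b = heis_b \<otimes>\<^bsub>heisenberg\<^esub> heis_central"
proof -
  have c: "heis_central = word_class heis_relators (word_comm letter_a letter_b)"
    by (simp add: word_class_word_comm heisenberg_def heis_a_def heis_b_def)
  show "heis_central \<in> carrier heisenberg"
    unfolding c unfolding heisenberg_def carrier_presented_group by (rule rangeI)
  show "heis_central \<otimes>\<^bsub>heisenberg\<^esub> heis_a = heis_a \<otimes>\<^bsub>heisenberg\<^esub> heis_central"
    "heis_central \<otimes>\<^bsub>heisenberg\<^esub> heis_b = heis_b \<otimes>\<^bsub>heisenberg\<^esub> heis_central"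
    unfolding c unfolding heis_a_def heis_b_def heisenberg_def
    by (intro commutator_relator; simp add: heis_relators_def)+
qed

text \<open>With \<open>b\<close> before \<open>a\<close>, the normal form evaluates to exactly \<open>(x, y, z)\<close>; the order
  \<open>a, b\<close> would give \<open>(x, y, z + x * y)\<close>.\<close>

definition heis_normal_form :: "int \<times> int \<times> int \<Rightarrow> heis_gen word set" where
  "heis_normal_form = (\<lambda>(x, y, z). heis_b [^]\<^bsub>heisenberg\<^esub> y \<otimes>\<^bsub>heisenberg\<^esub> heis_a [^]\<^bsub>heisenberg\<^esub> x
     \<otimes>\<^bsub>heisenberg\<^esub> heis_central [^]\<^bsub>heisenberg\<^esub> z)"

text \<open>Left multiplication by a letter acts on normal forms exactly as in the matrix group. The
  only collection step is at the front: moving \<open>a\<close> past the \<open>y\<close>-th power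
  of \<open>b\<close> costs the \<open>y\<close>-th power of the central element, moving the inverse
  of \<open>a\<close> costs the inverse of that.\<close>

lemma heis_normal_form_letter:
  "word_class heis_relators [l] \<otimes>\<^bsub>heisenberg\<^esub> heis_normal_form p
   = heis_normal_form (heis_letter l \<otimes>\<^bsub>int_heis\<^esub> p)"
proof -
  interpret group heisenberg by (rule group_heisenberg)
  note [simp] = heis_central_commutes(1)
  define b c where "b = (\<lambda>n::int. heis_b [^]\<^bsub>heisenberg\<^esub> n)" and "c = (\<lambda>n::int. heis_central [^]\<^bsub>heisenberg\<^esub> n)"
  define a where "a = (\<lambda>n::int. heis_a [^]\<^bsub>heisenberg\<^esub> n)"
  have cl [simp]: "a n \<in> carrier heisenberg" "b n \<in> carrier heisenberg" "c n \<in> carrier heisenberg" for n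
    by (simp_all add: a_def b_def c_def)
  have add: "a m \<otimes>\<^bsub>heisenberg\<^esub> a n = a (m + n)" "b m \<otimes>\<^bsub>heisenberg\<^esub> b n = b (m + n)"
    "c m \<otimes>\<^bsub>heisenberg\<^esub> c n = c (m + n)" for m n
    by (simp_all add: a_def b_def c_def int_pow_mult)
  have one: "a 1 = heis_a" "b 1 = heis_b" "c 1 = heis_central"
    by (simp_all add: a_def b_def c_def)
  have zero: "a 0 = \<one>\<^bsub>heisenberg\<^esub>" "c 0 = \<one>\<^bsub>heisenberg\<^esub>"
    by (simp_all add: a_def c_def)
  have ca: "c n \<otimes>\<^bsub>heisenberg\<^esub> a m = a m \<otimes>\<^bsub>heisenberg\<^esub> c n" for m n
    unfolding a_def c_def by (intro int_pow_commute heis_central_commutes) simp_all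
  have cb: "c n \<otimes>\<^bsub>heisenberg\<^esub> b m = b m \<otimes>\<^bsub>heisenberg\<^esub> c n" for m n
    unfolding b_def c_def by (intro int_pow_commute heis_central_commutes) simp_all
  have "heis_a \<otimes>\<^bsub>heisenberg\<^esub> heis_b = heis_central \<otimes>\<^bsub>heisenberg\<^esub> heis_b \<otimes>\<^bsub>heisenberg\<^esub> heis_a"
    by (rule commutator_mult[symmetric]) (rule heis_ab_carrier)+
  also have "\<dots> = heis_b \<otimes>\<^bsub>heisenberg\<^esub> heis_central \<otimes>\<^bsub>heisenberg\<^esub> heis_a"
    by (simp only: heis_central_commutes(3))
  finally have ab: "heis_a \<otimes>\<^bsub>heisenberg\<^esub> heis_b = heis_b \<otimes>\<^bsub>heisenberg\<^esub> heis_central \<otimes>\<^bsub>heisenberg\<^esub> heis_a" .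
  have pos: "a 1 \<otimes>\<^bsub>heisenberg\<^esub> b y = b y \<otimes>\<^bsub>heisenberg\<^esub> c y \<otimes>\<^bsub>heisenberg\<^esub> a 1" for y
    unfolding one unfolding b_def c_def
    by (rule conj_int_pow[OF _ _ _ ab heis_central_commutes(3)[symmetric]])
       (rule heis_ab_carrier heis_central_commutes(1))+
  \<comment> \<open>Derived from \<open>pos\<close> by multiplying with \<open>a (-1)\<close> from
    both sides and cancelling \<open>c y\<close> against \<open>c (-y)\<close>.\<close>
  have neg: "a (-1) \<otimes>\<^bsub>heisenberg\<^esub> b y = b y \<otimes>\<^bsub>heisenberg\<^esub> c (-y) \<otimes>\<^bsub>heisenberg\<^esub> a (-1)" for y
  proof -
    have "a (-1) \<otimes>\<^bsub>heisenberg\<^esub> (a 1 \<otimes>\<^bsub>heisenberg\<^esub> b y) \<otimes>\<^bsub>heisenberg\<^esub> c (-y) \<otimes>\<^bsub>heisenberg\<^esub> a (-1)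
      = a (-1) \<otimes>\<^bsub>heisenberg\<^esub> b y \<otimes>\<^bsub>heisenberg\<^esub> ((c y \<otimes>\<^bsub>heisenberg\<^esub> a 1) \<otimes>\<^bsub>heisenberg\<^esub> (c (-y) \<otimes>\<^bsub>heisenberg\<^esub> a (-1)))"
      unfolding pos by (simp add: m_assoc)
    also have "\<dots> = a (-1) \<otimes>\<^bsub>heisenberg\<^esub> b y \<otimes>\<^bsub>heisenberg\<^esub> (a 1 \<otimes>\<^bsub>heisenberg\<^esub> (c y \<otimes>\<^bsub>heisenberg\<^esub> c (-y)) \<otimes>\<^bsub>heisenberg\<^esub> a (-1))"
      by (simp add: ca m_assoc)
    also have "\<dots> = a (-1) \<otimes>\<^bsub>heisenberg\<^esub> b y"
      by (simp add: add zero)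
    also have "a (-1) \<otimes>\<^bsub>heisenberg\<^esub> (a 1 \<otimes>\<^bsub>heisenberg\<^esub> b y) = b y"
      by (simp add: m_assoc[symmetric] add zero)
    finally show ?thesis by simp
  qed
  have lett: "word_class heis_relators [(Gen_a, True)] = a 1" "word_class heis_relators [(Gen_b, True)] = b 1"
    by (simp_all add: one heis_a_def heis_b_def)
  have minus1: "g [^]\<^bsub>heisenberg\<^esub> (-1::int) = inv\<^bsub>heisenberg\<^esub> g" if "g \<in> carrier heisenberg" for g
    using int_pow_neg[of g 1] that by simp
  have "word_class heis_relators [(Gen_a, False)] = a (-1)"
    unfolding a_def minus1[OF heis_ab_carrier(1)] unfolding heis_a_def heisenberg_def
    by (simp add: inv_presented_group word_inv_def)
  moreover have "word_class heis_relators [(Gen_b, False)] = b (-1)"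
    unfolding b_def minus1[OF heis_ab_carrier(2)] unfolding heis_b_def heisenberg_def
    by (simp add: inv_presented_group word_inv_def)
  moreover obtain x y z where p: "p = (x, y, z)" by (cases p)
  have nf: "heis_normal_form (x, y, z) = b y \<otimes>\<^bsub>heisenberg\<^esub> a x \<otimes>\<^bsub>heisenberg\<^esub> c z" for x y z
    by (simp add: heis_normal_form_def a_def b_def c_def)
  have A: "a e \<otimes>\<^bsub>heisenberg\<^esub> (b y \<otimes>\<^bsub>heisenberg\<^esub> a x \<otimes>\<^bsub>heisenberg\<^esub> c z) = b y \<otimes>\<^bsub>heisenberg\<^esub> a (e + x) \<otimes>\<^bsub>heisenberg\<^esub> c (z + e * y)"
    if e: "e = 1 \<or> e = -1" for e
  proof -
    have "a e \<otimes>\<^bsub>heisenberg\<^esub> b y = b y \<otimes>\<^bsub>heisenberg\<^esub> c (e * y) \<otimes>\<^bsub>heisenberg\<^esub> a e"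
      using e pos neg by auto
    hence "a e \<otimes>\<^bsub>heisenberg\<^esub> (b y \<otimes>\<^bsub>heisenberg\<^esub> a x \<otimes>\<^bsub>heisenberg\<^esub> c z)
       = b y \<otimes>\<^bsub>heisenberg\<^esub> (c (e * y) \<otimes>\<^bsub>heisenberg\<^esub> (a e \<otimes>\<^bsub>heisenberg\<^esub> a x)) \<otimes>\<^bsub>heisenberg\<^esub> c z"
      by (simp add: m_assoc[symmetric])
    also have "\<dots> = b y \<otimes>\<^bsub>heisenberg\<^esub> a (e + x) \<otimes>\<^bsub>heisenberg\<^esub> (c (e * y) \<otimes>\<^bsub>heisenberg\<^esub> c z)"
      unfolding add ca by (simp add: m_assoc add)
    finally show ?thesis by (simp add: add add.commute)
  qed
  have B: "b e \<otimes>\<^bsub>heisenberg\<^esub> (b y \<otimes>\<^bsub>heisenberg\<^esub> a x \<otimes>\<^bsub>heisenberg\<^esub> c z) = b (e + y) \<otimes>\<^bsub>heisenberg\<^esub> a x \<otimes>\<^bsub>heisenberg\<^esub> c z" for e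
    by (simp add: m_assoc[symmetric] add)
  obtain g e where l: "l = (g, e)" by (cases l)
  ultimately show ?thesis
    by (cases g; cases e) (simp_all add: p l nf lett A B)
qed

text \<open>The converse to \<open>heis_eval_cong\<close>: the evaluation determines the normal
  form, and that is the class itself. Together the two lemmas solve the word problem of the
  presentation.\<close>

lemma word_class_eq_normal_form:
  "word_class heis_relators w = heis_normal_form (heis_eval w)"
proof (induction w)
  case Nil
  interpret group heisenberg by (rule group_heisenberg)
  show ?case using heis_central_commutes(1)
    by (simp add: heis_eval_Nil heis_normal_form_def) (simp add: heisenberg_def one_presented_group)
next
  case (Cons l w)
  have "word_class heis_relators (l # w)
     = word_class heis_relators [l] \<otimes>\<^bsub>heisenberg\<^esub> word_class heis_relators w"
    by (simp add: heisenberg_def mult_presented_group)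
  thus ?case using Cons by (simp add: heis_normal_form_letter heis_eval_Cons)
qed

lemma word_class_eq_iff_heis_eval:
  "word_class heis_relators u = word_class heis_relators v \<longleftrightarrow> heis_eval u = heis_eval v"
  using heis_eval_cong word_class_eq_normal_form word_class_eq_iff by metis

definition heis_coords :: "heis_gen word set \<Rightarrow> int \<times> int \<times> int" where
  "heis_coords U = heis_eval (SOME w. U = word_class heis_relators w)"

lemma heis_coords_word_class: "heis_coords (word_class heis_relators w) = heis_eval w"
  unfolding heis_coords_def
  by (rule someI2[of _ w]) (auto simp: word_class_eq_iff_heis_eval)

lemma heis_coords_hom: "heis_coords \<in> hom heisenberg int_heis"
  by (auto simp: hom_def heisenberg_def carrier_presented_group mult_presented_group
      heis_coords_word_class heis_eval_append)

lemma heis_coords_a: "heis_coords heis_a = (1, 0, 0)"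
  and heis_coords_b: "heis_coords heis_b = (0, 1, 0)"
  by (simp_all add: heis_a_def heis_b_def heis_coords_word_class heis_eval_Cons heis_eval_Nil)

lemma heis_coords_inj: "inj_on heis_coords (carrier heisenberg)"
  by (auto simp: inj_on_def heisenberg_def carrier_presented_group heis_coords_word_class
      word_class_eq_iff_heis_eval)

lemma heis_coords_surj: "heis_coords ` carrier heisenberg = UNIV"
proof -
  interpret G: group heisenberg by (rule group_heisenberg)
  interpret H: group int_heis by (rule group_int_heis)
  interpret group_hom heisenberg int_heis heis_coords
    by unfold_locales (rule heis_coords_hom)
  have c: "heis_coords heis_central = (0, 0, 1)"
    using heis_central_commutes(1) by (simp add: commutator_def heis_coords_a heis_coords_b)
  have "p \<in> heis_coords ` carrier heisenberg" for p
  proof -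
    obtain x y z where p: "p = (x, y, z)" by (cases p)
    define q where "q = heis_normal_form p"
    have q: "q = heis_normal_form p" "q \<in> carrier heisenberg"
      using heis_central_commutes(1) by (simp_all add: q_def p heis_normal_form_def)
    have "heis_coords q = p"
      using heis_central_commutes(1)
      by (simp add: q(1) p heis_normal_form_def hom_int_pow heis_coords_a heis_coords_b c int_heis_int_pow)
    thus ?thesis using q(2) by blast
  qed
  thus ?thesis by blast
qed

section \<open>Coordinates on the iterated central product\<close>

text \<open>The coordinates \<open>(i, True)\<close> and \<open>(i, False)\<close> are the exponents of \<open>a\<^sub>i\<close> and \<open>b\<^sub>i\<close>.\<close>

definition heis_index :: "nat \<Rightarrow> (nat \<times> bool) set" where
  "heis_index r = {1..r} \<times> UNIV"

lemma finite_heis_index [simp]: "finite (heis_index r)"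
  and card_heis_index: "card (heis_index r) = 2 * r"
  and mem_heis_index [simp]: "(i, e) \<in> heis_index r \<longleftrightarrow> i \<in> {1..r}"
  by (simp_all add: heis_index_def card_cartesian_product)

text \<open>The cocycle of the central extension: in copy \<open>i\<close> the matrix product adds
  \<open>x * y'\<close> to the exponent of \<open>c_i\<close>, which is \<open>\<delta> i\<close>
  times as much for \<open>c_1\<close>. In the application \<open>\<delta> 1 = 1\<close>, and the
  indices are shifted by one against the tuple \<open>D\<close>.\<close>

definition heis_form :: "nat \<Rightarrow> (nat \<Rightarrow> int) \<Rightarrow> (nat \<times> bool \<Rightarrow> int) \<Rightarrow> (nat \<times> bool \<Rightarrow> int) \<Rightarrow> int" where
  "heis_form r \<delta> u v = (\<Sum>i=1..r. \<delta> i * (u (i, True) * v (i, False)))"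

text \<open>The central extension of \<open>Z^(2r)\<close> by \<open>Z\<close> with this cocycle.
  Extensional functions make equality of vectors the same as equality at all indices.\<close>

definition heis_model :: "nat \<Rightarrow> (nat \<Rightarrow> int) \<Rightarrow> ((nat \<times> bool \<Rightarrow> int) \<times> int) monoid" where
  "heis_model r \<delta> = \<lparr>carrier = extensional (heis_index r) \<times> UNIV,
     monoid.mult = (\<lambda>(u, z) (u', z'). (\<lambda>i\<in>heis_index r. u i + u' i, z + z' + heis_form r \<delta> u u')),
     one = (\<lambda>i\<in>heis_index r. 0, 0)\<rparr>"

lemma carrier_heis_model [simp]: "carrier (heis_model r \<delta>) = extensional (heis_index r) \<times> UNIV"
  and mult_heis_model [simp]: "(u, z) \<otimes>\<^bsub>heis_model r \<delta>\<^esub> (u', z')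
    = (\<lambda>i\<in>heis_index r. u i + u' i, z + z' + heis_form r \<delta> u u')"
  and one_heis_model [simp]: "\<one>\<^bsub>heis_model r \<delta>\<^esub> = (\<lambda>i\<in>heis_index r. 0, 0)"
  by (simp_all add: heis_model_def)

lemma heis_form_add:
  "heis_form r \<delta> (\<lambda>i\<in>heis_index r. u i + u' i) v = heis_form r \<delta> u v + heis_form r \<delta> u' v"
  "heis_form r \<delta> v (\<lambda>i\<in>heis_index r. u i + u' i) = heis_form r \<delta> v u + heis_form r \<delta> v u'"
  unfolding heis_form_def sum.distrib[symmetric]
  by (intro sum.cong; simp add: algebra_simps)+

lemma heis_form_0:
  "heis_form r \<delta> (\<lambda>i\<in>heis_index r. 0) v = 0" "heis_form r \<delta> v (\<lambda>i\<in>heis_index r. 0) = 0"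
  by (auto simp: heis_form_def intro!: sum.neutral)

lemma group_heis_model: "group (heis_model r \<delta>)"
proof (rule groupI)
  fix p assume "p \<in> carrier (heis_model r \<delta>)"
  then obtain u z where p: "p = (u, z)" and u: "u \<in> extensional (heis_index r)" by auto
  let ?v = "\<lambda>i\<in>heis_index r. - u i"
  have "(?v, - z - heis_form r \<delta> ?v u) \<otimes>\<^bsub>heis_model r \<delta>\<^esub> p = \<one>\<^bsub>heis_model r \<delta>\<^esub>"
    by (auto simp: p fun_eq_iff restrict_def)
  thus "\<exists>q\<in>carrier (heis_model r \<delta>). q \<otimes>\<^bsub>heis_model r \<delta>\<^esub> p = \<one>\<^bsub>heis_model r \<delta>\<^esub>"
    by (intro bexI[of _ "(?v, - z - heis_form r \<delta> ?v u)"]) auto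
next
  fix p assume "p \<in> carrier (heis_model r \<delta>)"
  then obtain u z where p: "p = (u, z)" and u: "u \<in> extensional (heis_index r)" by auto
  show "\<one>\<^bsub>heis_model r \<delta>\<^esub> \<otimes>\<^bsub>heis_model r \<delta>\<^esub> p = p"
  proof -
    have "(\<lambda>i\<in>heis_index r. (\<lambda>i\<in>heis_index r. 0) i + u i) = u"
      by (rule extensionalityI[of _ "heis_index r"]) (use u in auto)
    thus ?thesis by (simp only: p one_heis_model mult_heis_model heis_form_0) simp
  qed
next
  fix p q s :: "(nat \<times> bool \<Rightarrow> int) \<times> int"
  obtain u z u' z' u'' z'' where pqs: "p = (u, z)" "q = (u', z')" "s = (u'', z'')"
    by (cases p; cases q; cases s)
  show "p \<otimes>\<^bsub>heis_model r \<delta>\<^esub> q \<otimes>\<^bsub>heis_model r \<delta>\<^esub> s = p \<otimes>\<^bsub>heis_model r \<delta>\<^esub> (q \<otimes>\<^bsub>heis_model r \<delta>\<^esub> s)"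
    unfolding pqs mult_heis_model heis_form_add by (auto simp: fun_eq_iff restrict_def)
qed auto

text \<open>An element with trivial \<open>a\<close>- and \<open>b\<close>-exponents is a product of powers of the elements
  \<open>c\<^sub>i c\<^sub>1\<^bsup>-d i\<^esup>\<close> as soon as its total central exponent vanishes.\<close>

lemma kernel_heis_sum_subset:
  fixes r :: nat and d :: "nat \<Rightarrow> int"
  defines "P \<equiv> heis_power r"
  assumes N: "subgroup N P" and r: "r \<ge> 1"
    and gens: "\<And>i. i \<in> {2..r} \<Longrightarrow>
       (\<lambda>j\<in>{1..r}. inv_into (carrier heisenberg) heis_coords (0, 0, if j = i then 1 else if j = 1 then - d i else 0)) \<in> N"
    and f: "f \<in> carrier P" "\<And>j. j \<in> {1..r} \<Longrightarrow> heis_coords (f j) = (0, 0, z j)"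
    and sum: "z 1 + (\<Sum>i=2..r. d i * z i) = 0"
  shows "f \<in> N"
proof -
  define h where "h p = inv_into (carrier heisenberg) heis_coords p" for p
  have h: "h p \<in> carrier heisenberg" "heis_coords (h p) = p" for p
    using heis_coords_surj by (auto simp: h_def inv_into_into f_inv_into_f)
  interpret H: group heisenberg by (rule group_heisenberg)
  interpret Z: group int_heis by (rule group_int_heis)
  interpret P: group P unfolding P_def by (rule product_group) (rule group_heisenberg)
  interpret c: group_hom heisenberg int_heis heis_coords
    by unfold_locales (rule heis_coords_hom)
  have Peq: "x = y" if "x \<in> carrier P" "y \<in> carrier P"
    "\<And>j. j \<in> {1..r} \<Longrightarrow> heis_coords (x j) = heis_coords (y j)" for x y
  proof (rule PiE_ext)
    show "x \<in> (\<Pi>\<^sub>E j\<in>{1..r}. carrier heisenberg)" "y \<in> (\<Pi>\<^sub>E j\<in>{1..r}. carrier heisenberg)"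
      using that by (simp_all add: P_def)
    fix j assume j: "j \<in> {1..r}"
    hence "x j \<in> carrier heisenberg" "y j \<in> carrier heisenberg" using that by (auto simp: P_def)
    thus "x j = y j" using that(3)[OF j] inj_onD[OF heis_coords_inj] by blast
  qed
  have proj: "(\<lambda>x. heis_coords (x j)) \<in> hom P int_heis" if "j \<in> {1..r}" for j
    using that by (auto simp: hom_def P_def PiE_iff)
  define g where "g i = (\<lambda>j\<in>{1..r}. h (0, 0, if j = i then 1 else if j = 1 then - d i else 0))" for i
  have gN: "g i \<in> N" if "i \<in> {2..r}" for i using gens[OF that] by (simp add: g_def h_def)
  have gP: "g i \<in> carrier P" for i using h by (auto simp: g_def P_def)
  have gpow: "heis_coords ((g i [^]\<^bsub>P\<^esub> n) j) = (0, 0, n * (if j = i then 1 else if j = 1 then - d i else 0))"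
    if "j \<in> {1..r}" for i j and n :: int
  proof -
    have "heis_coords ((g i [^]\<^bsub>P\<^esub> n) j) = heis_coords (g i j) [^]\<^bsub>int_heis\<^esub> n"
      by (rule hom_int_pow[OF proj[OF that] gP P.is_group Z.is_group])
    thus ?thesis using that h by (simp add: g_def int_heis_int_pow)
  qed
  \<comment> \<open>\<open>F k\<close> agrees with \<open>f\<close> on the copies from 2 to
    \<open>k\<close>, is trivial on later ones, and its first entry compensates so that the total
    central exponent is 0. Hence \<open>F 1\<close> is trivial and each step multiplies by a power
    of a single generator.\<close>
  define F where "F k = (\<lambda>j\<in>{1..r}. h (0, 0, if j = 1 then - (\<Sum>i=2..k. d i * z i) else if j \<le> k then z j else 0))" for k
  have FP: "F k \<in> carrier P" for k using h by (auto simp: F_def P_def)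
  have "F k \<in> N" if "k \<le> r" "k \<ge> 1" for k
    using that(2,1)
  proof (induction k rule: dec_induct)
    case base
    have "F 1 = \<one>\<^bsub>P\<^esub>"
      by (rule Peq[OF FP P.one_closed]) (auto simp: F_def P_def h)
    thus ?case using subgroup.one_closed[OF N] by simp
  next
    case (step k)
    have "F (Suc k) = F k \<otimes>\<^bsub>P\<^esub> g (Suc k) [^]\<^bsub>P\<^esub> z (Suc k)"
    proof (rule Peq[OF FP])
      show "F k \<otimes>\<^bsub>P\<^esub> g (Suc k) [^]\<^bsub>P\<^esub> z (Suc k) \<in> carrier P" using FP gP by simp
      fix j assume j: "j \<in> {1..r}"
      have "(g (Suc k) [^]\<^bsub>P\<^esub> z (Suc k)) j \<in> carrier heisenberg" "F k j \<in> carrier heisenberg"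
        using gP P.int_pow_closed[OF gP, of "Suc k" "z (Suc k)"] FP[of k] j by (auto simp: P_def)
      hence "heis_coords ((F k \<otimes>\<^bsub>P\<^esub> g (Suc k) [^]\<^bsub>P\<^esub> z (Suc k)) j)
         = heis_coords (F k j) \<otimes>\<^bsub>int_heis\<^esub> heis_coords ((g (Suc k) [^]\<^bsub>P\<^esub> z (Suc k)) j)"
        using j by (simp add: P_def)
      also have "\<dots> = heis_coords (F (Suc k) j)"
        using j step by (auto simp: gpow F_def h le_Suc_eq)
      finally show "heis_coords (F (Suc k) j) = heis_coords ((F k \<otimes>\<^bsub>P\<^esub> g (Suc k) [^]\<^bsub>P\<^esub> z (Suc k)) j)" ..
    qed
    moreover have "g (Suc k) [^]\<^bsub>P\<^esub> z (Suc k) \<in> N"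
      using step by (intro P.subgroup_int_pow_closed[OF N] gN) auto
    ultimately show ?case using step subgroup.m_closed[OF N] by simp
  qed
  hence "F r \<in> N" using r by simp
  \<comment> \<open>The vanishing of the total exponent is exactly what identifies the first
    entries.\<close>
  moreover have "F r = f"
    using f(2) sum by (intro Peq FP f(1)) (auto simp: F_def h)
  ultimately show ?thesis by simp
qed

section \<open>The central product identified with its coordinate model\<close>

definition central_weight :: "nat list \<Rightarrow> nat \<Rightarrow> int" where
  "central_weight D i = (if i = 1 then 1 else int (D ! (i - 2)))"

lemma heis_coords_heis_c:
  assumes "j \<in> {1..r}"
  shows "heis_c r i \<in> carrier (heis_power r)"
    and "heis_coords (heis_c r i j) = (0, 0, if j = i then 1 else 0)"
proof -
  interpret H: group heisenberg by (rule group_heisenberg)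
  interpret P: group "heis_power r" by (rule product_group) (rule group_heisenberg)
  interpret c: group_hom heisenberg int_heis heis_coords
    using group_int_heis by (simp add: group_hom_def group_hom_axioms_def heis_coords_hom group_heisenberg)
  have copy: "heis_copy r i x \<in> carrier (heis_power r)" if "x \<in> carrier heisenberg" for x i
    using that by (auto simp: heis_copy_def)
  show "heis_c r i \<in> carrier (heis_power r)"
    unfolding heis_c_def commutator_def by (intro P.m_closed P.inv_closed copy heis_ab_carrier)
  have "heis_c r i j = commutator heisenberg (heis_copy r i heis_a j) (heis_copy r i heis_b j)"
    using assms copy[of heis_a i] copy[of heis_b i] group_heisenberg
    by (simp add: heis_c_def commutator_def)
  thus "heis_coords (heis_c r i j) = (0, 0, if j = i then 1 else 0)"
    using assms by (simp add: commutator_def heis_copy_def heis_coords_a heis_coords_b)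
qed

text \<open>The first isomorphism theorem for the map \<open>\<phi>\<close> that reads off all
  \<open>a\<close>- and \<open>b\<close>-exponents and the total central exponent. Normality of the
  generated subgroup comes for free, since it is shown to be the kernel.\<close>

lemma H_D_iso_model:
  shows "group (H_D D)" and "\<exists>\<psi>. \<psi> \<in> iso (H_D D) (heis_model (length D + 1) (central_weight D))"
proof -
  define r where "r = length D + 1"
  define P where "P = heis_power r"
  define \<delta> where "\<delta> = central_weight D"
  have \<delta>1: "\<delta> (Suc 0) = 1" by (simp add: \<delta>_def central_weight_def)
  have r: "r \<ge> 1" by (simp add: r_def)
  interpret H: group heisenberg by (rule group_heisenberg)
  interpret Z: group int_heis by (rule group_int_heis)
  interpret M: group "heis_model r \<delta>" by (rule group_heis_model)
  interpret P: group P unfolding P_def by (rule product_group) (rule group_heisenberg)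
  interpret c: group_hom heisenberg int_heis heis_coords
    by unfold_locales (rule heis_coords_hom)
  define cx cy cz where "cx t = fst (heis_coords t)" and "cy t = fst (snd (heis_coords t))"
    and "cz t = snd (snd (heis_coords t))" for t
  have cadd: "cx (s \<otimes>\<^bsub>heisenberg\<^esub> t) = cx s + cx t" "cy (s \<otimes>\<^bsub>heisenberg\<^esub> t) = cy s + cy t"
    "cz (s \<otimes>\<^bsub>heisenberg\<^esub> t) = cz s + cz t + cx s * cy t"
    if "s \<in> carrier heisenberg" "t \<in> carrier heisenberg" for s t
    using that by (cases "heis_coords s"; cases "heis_coords t"; simp add: cx_def cy_def cz_def)+
  \<comment> \<open>In the quotient \<open>c_i\<close> becomes the \<open>\<delta> i\<close>-th
    power of \<open>c_1\<close>, so central exponents add up with these weights.\<close>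
  define \<phi> where "\<phi> f = (\<lambda>(i, e)\<in>heis_index r. if e then cx (f i) else cy (f i), \<Sum>i=1..r. \<delta> i * cz (f i))"
    for f :: "nat \<Rightarrow> heis_gen word set"
  have hom: "\<phi> \<in> hom P (heis_model r \<delta>)"
  proof (rule homI)
    fix f g assume "f \<in> carrier P" "g \<in> carrier P"
    hence fg: "f j \<in> carrier heisenberg" "g j \<in> carrier heisenberg" if "j \<in> {1..r}" for j
      using that by (auto simp: P_def)
    have 1: "(f \<otimes>\<^bsub>P\<^esub> g) j = f j \<otimes>\<^bsub>heisenberg\<^esub> g j" if "j \<in> {1..r}" for j
      using that by (simp add: P_def)
    have "(\<Sum>i=1..r. \<delta> i * cz ((f \<otimes>\<^bsub>P\<^esub> g) i))
       = (\<Sum>i=1..r. \<delta> i * cz (f i) + \<delta> i * cz (g i) + \<delta> i * (cx (f i) * cy (g i)))"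
      by (intro sum.cong) (auto simp: 1 cadd fg algebra_simps)
    thus "\<phi> (f \<otimes>\<^bsub>P\<^esub> g) = \<phi> f \<otimes>\<^bsub>heis_model r \<delta>\<^esub> \<phi> g"
      using fg by (auto simp: \<phi>_def heis_form_def sum.distrib fun_eq_iff 1 cadd)
  qed (simp add: \<phi>_def)
  interpret \<phi>: group_hom P "heis_model r \<delta>" \<phi>
    by unfold_locales (rule hom)
  have surj: "\<phi> ` carrier P = carrier (heis_model r \<delta>)"
  proof (intro equalityI subsetI)
    fix p assume "p \<in> carrier (heis_model r \<delta>)"
    then obtain u z where p: "p = (u, z)" and u: "u \<in> extensional (heis_index r)" by auto
    \<comment> \<open>The whole central coordinate is placed in the first copy, where the weight is
      1.\<close>
    define q where "q j = (u (j, True), u (j, False), if j = 1 then z else 0)" for j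
    have "\<exists>t\<in>carrier heisenberg. heis_coords t = q j" for j
      using heis_coords_surj by (metis UNIV_I imageE)
    then obtain h where h: "\<And>j. h j \<in> carrier heisenberg" "\<And>j. heis_coords (h j) = q j" by metis
    define f where "f = restrict h {1..r}"
    have "f \<in> carrier P" using h by (auto simp: f_def P_def)
    moreover have "\<phi> f = p"
    proof -
      have "(\<Sum>i=1..r. \<delta> i * cz (f i)) = (\<Sum>i=1..r. if i = 1 then z else 0)"
        by (intro sum.cong) (auto simp: f_def cz_def h q_def \<delta>1)
      also have "\<dots> = z" using r by simp
      finally show ?thesis using u
        by (auto simp: \<phi>_def p fun_eq_iff f_def cx_def cy_def h q_def extensional_def)
    qed
    ultimately show "p \<in> \<phi> ` carrier P" by blast
  qed (elim imageE, simp only: \<phi>.hom_closed)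
  define K where "K = {heis_c r i \<otimes>\<^bsub>P\<^esub> inv\<^bsub>P\<^esub> (heis_c r 1 [^]\<^bsub>P\<^esub> (D ! (i - 2))) | i. i \<in> {2..r}}"
  have cP: "heis_c r i \<in> carrier P" for i
    unfolding P_def by (rule heis_coords_heis_c(1)[of 1]) (use r in simp)
  have KP: "K \<subseteq> carrier P"
    unfolding K_def using cP by auto
  have Kc: "heis_coords ((heis_c r i \<otimes>\<^bsub>P\<^esub> inv\<^bsub>P\<^esub> (heis_c r 1 [^]\<^bsub>P\<^esub> (D ! (i - 2)))) j)
     = (0, 0, if j = i then 1 else if j = 1 then - \<delta> i else 0)" if "i \<in> {2..r}" "j \<in> {1..r}" for i j
  proof -
    have proj: "(\<lambda>x. heis_coords (x j)) \<in> hom P int_heis"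
      using that by (auto simp: hom_def P_def PiE_iff)
    interpret p: group_hom P int_heis "\<lambda>x. heis_coords (x j)"
      by unfold_locales (rule proj)
    have "(0, 0, k) [^]\<^bsub>int_heis\<^esub> n = (0, 0, int n * k)" for k n
      using int_heis_int_pow[of 0 0 k "int n"] by (simp add: int_pow_int)
    thus ?thesis
      using that by (auto simp: p.hom_nat_pow cP heis_coords_heis_c(2) \<delta>_def central_weight_def)
  qed
  have "generate P K = kernel P (heis_model r \<delta>) \<phi>"
  proof
    show "generate P K \<subseteq> kernel P (heis_model r \<delta>) \<phi>"
    proof (rule P.generate_subgroup_incl[OF _ \<phi>.subgroup_kernel], rule subsetI)
      fix f assume f: "f \<in> K"
      then obtain i where i: "i \<in> {2..r}"
        and fi: "f = heis_c r i \<otimes>\<^bsub>P\<^esub> inv\<^bsub>P\<^esub> (heis_c r 1 [^]\<^bsub>P\<^esub> (D ! (i - 2)))" by (auto simp: K_def)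
      have fc: "heis_coords (f j) = (0, 0, if j = i then 1 else if j = 1 then - \<delta> i else 0)" if "j \<in> {1..r}" for j
        unfolding fi by (rule Kc[OF i that])
      \<comment> \<open>Copy \<open>i\<close> contributes its weight \<open>\<delta> i\<close>, and
        copy 1, of weight 1, contributes \<open>- \<delta> i\<close>.\<close>
      have "(\<Sum>j=1..r. \<delta> j * cz (f j)) = (\<Sum>j=1..r. (if j = i then \<delta> i else 0) + (if j = 1 then - \<delta> i else 0))"
        using i by (intro sum.cong) (auto simp: cz_def fc \<delta>1)
      also have "\<dots> = 0" using i r unfolding sum.distrib by simp
      finally have "\<phi> f = \<one>\<^bsub>heis_model r \<delta>\<^esub>"
        by (auto simp: \<phi>_def fun_eq_iff cx_def cy_def fc)
      thus "f \<in> kernel P (heis_model r \<delta>) \<phi>" using f KP by (auto simp: kernel_def)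
    qed
  next
    show "kernel P (heis_model r \<delta>) \<phi> \<subseteq> generate P K"
    proof
      fix f assume "f \<in> kernel P (heis_model r \<delta>) \<phi>"
      hence f: "f \<in> carrier P" and \<phi>f: "\<phi> f = (\<lambda>i\<in>heis_index r. 0, 0)" by (auto simp: kernel_def)
      have "heis_coords (f j) = (0, 0, cz (f j))" if "j \<in> {1..r}" for j
      proof -
        have "fst (\<phi> f) (j, e) = 0" for e using that \<phi>f by simp
        from this[of True] this[of False] that show ?thesis
          by (simp add: \<phi>_def cx_def cy_def cz_def prod_eq_iff)
      qed
      moreover have "cz (f 1) + (\<Sum>i=2..r. \<delta> i * cz (f i)) = 0"
      proof -
        have "(\<Sum>i=1..r. \<delta> i * cz (f i)) = 0" using \<phi>f by (simp add: \<phi>_def)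
        thus ?thesis using r by (subst (asm) sum.atLeast_Suc_atMost) (auto simp: \<delta>1 numeral_2_eq_2)
      qed
      moreover have "(\<lambda>j\<in>{1..r}. inv_into (carrier heisenberg) heis_coords
          (0, 0, if j = i then 1 else if j = 1 then - \<delta> i else 0)) \<in> generate P K" if i: "i \<in> {2..r}" for i
      proof -
        define f where "f = heis_c r i \<otimes>\<^bsub>P\<^esub> inv\<^bsub>P\<^esub> (heis_c r 1 [^]\<^bsub>P\<^esub> (D ! (i - 2)))"
        have fK: "f \<in> K" using i by (auto simp: f_def K_def)
        hence fP: "f \<in> carrier P" using KP by auto
        have "(\<lambda>j\<in>{1..r}. inv_into (carrier heisenberg) heis_coords
          (0, 0, if j = i then 1 else if j = 1 then - \<delta> i else 0)) = f"
        proof (rule extensionalityI[of _ "{1..r}"])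
          show "f \<in> extensional {1..r}" using fP by (auto simp: P_def PiE_def)
          fix j assume j: "j \<in> {1..r}"
          hence "f j \<in> carrier heisenberg" using fP by (auto simp: P_def)
          thus "(\<lambda>j\<in>{1..r}. inv_into (carrier heisenberg) heis_coords
            (0, 0, if j = i then 1 else if j = 1 then - \<delta> i else 0)) j = f j"
            using inv_into_f_f[OF heis_coords_inj, of "f j"] j unfolding f_def Kc[OF i j] by simp
        qed simp
        thus ?thesis using generate.incl[OF fK] by simp
      qed
      ultimately show "f \<in> generate P K"
        using kernel_heis_sum_subset[of "generate P K" r \<delta> f "\<lambda>j. cz (f j)"]
          P.generate_is_subgroup[OF KP] f r by (simp add: P_def)
    qed
  qed
  hence HD: "H_D D = P Mod kernel P (heis_model r \<delta>) \<phi>"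
    by (simp add: H_D_def Let_def K_def P_def r_def)
  show "group (H_D D)" unfolding HD
    by (rule normal.factorgroup_is_group[OF \<phi>.normal_kernel])
  show "\<exists>\<psi>. \<psi> \<in> iso (H_D D) (heis_model (length D + 1) (central_weight D))"
    using \<phi>.FactGroup_iso_set[OF surj] unfolding HD r_def \<delta>_def by blast
qed

section \<open>Word length and conjugacy classes\<close>

context group
begin

lemma foldr_mult_closed:
  "set w \<subseteq> carrier G \<Longrightarrow> foldr (\<otimes>) w \<one> \<in> carrier G"
  by (induction w) auto

lemma foldr_mult_append:
  "set v \<subseteq> carrier G \<Longrightarrow> set w \<subseteq> carrier G \<Longrightarrow>
     foldr (\<otimes>) (v @ w) \<one> = foldr (\<otimes>) v \<one> \<otimes> foldr (\<otimes>) w \<one>"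
proof (induction v)
  case (Cons a v)
  thus ?case using foldr_mult_closed[of v] foldr_mult_closed[of w] by (simp add: m_assoc)
qed (simp add: foldr_mult_closed)

lemma word_length_le:
  "set w \<subseteq> S \<union> m_inv G ` S \<Longrightarrow> word_length G S (foldr (\<otimes>) w \<one>) \<le> length w"
  unfolding word_length_def by (rule Least_le) blast

lemma generate_imp_word:
  assumes "S \<subseteq> carrier G" "g \<in> generate G S"
  shows "\<exists>w. set w \<subseteq> S \<union> m_inv G ` S \<and> foldr (\<otimes>) w \<one> = g"
  using assms(2)
proof (induction rule: generate.induct)
  case one
  show ?case by (intro exI[of _ "[]"]) simp
next
  case (incl h)
  thus ?case using assms(1) by (intro exI[of _ "[h]"]) auto
next
  case (inv h)
  thus ?case using assms(1) by (intro exI[of _ "[inv h]"]) auto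
next
  case (eng g h)
  then obtain v w where v: "set v \<subseteq> S \<union> m_inv G ` S" "foldr (\<otimes>) v \<one> = g"
    and w: "set w \<subseteq> S \<union> m_inv G ` S" "foldr (\<otimes>) w \<one> = h" by blast
  have S: "S \<union> m_inv G ` S \<subseteq> carrier G" using assms(1) by auto
  have "foldr (\<otimes>) (v @ w) \<one> = g \<otimes> h"
    using foldr_mult_append[OF order.trans[OF v(1) S] order.trans[OF w(1) S]] v(2) w(2) by simp
  thus ?case using v(1) w(1) by (intro exI[of _ "v @ w"]) simp
qed

lemma geodesic_word:
  assumes "S \<subseteq> carrier G" "g \<in> generate G S"
  shows "\<exists>w. length w = word_length G S g \<and> set w \<subseteq> S \<union> m_inv G ` S \<and> foldr (\<otimes>) w \<one> = g"
  unfolding word_length_def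
  by (rule LeastI_ex) (use generate_imp_word[OF assms] in blast)

lemma word_length_mult_le:
  assumes "S \<subseteq> carrier G" "g \<in> generate G S" "h \<in> generate G S"
  shows "word_length G S (g \<otimes> h) \<le> word_length G S g + word_length G S h"
proof -
  obtain v w where v: "length v = word_length G S g" "set v \<subseteq> S \<union> m_inv G ` S" "foldr (\<otimes>) v \<one> = g"
    and w: "length w = word_length G S h" "set w \<subseteq> S \<union> m_inv G ` S" "foldr (\<otimes>) w \<one> = h"
    using geodesic_word[OF assms(1,2)] geodesic_word[OF assms(1,3)] by blast
  have "S \<union> m_inv G ` S \<subseteq> carrier G" using assms(1) by auto
  hence "foldr (\<otimes>) (v @ w) \<one> = g \<otimes> h"
    using foldr_mult_append[of v w] v w by auto
  thus ?thesis using word_length_le[of "v @ w" S] v w by simp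
qed

text \<open>A complete invariant labels the classes, and a class has length at most \<open>n\<close>
  iff one of its members does. So classes of bounded length correspond to the values of
  \<open>f\<close> on a ball, and minimal representatives need not be found.\<close>

lemma conj_growth_eq_card_invariant:
  assumes inv: "\<And>g h. g \<in> carrier G \<Longrightarrow> h \<in> carrier G \<Longrightarrow>
      (\<exists>k\<in>carrier G. k \<otimes> g \<otimes> inv k = h) \<longleftrightarrow> f g = f h"
  shows "conj_growth G S n = card (f ` {g\<in>carrier G. word_length G S g \<le> n})"
proof -
  define cl where "cl q = {h\<in>carrier G. f h = q}" for q
  have orbit: "orbit G (\<lambda>g. \<lambda>h\<in>carrier G. g \<otimes> h \<otimes> inv g) g = cl (f g)" if g: "g \<in> carrier G" for g
  proof (intro equalityI subsetI)
    fix h assume "h \<in> orbit G (\<lambda>g. \<lambda>h\<in>carrier G. g \<otimes> h \<otimes> inv g) g"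
    then obtain k where k: "k \<in> carrier G" "h = k \<otimes> g \<otimes> inv k" using g by (auto simp: orbit_def)
    hence "h \<in> carrier G" using g by simp
    moreover from this have "f g = f h" using inv[OF g] k by blast
    ultimately show "h \<in> cl (f g)" by (simp add: cl_def)
  next
    fix h assume "h \<in> cl (f g)"
    hence "h \<in> carrier G" "f g = f h" by (simp_all add: cl_def)
    then obtain k where "k \<in> carrier G" "k \<otimes> g \<otimes> inv k = h" using inv[OF g] by blast
    thus "h \<in> orbit G (\<lambda>g. \<lambda>h\<in>carrier G. g \<otimes> h \<otimes> inv g) g"
      using g unfolding orbit_def by force
  qed
  hence classes: "conjugacy_classes G = (\<lambda>g. cl (f g)) ` carrier G"
    unfolding conjugacy_classes_def orbits_def by auto
  have le_iff: "class_length G S (cl (f g)) \<le> n \<longleftrightarrow> (\<exists>h\<in>carrier G. f h = f g \<and> word_length G S h \<le> n)"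
    if g: "g \<in> carrier G" for g
  proof
    assume le: "class_length G S (cl (f g)) \<le> n"
    have "word_length G S ` cl (f g) \<noteq> {}" using g by (auto simp: cl_def)
    hence "class_length G S (cl (f g)) \<in> word_length G S ` cl (f g)"
      unfolding class_length_def by (rule Inf_nat_def1)
    thus "\<exists>h\<in>carrier G. f h = f g \<and> word_length G S h \<le> n" using le by (auto simp: cl_def)
  next
    assume "\<exists>h\<in>carrier G. f h = f g \<and> word_length G S h \<le> n"
    then obtain h where "h \<in> cl (f g)" "word_length G S h \<le> n" by (auto simp: cl_def)
    moreover from this(1) have "class_length G S (cl (f g)) \<le> word_length G S h"
      unfolding class_length_def by (intro cINF_lower) auto
    ultimately show "class_length G S (cl (f g)) \<le> n" by simp
  qed
  have "{\<kappa> \<in> conjugacy_classes G. class_length G S \<kappa> \<le> n} = cl ` f ` {g\<in>carrier G. word_length G S g \<le> n}"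
    (is "?L = ?R")
  proof (intro equalityI subsetI)
    fix \<kappa> assume "\<kappa> \<in> ?L"
    then obtain g where g: "g \<in> carrier G" "\<kappa> = cl (f g)" "class_length G S (cl (f g)) \<le> n"
      by (auto simp: classes)
    then obtain h where "h \<in> carrier G" "f h = f g" "word_length G S h \<le> n"
      using le_iff by blast
    thus "\<kappa> \<in> ?R" using g(2) by (metis (mono_tags, lifting) image_eqI mem_Collect_eq)
  next
    fix \<kappa> assume "\<kappa> \<in> ?R"
    then obtain g where g: "g \<in> carrier G" "word_length G S g \<le> n" "\<kappa> = cl (f g)" by auto
    thus "\<kappa> \<in> ?L" using le_iff[of g] by (auto simp: classes)
  qed
  moreover have "inj_on cl (f ` {g\<in>carrier G. word_length G S g \<le> n})"
  proof (rule inj_onI)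
    fix a b assume "a \<in> f ` {g\<in>carrier G. word_length G S g \<le> n}" and eq: "cl a = cl b"
    then obtain g where "g \<in> cl a" "f g = a" by (auto simp: cl_def)
    thus "a = b" using eq by (auto simp: cl_def)
  qed
  ultimately show ?thesis unfolding conj_growth_def by (simp add: card_image)
qed

end

lemma Gcd_int_bezout:
  fixes w :: "'i \<Rightarrow> int"
  assumes "finite I"
  shows "\<exists>a. (\<Sum>i\<in>I. a i * w i) = Gcd (w ` I)"
  using assms
proof (induction I rule: finite_induct)
  case (insert j I)
  then obtain a where a: "(\<Sum>i\<in>I. a i * w i) = Gcd (w ` I)" by auto
  obtain x y where xy: "x * w j + y * Gcd (w ` I) = gcd (w j) (Gcd (w ` I))"
    using bezout_int by blast
  have "(\<Sum>i\<in>insert j I. (if i = j then x else y * a i) * w i) = x * w j + (\<Sum>i\<in>I. y * (a i * w i))"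
    using insert.hyps by (simp, intro sum.cong) (auto simp: mult.assoc)
  also have "\<dots> = Gcd (w ` insert j I)"
    using xy a by (simp flip: sum_distrib_left)
  finally show ?case by (rule exI[where x = "\<lambda>i. if i = j then x else y * a i"])
qed simp

section \<open>Conjugacy classes in coordinates\<close>

definition content :: "nat \<Rightarrow> (nat \<Rightarrow> int) \<Rightarrow> (nat \<times> bool \<Rightarrow> int) \<Rightarrow> int" where
  "content r \<delta> v = Gcd ((\<lambda>(i, e). \<delta> i * v (i, e)) ` heis_index r)"

lemma sum_heis_index:
  "(\<Sum>x\<in>heis_index r. f x) = (\<Sum>i=1..r. f (i, True) + f (i, False))"
  using sum.cartesian_product[of "\<lambda>i e. f (i, e)" UNIV "{1..r}"]
  by (simp add: heis_index_def UNIV_bool add.commute)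

lemma content_dvd:
  assumes "i \<in> {1..r}"
  shows "content r \<delta> v dvd \<delta> i * v (i, e)"
proof -
  have "(\<lambda>(i, e). \<delta> i * v (i, e)) (i, e) \<in> (\<lambda>(i, e). \<delta> i * v (i, e)) ` heis_index r"
    using assms by (intro imageI) simp
  thus ?thesis unfolding content_def by (simp add: Gcd_dvd)
qed

text \<open>Skew-symmetrising the form gives the central exponent of a commutator. Grouped this way,
  every summand is a combination of the numbers whose gcd is the content.\<close>

lemma heis_form_commutator:
  "heis_form r \<delta> u v - heis_form r \<delta> v u = (\<Sum>i=1..r. u (i, True) * (\<delta> i * v (i, False)) - u (i, False) * (\<delta> i * v (i, True)))"
  unfolding heis_form_def sum_subtractf[symmetric] by (intro sum.cong) (auto simp: algebra_simps)

lemma content_dvd_commutator: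
  "content r \<delta> v dvd heis_form r \<delta> u v - heis_form r \<delta> v u"
  unfolding heis_form_commutator by (intro dvd_sum dvd_diff dvd_mult content_dvd)

lemma content_dvd_imp_commutator:
  assumes "content r \<delta> v dvd m"
  shows "\<exists>u\<in>extensional (heis_index r). heis_form r \<delta> u v - heis_form r \<delta> v u = m"
proof -
  obtain a where a: "(\<Sum>x\<in>heis_index r. a x * (case x of (i, e) \<Rightarrow> \<delta> i * v (i, e))) = content r \<delta> v"
    using Gcd_int_bezout[of "heis_index r" "\<lambda>(i, e). \<delta> i * v (i, e)"] by (auto simp: content_def)
  obtain q where q: "m = content r \<delta> v * q" using assms by (elim dvdE)
  \<comment> \<open>The skew form pairs \<open>u (i, True)\<close> with \<open>v (i, False)\<close>
    and, with a minus sign, \<open>u (i, False)\<close> with \<open>v (i, True)\<close>. So the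
    Bezout coefficients are swapped within each copy, and one of the two changes its sign.\<close>
  define u where "u = (\<lambda>(i, e)\<in>heis_index r. if e then q * a (i, False) else - (q * a (i, True)))"
  have "heis_form r \<delta> u v - heis_form r \<delta> v u
     = (\<Sum>i=1..r. q * (a (i, True) * (\<delta> i * v (i, True)) + a (i, False) * (\<delta> i * v (i, False))))"
    unfolding heis_form_commutator by (intro sum.cong) (auto simp: u_def algebra_simps)
  also have "\<dots> = m"
    unfolding q a[symmetric] sum_heis_index sum_distrib_left[symmetric] by simp
  finally show ?thesis by (intro bexI[of _ u]) (auto simp: u_def)
qed

text \<open>Collects what the counting uses about the group, so that neither the quotient nor the
  presentation reappears: \<open>p\<close> is a homomorphism, \<open>u\<close> is additive, and only
  \<open>z\<close> is twisted by the form.\<close>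

locale heis_coordinates = group G + A: comm_group A
  for G :: "('g, 'm) monoid_scheme" (structure) and A :: "('a, 'n) monoid_scheme" +
  fixes p :: "'g \<Rightarrow> 'a" and u :: "'g \<Rightarrow> nat \<times> bool \<Rightarrow> int" and z :: "'g \<Rightarrow> int"
    and r :: nat and \<delta> :: "nat \<Rightarrow> int"
  assumes r_pos: "r \<ge> 1" and weight_pos: "\<And>i. i \<in> {1..r} \<Longrightarrow> \<delta> i > 0"
    and p_hom: "p \<in> hom G A"
    and u_mult: "\<And>g h. g \<in> carrier G \<Longrightarrow> h \<in> carrier G \<Longrightarrow> u (g \<otimes> h) = (\<lambda>i\<in>heis_index r. u g i + u h i)"
    and z_mult: "\<And>g h. g \<in> carrier G \<Longrightarrow> h \<in> carrier G \<Longrightarrow> z (g \<otimes> h) = z g + z h + heis_form r \<delta> (u g) (u h)"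
    and bij: "bij_betw (\<lambda>g. (p g, u g, z g)) (carrier G) (carrier A \<times> extensional (heis_index r) \<times> UNIV)"
begin

lemma p_closed [simp]: "g \<in> carrier G \<Longrightarrow> p g \<in> carrier A"
  and p_mult [simp]: "g \<in> carrier G \<Longrightarrow> h \<in> carrier G \<Longrightarrow> p (g \<otimes> h) = p g \<otimes>\<^bsub>A\<^esub> p h"
  using p_hom by (auto simp: hom_def)

lemma u_extensional [simp]: "g \<in> carrier G \<Longrightarrow> u g \<in> extensional (heis_index r)"
  using bij_betwE[OF bij] by auto

lemma coords_eqI:
  assumes "g \<in> carrier G" "h \<in> carrier G" "p g = p h" "u g = u h" "z g = z h"
  shows "g = h"
  by (rule inj_onD[OF bij_betw_imp_inj_on[OF bij]]) (use assms in simp_all)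

lemma coords_exist:
  assumes "q \<in> carrier A" "v \<in> extensional (heis_index r)"
  shows "\<exists>g\<in>carrier G. p g = q \<and> u g = v \<and> z g = t"
proof -
  have "(q, v, t) \<in> (\<lambda>g. (p g, u g, z g)) ` carrier G"
    using bij_betw_imp_surj_on[OF bij] assms by simp
  thus ?thesis by (auto simp: image_iff)
qed

lemma coords_one: "p \<one> = \<one>\<^bsub>A\<^esub>" "u \<one> = (\<lambda>i\<in>heis_index r. 0)" "z \<one> = 0"
proof -
  show "p \<one> = \<one>\<^bsub>A\<^esub>" using hom_one[OF p_hom is_group A.is_group] .
  have "u \<one> i = 0" if "i \<in> heis_index r" for i
    using fun_cong[OF u_mult[OF one_closed one_closed], of i] that by simp
  thus *: "u \<one> = (\<lambda>i\<in>heis_index r. 0)"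
    by (intro extensionalityI[of _ "heis_index r"]) auto
  show "z \<one> = 0" using z_mult[of \<one> \<one>] by (simp add: * heis_form_0)
qed

text \<open>For central \<open>g\<close> the content vanishes, and then \<open>z g mod 0 = z g\<close>.\<close>

definition conj_invariant :: "'g \<Rightarrow> 'a \<times> (nat \<times> bool \<Rightarrow> int) \<times> int" where
  "conj_invariant g = (p g, u g, z g mod content r \<delta> (u g))"

lemma conj_iff_conj_invariant:
  assumes g: "g \<in> carrier G" and h: "h \<in> carrier G"
  shows "(\<exists>k\<in>carrier G. k \<otimes> g \<otimes> inv k = h) \<longleftrightarrow> conj_invariant g = conj_invariant h"
proof -
  have conj_iff: "k \<otimes> g \<otimes> inv k = h \<longleftrightarrow>
      p g = p h \<and> u g = u h \<and> z h - z g = heis_form r \<delta> (u k) (u g) - heis_form r \<delta> (u g) (u k)"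
    if k: "k \<in> carrier G" for k
  proof -
    \<comment> \<open>Clearing the inverse avoids computing the coordinates of
      \<open>inv k\<close>.\<close>
    have 1: "k \<otimes> g \<otimes> inv k = h \<longleftrightarrow> k \<otimes> g = h \<otimes> k"
      using g h k by (metis inv_solve_right m_closed)
    have 2: "k \<otimes> g = h \<otimes> k \<longleftrightarrow> p (k \<otimes> g) = p (h \<otimes> k) \<and> u (k \<otimes> g) = u (h \<otimes> k) \<and> z (k \<otimes> g) = z (h \<otimes> k)"
      using g h k coords_eqI[of "k \<otimes> g" "h \<otimes> k"] by (auto simp del: p_mult)
    have 3: "p (k \<otimes> g) = p (h \<otimes> k) \<longleftrightarrow> p g = p h"
      using g h k by (simp add: A.m_comm[of "p k" "p g"])
    have 4: "u (k \<otimes> g) = u (h \<otimes> k) \<longleftrightarrow> u g = u h"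
    proof
      assume eq: "u (k \<otimes> g) = u (h \<otimes> k)"
      show "u g = u h"
      proof (rule extensionalityI[of _ "heis_index r"])
        fix i assume "i \<in> heis_index r"
        thus "u g i = u h i" using fun_cong[OF eq, of i] g h k by (simp add: u_mult)
      qed (use g h in auto)
    qed (use g h k in \<open>simp add: u_mult add.commute\<close>)
    have 5: "z (k \<otimes> g) = z (h \<otimes> k) \<longleftrightarrow> z h - z g = heis_form r \<delta> (u k) (u g) - heis_form r \<delta> (u h) (u k)"
      using g h k by (auto simp: z_mult)
    show ?thesis unfolding 1 2 3 4 5 by (rule conj_cong[OF HOL.refl], rule conj_cong[OF HOL.refl]) simp
  qed
  show ?thesis
  proof
    assume "\<exists>k\<in>carrier G. k \<otimes> g \<otimes> inv k = h"
    then obtain k where k: "k \<in> carrier G" "p g = p h" "u g = u h"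
      "z h - z g = heis_form r \<delta> (u k) (u g) - heis_form r \<delta> (u g) (u k)"
      using conj_iff by blast
    hence "content r \<delta> (u g) dvd z h - z g" by (simp only: content_dvd_commutator)
    hence "content r \<delta> (u g) dvd z g - z h" by (subst dvd_diff_commute)
    thus "conj_invariant g = conj_invariant h"
      using k by (simp add: conj_invariant_def mod_eq_dvd_iff)
  next
    assume "conj_invariant g = conj_invariant h"
    hence gh: "p g = p h" "u g = u h" and "content r \<delta> (u g) dvd z g - z h"
      by (auto simp: conj_invariant_def mod_eq_dvd_iff)
    from this(3) have "content r \<delta> (u g) dvd z h - z g" by (subst dvd_diff_commute)
    then obtain v where v: "v \<in> extensional (heis_index r)"
      "heis_form r \<delta> v (u g) - heis_form r \<delta> (u g) v = z h - z g"
      using content_dvd_imp_commutator by blast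
    obtain k where k: "k \<in> carrier G" "u k = v"
      using coords_exist[OF A.one_closed v(1)] by blast
    have "k \<otimes> g \<otimes> inv k = h" using conj_iff[OF k(1)] gh v(2) k(2) by simp
    thus "\<exists>k\<in>carrier G. k \<otimes> g \<otimes> inv k = h" using k(1) by (rule bexI)
  qed
qed

lemma conj_growth_eq:
  "conj_growth G S n = card (conj_invariant ` {g\<in>carrier G. word_length G S g \<le> n})"
  by (rule conj_growth_eq_card_invariant) (rule conj_iff_conj_invariant)

lemma weight_bound: "\<exists>\<Delta>\<ge>1. \<forall>i\<in>{1..r}. \<delta> i \<le> int \<Delta>"
proof -
  have "\<delta> i \<le> int (nat (\<Sum>i=1..r. \<delta> i))" if "i \<in> {1..r}" for i
  proof -
    have "\<delta> i \<le> (\<Sum>i=1..r. \<delta> i)"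
      using that weight_pos by (intro member_le_sum) (auto intro: less_imp_le)
    thus ?thesis by simp
  qed
  moreover have "nat (\<Sum>i=1..r. \<delta> i) \<ge> 1"
  proof -
    have "1 \<in> {1..r}" using r_pos by simp
    thus ?thesis using calculation[of 1] weight_pos[of 1] by linarith
  qed
  ultimately show ?thesis by blast
qed

text \<open>A letter changes \<open>z\<close> by a constant plus a form value that is linear in the
  current vector, hence in the length; summing over the letters gives the square.\<close>

lemma word_coords_bound:
  assumes "finite S" "S \<subseteq> carrier G"
  shows "\<exists>K\<ge>1. \<forall>w. set w \<subseteq> S \<union> m_inv G ` S \<longrightarrow>
    (\<forall>i\<in>heis_index r. \<bar>u (foldr (\<otimes>) w \<one>) i\<bar> \<le> int (K * length w)) \<and>
    \<bar>z (foldr (\<otimes>) w \<one>)\<bar> \<le> int (K * length w ^ 2)"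
proof -
  define S' where "S' = S \<union> m_inv G ` S"
  have S': "finite S'" "S' \<subseteq> carrier G" using assms by (auto simp: S'_def)
  define k where "k = nat (\<Sum>s\<in>S'. \<bar>z s\<bar> + (\<Sum>i\<in>heis_index r. \<bar>u s i\<bar>))"
  have sk: "\<bar>z s\<bar> + (\<Sum>i\<in>heis_index r. \<bar>u s i\<bar>) \<le> int k" if "s \<in> S'" for s
  proof -
    have "\<bar>z s\<bar> + (\<Sum>i\<in>heis_index r. \<bar>u s i\<bar>) \<le> (\<Sum>s\<in>S'. \<bar>z s\<bar> + (\<Sum>i\<in>heis_index r. \<bar>u s i\<bar>))"
      using that S' by (intro member_le_sum[of s S' "\<lambda>s. \<bar>z s\<bar> + (\<Sum>i\<in>heis_index r. \<bar>u s i\<bar>)"]) (auto intro!: sum_nonneg add_nonneg_nonneg)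
    thus ?thesis by (simp add: k_def)
  qed
  have zk: "\<bar>z s\<bar> \<le> int k" if "s \<in> S'" for s
  proof -
    have "(\<Sum>i\<in>heis_index r. \<bar>u s i\<bar>) \<ge> 0" by (intro sum_nonneg) simp
    thus ?thesis using sk[OF that] by linarith
  qed
  have uk: "\<bar>u s i\<bar> \<le> int k" if "s \<in> S'" "i \<in> heis_index r" for s i
  proof -
    have "\<bar>u s i\<bar> \<le> (\<Sum>i\<in>heis_index r. \<bar>u s i\<bar>)"
      using that(2) by (intro member_le_sum) auto
    thus ?thesis using sk[OF that(1)] by linarith
  qed
  \<comment> \<open>Bounds the form: a letter has vector entries at most \<open>k\<close> and a word
    of length \<open>m\<close> has entries at most \<open>k * m\<close>, which gives
    \<open>E * m\<close>.\<close>
  define E where "E = nat (\<Sum>i=1..r. \<bar>\<delta> i\<bar>) * k * k"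
  define K where "K = Suc (k + E)"
  have main: "(\<forall>i\<in>heis_index r. \<bar>u (foldr (\<otimes>) w \<one>) i\<bar> \<le> int k * int (length w)) \<and>
    \<bar>z (foldr (\<otimes>) w \<one>)\<bar> \<le> int (k + E) * int (length w) ^ 2" if "set w \<subseteq> S'" for w
    using that
  proof (induction w)
    case (Cons s w)
    define g where "g = foldr (\<otimes>) w \<one>"
    define m where "m = int (length w)"
    have s: "s \<in> S'" "s \<in> carrier G" and g: "g \<in> carrier G"
      using Cons.prems S' foldr_mult_closed[of w] by (auto simp: g_def)
    have IH: "\<bar>u g i\<bar> \<le> int k * m" "\<bar>z g\<bar> \<le> int (k + E) * m ^ 2" if "i \<in> heis_index r" for i
      using Cons that by (auto simp: g_def m_def)
    have "\<bar>u (s \<otimes> g) i\<bar> \<le> int k * (m + 1)" if i: "i \<in> heis_index r" for i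
    proof -
      have "u (s \<otimes> g) i = u s i + u g i" using s g i by (simp add: u_mult)
      moreover have "int k * (m + 1) = int k * m + int k" by (simp add: algebra_simps)
      ultimately show ?thesis
        using uk[OF s(1) i] IH(1)[OF i] abs_triangle_ineq[of "u s i" "u g i"] by linarith
    qed
    moreover have "\<bar>z (s \<otimes> g)\<bar> \<le> int (k + E) * (m + 1) ^ 2"
    proof -
      have "\<bar>heis_form r \<delta> (u s) (u g)\<bar> \<le> (\<Sum>i=1..r. \<bar>\<delta> i * (u s (i, True) * u g (i, False))\<bar>)"
        unfolding heis_form_def by (rule sum_abs)
      also have "\<dots> \<le> (\<Sum>i=1..r. \<bar>\<delta> i\<bar> * (int k * (int k * m)))"
        unfolding abs_mult using uk[OF s(1)] IH(1)
        by (intro sum_mono mult_left_mono mult_mono) auto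
      also have "\<dots> = int E * m"
        by (simp add: E_def sum_distrib_right[symmetric] sum_nonneg)
      finally have form: "\<bar>heis_form r \<delta> (u s) (u g)\<bar> \<le> int E * m" by simp
      have "\<bar>z g\<bar> \<le> int (k + E) * m ^ 2" using IH(2)[of "(1, True)"] r_pos by simp
      moreover have "z (s \<otimes> g) = z s + z g + heis_form r \<delta> (u s) (u g)" using s g by (simp add: z_mult)
      \<comment> \<open>The increment of the square leaves room for \<open>k\<close> from the letter
        and \<open>E * m\<close> from the form.\<close>
      moreover have "int (k + E) * (m + 1) ^ 2
          = int (k + E) * m ^ 2 + 2 * (int k * m) + 2 * (int E * m) + int k + int E"
        by (simp add: algebra_simps power2_eq_square)
      moreover have "int k * m \<ge> 0" "int E * m \<ge> 0" by (simp_all add: m_def)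
      ultimately show ?thesis using form zk[OF s(1)] by linarith
    qed
    ultimately show ?case by (simp add: g_def m_def add.commute)
  qed (simp add: coords_one)
  have K: "int k * int n \<le> int (K * n)" "int (k + E) * int n ^ 2 \<le> int (K * n ^ 2)" for n
    by (simp_all add: K_def algebra_simps)
  show ?thesis
  proof (intro exI[of _ K] conjI allI impI ballI)
    fix w assume w: "set w \<subseteq> S \<union> m_inv G ` S"
    show "\<bar>z (foldr (\<otimes>) w \<one>)\<bar> \<le> int (K * length w ^ 2)"
      by (rule order.trans[OF _ K(2)]) (use main[of w] w in \<open>simp add: S'_def\<close>)
    fix i assume "i \<in> heis_index r"
    thus "\<bar>u (foldr (\<otimes>) w \<one>) i\<bar> \<le> int (K * length w)"
      by (intro order.trans[OF _ K(1)]) (use main[of w] w in \<open>simp add: S'_def\<close>)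
  qed (simp add: K_def)
qed

end

section \<open>Upper bound\<close>

context heis_coordinates
begin

lemma p_foldr:
  "set w \<subseteq> carrier G \<Longrightarrow> p (foldr (\<otimes>) w \<one>) = foldr (\<otimes>\<^bsub>A\<^esub>) (map p w) \<one>\<^bsub>A\<^esub>"
  by (induction w) (simp_all add: coords_one foldr_mult_closed)

lemma p_inv: "g \<in> carrier G \<Longrightarrow> p (inv g) = inv\<^bsub>A\<^esub> p g"
  by (rule group_hom.hom_inv[of G A]) (simp_all add: group_hom_def group_hom_axioms_def is_group A.is_group p_hom)

text \<open>Multiplying each coordinate by its weight turns the content into an ordinary gcd. This
  embeds the vectors into a box enlarged by the factor \<open>\<Delta>\<close>, and summing over all
  of that box costs only a constant factor.\<close>

lemma sum_content_le:
  fixes \<Delta> K :: nat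
  assumes "\<And>i. i \<in> {1..r} \<Longrightarrow> \<delta> i \<le> int \<Delta>" "\<Delta> * K \<ge> 1"
  defines "V \<equiv> {v \<in> heis_index r \<rightarrow>\<^sub>E {-int K..int K}. \<exists>i\<in>heis_index r. v i \<noteq> 0}"
  shows "real (\<Sum>v\<in>V. nat (content r \<delta> v))
       \<le> (3 * real (\<Delta> * K)) ^ (2 * r) * (if r = 1 then 1 + ln (real (\<Delta> * K)) else 2)"
proof -
  have fin: "finite V"
    unfolding V_def by (rule finite_subset[of _ "heis_index r \<rightarrow>\<^sub>E {-int K..int K}"]) (auto intro!: finite_PiE)
  define U where "U = {w \<in> heis_index r \<rightarrow>\<^sub>E {-int (\<Delta> * K)..int (\<Delta> * K)}. \<exists>i\<in>heis_index r. w i \<noteq> 0}"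
  have finU: "finite U"
    unfolding U_def
    by (rule finite_subset[of _ "heis_index r \<rightarrow>\<^sub>E {-int (\<Delta> * K)..int (\<Delta> * K)}"]) (auto intro!: finite_PiE)
  define scale where "scale v = (\<lambda>x\<in>heis_index r. \<delta> (fst x) * v x)" for v :: "nat \<times> bool \<Rightarrow> int"
  have pos: "\<delta> (fst x) > 0" if "x \<in> heis_index r" for x
    using that weight_pos by (cases x) auto
  have content: "content r \<delta> v = Gcd (scale v ` heis_index r)" for v
    unfolding content_def scale_def by (intro arg_cong[of _ _ Gcd] image_cong) auto
  have inj: "inj_on scale V"
  proof (rule inj_onI)
    fix v w assume vw: "v \<in> V" "w \<in> V" and eq: "scale v = scale w"
    show "v = w"
    proof (rule extensionalityI[of _ "heis_index r"])
      fix x assume x: "x \<in> heis_index r"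
      hence "\<delta> (fst x) * v x = \<delta> (fst x) * w x" using fun_cong[OF eq, of x] by (simp add: scale_def)
      thus "v x = w x" using pos[OF x] by simp
    qed (use vw in \<open>auto simp: V_def PiE_def\<close>)
  qed
  have sub: "scale ` V \<subseteq> U"
  proof
    fix w assume "w \<in> scale ` V"
    then obtain v where v: "v \<in> heis_index r \<rightarrow>\<^sub>E {-int K..int K}" "\<exists>i\<in>heis_index r. v i \<noteq> 0" "w = scale v"
      by (auto simp: V_def)
    have sc: "\<bar>scale v x\<bar> \<le> int (\<Delta> * K)" if x: "x \<in> heis_index r" for x
    proof -
      have "\<bar>v x\<bar> \<le> int K" using PiE_mem[OF v(1) x] by auto
      moreover have "\<bar>\<delta> (fst x)\<bar> \<le> int \<Delta>" using assms(1)[of "fst x"] pos[OF x] x by (cases x) auto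
      ultimately show ?thesis using x by (simp add: scale_def abs_mult mult_mono)
    qed
    have "scale v x \<in> {-int (\<Delta> * K)..int (\<Delta> * K)}" if "x \<in> heis_index r" for x
      using sc[OF that] unfolding atLeastAtMost_iff by linarith
    moreover have "scale v \<in> extensional (heis_index r)" by (simp add: scale_def)
    moreover obtain x where "x \<in> heis_index r" "v x \<noteq> 0" using v(2) by blast
    hence "\<exists>x\<in>heis_index r. scale v x \<noteq> 0" using pos[of x] by (intro bexI[of _ x]) (simp_all add: scale_def)
    ultimately show "w \<in> U" unfolding U_def v(3) by (simp add: PiE_iff)
  qed
  have "(\<Sum>v\<in>V. nat (content r \<delta> v)) = (\<Sum>w\<in>scale ` V. nat (Gcd (w ` heis_index r)))"
    by (simp add: sum.reindex[OF inj] content)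
  also have "\<dots> \<le> (\<Sum>w\<in>U. nat (Gcd (w ` heis_index r)))"
    by (rule sum_mono2[OF finU sub]) simp
  finally have le: "(\<Sum>v\<in>V. nat (content r \<delta> v)) \<le> (\<Sum>w\<in>U. nat (Gcd (w ` heis_index r)))"
    by simp
  have "real (\<Sum>v\<in>V. nat (content r \<delta> v)) \<le> real (\<Sum>w\<in>U. nat (Gcd (w ` heis_index r)))"
    using le by (rule of_nat_mono)
  also have "\<dots> \<le> (3 * real (\<Delta> * K)) ^ (2 * r) * (if r = 1 then 1 + ln (real (\<Delta> * K)) else 2)"
    unfolding U_def by (rule sum_Gcd_le_power[OF finite_heis_index card_heis_index r_pos assms(2)])
  finally show "real (\<Sum>v\<in>V. nat (content r \<delta> v))
       \<le> (3 * real (\<Delta> * K)) ^ (2 * r) * (if r = 1 then 1 + ln (real (\<Delta> * K)) else 2)" by simp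
qed

text \<open>The invariants of a ball lie in \<open>Q n \<times> W n\<close>, an estimate that
  ignores correlations between the abelian part and the rest. Finiteness belongs to the conclusion
  because the lower bound compares cardinalities inside the same set.\<close>

lemma conj_growth_upper:
  assumes S: "finite_generating_set G S" and rank: "has_torsion_free_rank A s"
  shows "\<exists>C D. C > 0 \<and> D \<ge> 1 \<and> (\<forall>n. finite (conj_invariant ` {g\<in>carrier G. word_length G S g \<le> n}) \<and>
    (n \<ge> 1 \<longrightarrow> real (conj_growth G S n) \<le> C * real n ^ (s + 2 * r) * (if r = 1 then 1 + ln (D * real n) else 1)))"
proof -
  have S': "finite S" "S \<subseteq> carrier G" "generate G S = carrier G"
    using S by (auto simp: finite_generating_set_def)
  define T where "T = p ` S"
  have T: "finite T" "T \<subseteq> carrier A" using S' by (auto simp: T_def)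
  define Q where "Q n = {(\<Otimes>\<^bsub>A\<^esub>t\<in>T. t [^]\<^bsub>A\<^esub> k t) | k::'a \<Rightarrow> int. \<forall>t\<in>T. \<bar>k t\<bar> \<le> int n}" for n
  have "\<exists>C0. \<forall>n. finite (Q n) \<and> card (Q n) \<le> C0 * (n + 1) ^ s"
    unfolding Q_def by (rule A.card_bounded_products_le[OF rank T])
  then obtain C0 where "\<forall>n. finite (Q n) \<and> card (Q n) \<le> C0 * (n + 1) ^ s" ..
  hence Q: "finite (Q n)" "card (Q n) \<le> C0 * (n + 1) ^ s" for n by simp_all
  obtain K where K1: "K \<ge> 1" and K: "\<forall>w. set w \<subseteq> S \<union> m_inv G ` S \<longrightarrow>
    (\<forall>i\<in>heis_index r. \<bar>u (foldr (\<otimes>) w \<one>) i\<bar> \<le> int (K * length w)) \<and>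
    \<bar>z (foldr (\<otimes>) w \<one>)\<bar> \<le> int (K * length w ^ 2)"
    using word_coords_bound[OF S'(1,2)] by (elim exE conjE) (rule that)
  obtain \<Delta> where \<Delta>: "\<Delta> \<ge> 1" "\<forall>i\<in>{1..r}. \<delta> i \<le> int \<Delta>" using weight_bound by blast
  define V where "V n = {v \<in> heis_index r \<rightarrow>\<^sub>E {-int (K * n)..int (K * n)}. \<exists>i\<in>heis_index r. v i \<noteq> 0}" for n
  have finV: "finite (V n)" for n
    unfolding V_def
    by (rule finite_subset[of _ "heis_index r \<rightarrow>\<^sub>E {-int (K * n)..int (K * n)}"]) (auto intro!: finite_PiE)
  \<comment> \<open>For a nonzero vector only the residues modulo the content remain. For the zero
    vector the content is 0, nothing is reduced, and \<open>z\<close> keeps its quadratic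
    range.\<close>
  define W where "W n = Sigma (V n) (\<lambda>v. {0..<content r \<delta> v}) \<union> {\<lambda>i\<in>heis_index r. 0} \<times> {-int (K * n ^ 2)..int (K * n ^ 2)}" for n
  have finW: "finite (W n)" for n unfolding W_def by (intro finite_UnI finite_SigmaI finV) auto
  have ball: "conj_invariant g \<in> Q n \<times> W n" if g: "g \<in> carrier G" "word_length G S g \<le> n" for g n
  proof -
    obtain w where w: "length w = word_length G S g" "set w \<subseteq> S \<union> m_inv G ` S" "foldr (\<otimes>) w \<one> = g"
      using geodesic_word[OF S'(2), of g] S'(3) g by auto
    have wG: "set w \<subseteq> carrier G" using w(2) S'(2) by auto
    have len: "length w \<le> n" using w(1) g(2) by simp
    \<comment> \<open>The projected word spells \<open>p g\<close> in letters from \<open>T\<close>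
      and their inverses, so its length bounds the exponents.\<close>
    have sub: "set (map p w) \<subseteq> T \<union> m_inv A ` T"
    proof
      fix a assume "a \<in> set (map p w)"
      then obtain b where b: "b \<in> set w" "a = p b" by auto
      hence "b \<in> S \<or> b \<in> m_inv G ` S" using w(2) by blast
      thus "a \<in> T \<union> m_inv A ` T"
        using S'(2) by (auto simp: T_def b(2) p_inv subset_eq)
    qed
    obtain k :: "'a \<Rightarrow> int" where k: "\<forall>t\<in>T. \<bar>k t\<bar> \<le> int (length (map p w))"
      "foldr (\<otimes>\<^bsub>A\<^esub>) (map p w) \<one>\<^bsub>A\<^esub> = (\<Otimes>\<^bsub>A\<^esub>t\<in>T. t [^]\<^bsub>A\<^esub> k t)"
      using A.foldr_word_eq_finprod[OF T sub] by (elim exE conjE) (rule that)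
    have "p g = (\<Otimes>\<^bsub>A\<^esub>t\<in>T. t [^]\<^bsub>A\<^esub> k t)" using p_foldr[OF wG] k(2) w(3) by simp
    moreover have "\<forall>t\<in>T. \<bar>k t\<bar> \<le> int n" using k(1) len by auto
    ultimately have pQ: "p g \<in> Q n" unfolding Q_def by (intro CollectI exI[of _ k] conjI)
    have ug: "\<bar>u g i\<bar> \<le> int (K * n)" if "i \<in> heis_index r" for i
    proof -
      have "\<bar>u g i\<bar> \<le> int (K * length w)" using K w that by blast
      also have "\<dots> \<le> int (K * n)" using len by (subst of_nat_le_iff) simp
      finally show ?thesis by simp
    qed
    have zg: "\<bar>z g\<bar> \<le> int (K * n ^ 2)"
    proof -
      have "\<bar>z g\<bar> \<le> int (K * length w ^ 2)" using K w by blast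
      also have "\<dots> \<le> int (K * n ^ 2)" using len by (subst of_nat_le_iff) (simp add: power_mono)
      finally show ?thesis by simp
    qed
    have "(u g, z g mod content r \<delta> (u g)) \<in> W n"
    proof (cases "\<exists>x\<in>heis_index r. u g x \<noteq> 0")
      case True
      have "u g x \<in> {-int (K * n)..int (K * n)}" if "x \<in> heis_index r" for x
        using ug[OF that] unfolding atLeastAtMost_iff by linarith
      hence "u g \<in> V n" using True g(1) unfolding V_def by (auto simp: PiE_iff)
      moreover have "content r \<delta> (u g) > 0"
      proof -
        obtain i e where ie: "i \<in> {1..r}" "u g (i, e) \<noteq> 0" using True by auto
        hence "\<delta> i * u g (i, e) \<noteq> 0" using weight_pos[OF ie(1)] by simp
        hence "content r \<delta> (u g) \<noteq> 0" using content_dvd[OF ie(1), of \<delta> "u g" e] by auto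
        moreover have "content r \<delta> (u g) \<ge> 0" by (simp add: content_def)
        ultimately show ?thesis by simp
      qed
      ultimately show ?thesis unfolding W_def by auto
    next
      case False
      hence u0: "u g = (\<lambda>i\<in>heis_index r. 0)"
        using g(1) by (intro extensionalityI[of _ "heis_index r"]) auto
      have "(\<lambda>(i, e). \<delta> i * u g (i, e)) ` heis_index r \<subseteq> {0}" using False by auto
      hence "content r \<delta> (u g) = 0" by (simp add: content_def)
      thus ?thesis using u0 zg unfolding W_def by (auto simp: abs_le_iff)
    qed
    thus ?thesis using pQ by (simp add: conj_invariant_def)
  qed
  define c where "c = 2 * (3 * real (\<Delta> * K)) ^ (2 * r) + 2 * real K + 1"
  have c0: "c > 0" unfolding c_def by (intro add_nonneg_pos add_nonneg_nonneg) auto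
  have sub: "conj_invariant ` {g\<in>carrier G. word_length G S g \<le> n} \<subseteq> Q n \<times> W n" for n
    using ball by blast
  have finB: "finite (conj_invariant ` {g\<in>carrier G. word_length G S g \<le> n})" for n
    by (rule finite_subset[OF sub]) (intro finite_cartesian_product Q(1) finW)
  have "real (conj_growth G S n) \<le> ((real C0 + 1) * 2 ^ s * c) * real n ^ (s + 2 * r) * (if r = 1 then 1 + ln (real (\<Delta> * K) * real n) else 1)"
    if n: "n \<ge> 1" for n
  proof -
    \<comment> \<open>\<open>2 * L\<close> dominates both the logarithmic factor for
      \<open>r = 1\<close> and the constant 2 for \<open>r \<ge> 2\<close>; this is the 2 in the
      first summand of \<open>c\<close>. That \<open>L \<ge> 1\<close> lets it multiply the central
      part too.\<close>
    define L where "L = (if r = 1 then 1 + ln (real (\<Delta> * K) * real n) else 1)"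
    have "real (\<Delta> * K) * real n \<ge> 1"
    proof -
      have "1 \<le> \<Delta> * K * n" using \<Delta>(1) K1 n by (simp add: Suc_le_eq)
      hence "real 1 \<le> real (\<Delta> * K * n)" by (rule of_nat_mono)
      thus ?thesis by simp
    qed
    hence L1: "L \<ge> 1" by (simp add: L_def)
    have "conj_growth G S n \<le> card (Q n \<times> W n)"
      unfolding conj_growth_eq by (intro card_mono sub finite_cartesian_product Q(1) finW)
    also have "\<dots> = card (Q n) * card (W n)" by (rule card_cartesian_product)
    finally have "real (conj_growth G S n) \<le> real (card (Q n)) * real (card (W n))"
      by (metis of_nat_le_iff of_nat_mult)
    also have "real (card (Q n)) \<le> (real C0 + 1) * 2 ^ s * real n ^ s"
    proof -
      have "real (card (Q n)) \<le> real (C0 * (n + 1) ^ s)" using Q(2) by (rule of_nat_mono)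
      also have "\<dots> = real C0 * (real n + 1) ^ s" by (simp add: add.commute)
      also have "\<dots> \<le> (real C0 + 1) * (2 * real n) ^ s"
        using n by (intro mult_mono power_mono) auto
      finally show ?thesis by (simp add: power_mult_distrib mult.assoc)
    qed
    also have "real (card (W n)) \<le> c * real n ^ (2 * r) * L"
    proof -
      have "card (W n) \<le> card (Sigma (V n) (\<lambda>v. {0..<content r \<delta> v})) + card ({\<lambda>i\<in>heis_index r. 0::int} \<times> {-int (K * n ^ 2)..int (K * n ^ 2)})"
        unfolding W_def by (rule card_Un_le)
      also have "card (Sigma (V n) (\<lambda>v. {0..<content r \<delta> v})) = (\<Sum>v\<in>V n. nat (content r \<delta> v))"
        using finV by simp
      also have "card ({\<lambda>i\<in>heis_index r. 0::int} \<times> {-int (K * n ^ 2)..int (K * n ^ 2)}) = 2 * (K * n ^ 2) + 1"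
      proof -
        have "card {-int (K * n ^ 2)..int (K * n ^ 2)} = 2 * (K * n ^ 2) + 1"
          by (simp add: nat_eq_iff)
        thus ?thesis by (simp only: card_cartesian_product card.insert) simp
      qed
      finally have "real (card (W n)) \<le> real ((\<Sum>v\<in>V n. nat (content r \<delta> v)) + (2 * (K * n ^ 2) + 1))"
        by (rule of_nat_mono)
      also have "\<dots> = real (\<Sum>v\<in>V n. nat (content r \<delta> v)) + (2 * real K * real n ^ 2 + 1)"
        by simp
      also have "real (\<Sum>v\<in>V n. nat (content r \<delta> v)) \<le> (3 * real (\<Delta> * K)) ^ (2 * r) * real n ^ (2 * r) * (2 * L)"
      proof -
        have "real (\<Sum>v\<in>V n. nat (content r \<delta> v))
          \<le> (3 * real (\<Delta> * (K * n))) ^ (2 * r) * (if r = 1 then 1 + ln (real (\<Delta> * (K * n))) else 2)"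
          unfolding V_def
          by (rule sum_content_le) (use \<Delta> K1 n in \<open>auto simp: Suc_le_eq\<close>)
        also have "\<dots> \<le> (3 * real (\<Delta> * (K * n))) ^ (2 * r) * (2 * L)"
          using L1 by (intro mult_left_mono) (auto simp: L_def mult.assoc)
        also have "(3 * real (\<Delta> * (K * n))) ^ (2 * r) = (3 * real (\<Delta> * K)) ^ (2 * r) * real n ^ (2 * r)"
          by (simp add: power_mult_distrib)
        finally show ?thesis .
      qed
      \<comment> \<open>The central classes are absorbed because
        \<open>2 \<le> 2 * r\<close>.\<close>
      also have "2 * real K * real n ^ 2 + 1 \<le> (2 * real K + 1) * real n ^ (2 * r) * L"
      proof -
        have "real n ^ 2 \<le> real n ^ (2 * r)" using n r_pos by (intro power_increasing) auto
        moreover have "1 \<le> real n ^ (2 * r)" using n by (intro one_le_power) auto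
        ultimately have "2 * real K * real n ^ 2 + 1 \<le> 2 * real K * real n ^ (2 * r) + real n ^ (2 * r)"
          by (intro add_mono mult_left_mono) auto
        also have "\<dots> = (2 * real K + 1) * real n ^ (2 * r) * 1" by (simp add: algebra_simps)
        also have "\<dots> \<le> (2 * real K + 1) * real n ^ (2 * r) * L" using L1 by (intro mult_left_mono) auto
        finally show ?thesis .
      qed
      also have "(3 * real (\<Delta> * K)) ^ (2 * r) * real n ^ (2 * r) * (2 * L) + (2 * real K + 1) * real n ^ (2 * r) * L
        = c * real n ^ (2 * r) * L"
        unfolding c_def by (simp add: algebra_simps)
      finally show ?thesis by simp
    qed
    finally have "real (conj_growth G S n) \<le> ((real C0 + 1) * 2 ^ s * real n ^ s) * (c * real n ^ (2 * r) * L)"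
      by (simp add: mult_left_mono mult_right_mono)
    also have "\<dots> = ((real C0 + 1) * 2 ^ s * c) * real n ^ (s + 2 * r) * L"
      by (simp add: power_add mult_ac)
    finally show ?thesis by (simp add: L_def)
  qed
  moreover have "(real C0 + 1) * 2 ^ s * c > 0" using c0 by simp
  moreover have "real (\<Delta> * K) \<ge> 1"
  proof -
    have "1 \<le> \<Delta> * K" using \<Delta>(1) K1 by (simp add: Suc_le_eq)
    hence "real 1 \<le> real (\<Delta> * K)" by (rule of_nat_mono)
    thus ?thesis by simp
  qed
  ultimately show ?thesis
    using finB by (intro exI[of _ "(real C0 + 1) * 2 ^ s * c"] exI[of _ "real (\<Delta> * K)"]) simp
qed

end

section \<open>Lower bound\<close>

lemma heis_form_scale:
  "heis_form r \<delta> (\<lambda>x\<in>heis_index r. c * v x) w = c * heis_form r \<delta> v w"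
  unfolding heis_form_def sum_distrib_left by (intro sum.cong) (auto simp: mult_ac)

text \<open>The form pairs \<open>a\<close>-exponents on the left with \<open>b\<close>-exponents on
  the right. Factors ordered so that these never meet in one copy multiply without a central
  correction.\<close>

lemma heis_form_eq_0I:
  assumes "\<And>i. i \<in> {1..r} \<Longrightarrow> v (i, True) = 0 \<or> w (i, False) = 0"
  shows "heis_form r \<delta> v w = 0"
  unfolding heis_form_def using assms by (intro sum.neutral ballI) auto

context heis_coordinates
begin

text \<open>Only linear bounds on the length are needed here: the central coordinate of the chosen
  representatives is below the gcd of the other ones, so distortion of the centre plays no role.\<close>

definition reach :: "'g set \<Rightarrow> 'a \<Rightarrow> (nat \<times> bool \<Rightarrow> int) \<Rightarrow> int \<Rightarrow> nat \<Rightarrow> bool" where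
  "reach S q v t m \<longleftrightarrow> (\<exists>g\<in>carrier G. p g = q \<and> u g = v \<and> z g = t \<and> word_length G S g \<le> m)"

lemma reach_mono: "reach S q v t m \<Longrightarrow> m \<le> m' \<Longrightarrow> reach S q v t m'"
  unfolding reach_def by (meson order.trans)

lemma reach_exists:
  assumes "q \<in> carrier A" "v \<in> extensional (heis_index r)"
  shows "\<exists>m. reach S q v t m"
proof -
  obtain g where "g \<in> carrier G" "p g = q" "u g = v" "z g = t"
    using coords_exist[OF assms] by blast
  thus ?thesis unfolding reach_def by blast
qed

lemma reach_closed: "reach S q v t m \<Longrightarrow> q \<in> carrier A \<and> v \<in> extensional (heis_index r)"
  unfolding reach_def by auto

context
  fixes S
  assumes S: "finite_generating_set G S"
begin

lemma reach_mult:
  assumes "reach S q v t m" "reach S q' v' t' m'"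
  shows "reach S (q \<otimes>\<^bsub>A\<^esub> q') (\<lambda>x\<in>heis_index r. v x + v' x) (t + t' + heis_form r \<delta> v v') (m + m')"
proof -
  have S': "S \<subseteq> carrier G" "generate G S = carrier G"
    using S by (auto simp: finite_generating_set_def)
  obtain g h where g: "g \<in> carrier G" "p g = q" "u g = v" "z g = t" "word_length G S g \<le> m"
    and h: "h \<in> carrier G" "p h = q'" "u h = v'" "z h = t'" "word_length G S h \<le> m'"
    using assms unfolding reach_def by blast
  have "word_length G S (g \<otimes> h) \<le> m + m'"
    using word_length_mult_le[OF S'(1), of g h] g h S'(2) by simp
  thus ?thesis unfolding reach_def
    using g h by (intro bexI[of _ "g \<otimes> h"]) (simp_all add: u_mult z_mult)
qed

lemma reach_one: "reach S \<one>\<^bsub>A\<^esub> (\<lambda>x\<in>heis_index r. 0) 0 0"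
proof -
  have "word_length G S \<one> \<le> 0" using word_length_le[of "[]" S] by simp
  thus ?thesis unfolding reach_def by (intro bexI[of _ \<one>]) (simp_all add: coords_one)
qed

text \<open>With vanishing self-pairing the powers gather no quadratic central term, so repeating
  one fixed word \<open>k\<close> times suffices.\<close>

lemma reach_pow:
  assumes "reach S q v t m" "heis_form r \<delta> v v = 0"
  shows "reach S (q [^]\<^bsub>A\<^esub> int k) (\<lambda>x\<in>heis_index r. int k * v x) (int k * t) (k * m)"
proof (induction k)
  case 0
  show ?case
    by (simp only: of_nat_0 mult_zero_left int_pow_0) (rule reach_one)
next
  case (Suc k)
  have q: "q \<in> carrier A" using reach_closed[OF assms(1)] by simp
  have "reach S (q [^]\<^bsub>A\<^esub> int k \<otimes>\<^bsub>A\<^esub> q)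
     (\<lambda>x\<in>heis_index r. (\<lambda>x\<in>heis_index r. int k * v x) x + v x) (int k * t + t + 0) (k * m + m)"
    using reach_mult[OF Suc assms(1)] unfolding heis_form_scale assms(2) by simp
  moreover have "q [^]\<^bsub>A\<^esub> int k \<otimes>\<^bsub>A\<^esub> q = q [^]\<^bsub>A\<^esub> int (Suc k)"
    unfolding int_pow_int using q by simp
  moreover have "(\<lambda>x\<in>heis_index r. (\<lambda>x\<in>heis_index r. int k * v x) x + v x) = (\<lambda>x\<in>heis_index r. int (Suc k) * v x)"
    by (rule restrict_ext) (simp add: algebra_simps)
  moreover have "int k * t + t + 0 = int (Suc k) * t" "k * m + m = Suc k * m"
    by (simp_all add: algebra_simps)
  ultimately show ?case by (simp only:)
qed

text \<open>Each basis element is lifted with zero vector and zero centre. Such lifts multiply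
  without correction, and each costs a fixed number of letters.\<close>

lemma reach_abelian:
  assumes "finite B" "B \<subseteq> carrier A"
  shows "\<exists>\<Lambda>. \<forall>n. \<forall>k::'a \<Rightarrow> nat. (\<forall>b\<in>B. k b \<le> n) \<longrightarrow>
     reach S (\<Otimes>\<^bsub>A\<^esub>b\<in>B. b [^]\<^bsub>A\<^esub> int (k b)) (\<lambda>x\<in>heis_index r. 0) 0 (\<Lambda> * n)"
  using assms
proof (induction B rule: finite_induct)
  case empty
  show ?case
    by (intro exI[of _ 0] allI impI, simp only: A.finprod_empty mult_zero_left, rule reach_one)
next
  case (insert b B)
  have bB: "b \<in> carrier A" "B \<subseteq> carrier A" using insert.prems by auto
  from insert.IH[OF bB(2)] obtain \<Lambda> where IH: "\<forall>n. \<forall>k::'a \<Rightarrow> nat. (\<forall>b\<in>B. k b \<le> n) \<longrightarrow>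
     reach S (\<Otimes>\<^bsub>A\<^esub>b\<in>B. b [^]\<^bsub>A\<^esub> int (k b)) (\<lambda>x\<in>heis_index r. 0) 0 (\<Lambda> * n)" ..
  obtain m where m: "reach S b (\<lambda>x\<in>heis_index r. 0) 0 m"
    using reach_exists[OF bB(1), of "\<lambda>x\<in>heis_index r. 0"] by auto
  show ?case
  proof (intro exI[of _ "m + \<Lambda>"] allI impI)
    fix n and k :: "'a \<Rightarrow> nat"
    assume k: "\<forall>b\<in>insert b B. k b \<le> n"
    hence kB: "\<forall>b\<in>B. k b \<le> n" and kb: "k b \<le> n" by simp_all
    have 0: "(\<lambda>x\<in>heis_index r. int (k b) * (\<lambda>x\<in>heis_index r. 0) x) = (\<lambda>x\<in>heis_index r. 0)"
      "(\<lambda>x\<in>heis_index r. (\<lambda>x\<in>heis_index r. 0) x + (\<lambda>x\<in>heis_index r. 0) x) = (\<lambda>x\<in>heis_index r. 0 :: int)"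
      by (intro restrict_ext; simp)+
    have "reach S (b [^]\<^bsub>A\<^esub> int (k b)) (\<lambda>x\<in>heis_index r. 0) 0 (k b * m)"
      using reach_pow[OF m heis_form_0(1), of "k b"] unfolding 0 by simp
    from reach_mult[OF this IH[THEN spec, THEN spec, THEN mp, OF kB]]
    have "reach S (b [^]\<^bsub>A\<^esub> int (k b) \<otimes>\<^bsub>A\<^esub> (\<Otimes>\<^bsub>A\<^esub>b\<in>B. b [^]\<^bsub>A\<^esub> int (k b))) (\<lambda>x\<in>heis_index r. 0) 0 (k b * m + \<Lambda> * n)"
      unfolding 0 heis_form_0 by simp
    moreover have "(\<Otimes>\<^bsub>A\<^esub>b\<in>insert b B. b [^]\<^bsub>A\<^esub> int (k b)) = b [^]\<^bsub>A\<^esub> int (k b) \<otimes>\<^bsub>A\<^esub> (\<Otimes>\<^bsub>A\<^esub>b\<in>B. b [^]\<^bsub>A\<^esub> int (k b))"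
      using insert.hyps bB by (intro A.finprod_insert) auto
    ultimately have "reach S (\<Otimes>\<^bsub>A\<^esub>b\<in>insert b B. b [^]\<^bsub>A\<^esub> int (k b)) (\<lambda>x\<in>heis_index r. 0) 0 (k b * m + \<Lambda> * n)"
      by (simp only:)
    moreover have "k b * m + \<Lambda> * n \<le> (m + \<Lambda>) * n"
      using mult_right_mono[OF kb, of m] by (simp add: algebra_simps)
    ultimately show "reach S (\<Otimes>\<^bsub>A\<^esub>b\<in>insert b B. b [^]\<^bsub>A\<^esub> int (k b)) (\<lambda>x\<in>heis_index r. 0) 0 ((m + \<Lambda>) * n)"
      by (rule reach_mono)
  qed
qed

text \<open>Copies are added one at a time, and within a copy the \<open>b\<close>-power precedes
  the \<open>a\<close>-power. The form then vanishes on every product, so the centre stays at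
  0.\<close>

lemma reach_heis:
  "\<exists>\<Lambda>. \<forall>n. \<forall>v. (\<forall>x\<in>heis_index r. 0 \<le> v x \<and> v x \<le> int n) \<longrightarrow>
     reach S \<one>\<^bsub>A\<^esub> (\<lambda>x\<in>heis_index r. if fst x \<le> j then v x else 0) 0 (\<Lambda> * n)"
proof (induction j)
  case 0
  have eq: "(\<lambda>x\<in>heis_index r. if fst x \<le> 0 then v x else 0) = (\<lambda>x\<in>heis_index r. 0)" for v :: "nat \<times> bool \<Rightarrow> int"
    by (rule restrict_ext) (auto simp: heis_index_def)
  show ?case
    by (intro exI[of _ 0] allI impI, simp only: eq mult_zero_left, rule reach_one)
next
  case (Suc j)
  then obtain \<Lambda> where IH: "\<forall>n. \<forall>v. (\<forall>x\<in>heis_index r. 0 \<le> v x \<and> v x \<le> int n) \<longrightarrow>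
     reach S \<one>\<^bsub>A\<^esub> (\<lambda>x\<in>heis_index r. if fst x \<le> j then v x else 0) 0 (\<Lambda> * n)" ..
  define e where "e b = (\<lambda>x\<in>heis_index r. if x = (Suc j, b) then 1 else 0 :: int)" for b
  obtain ma where ma: "reach S \<one>\<^bsub>A\<^esub> (e True) 0 ma"
    using reach_exists[OF A.one_closed, of "e True"] by (auto simp: e_def)
  obtain mb where mb: "reach S \<one>\<^bsub>A\<^esub> (e False) 0 mb"
    using reach_exists[OF A.one_closed, of "e False"] by (auto simp: e_def)
  show ?case
  proof (intro exI[of _ "\<Lambda> + (mb + ma)"] allI impI)
    fix n v assume v: "\<forall>x\<in>heis_index r. 0 \<le> v x \<and> v x \<le> int n"
    show "reach S \<one>\<^bsub>A\<^esub> (\<lambda>x\<in>heis_index r. if fst x \<le> Suc j then v x else 0) 0 ((\<Lambda> + (mb + ma)) * n)"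
    \<comment> \<open>Beyond the last copy the vector does not change; allowing all \<open>j\<close>
      keeps the induction free of bounds.\<close>
    proof (cases "Suc j \<in> {1..r}")
      case False
      have "(\<lambda>x\<in>heis_index r. if fst x \<le> Suc j then v x else 0) = (\<lambda>x\<in>heis_index r. if fst x \<le> j then v x else 0)"
        using False by (intro restrict_ext) (auto simp: heis_index_def le_Suc_eq)
      moreover have "reach S \<one>\<^bsub>A\<^esub> (\<lambda>x\<in>heis_index r. if fst x \<le> j then v x else 0) 0 (\<Lambda> * n)"
        by (rule IH[THEN spec, THEN spec, THEN mp, OF v])
      ultimately have "reach S \<one>\<^bsub>A\<^esub> (\<lambda>x\<in>heis_index r. if fst x \<le> Suc j then v x else 0) 0 (\<Lambda> * n)"
        by (simp only:)
      thus ?thesis by (rule reach_mono) simp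
    next
      case True
      have vS: "0 \<le> v (Suc j, b)" "v (Suc j, b) \<le> int n" for b
        using bspec[OF v, of "(Suc j, b)"] True by simp_all
      define x y where "x = nat (v (Suc j, True))" and "y = nat (v (Suc j, False))"
      have xy: "int x = v (Suc j, True)" "int y = v (Suc j, False)" "x \<le> n" "y \<le> n"
        using vS[of True] vS[of False] by (simp_all add: x_def y_def)
      define va vb prev where "va = (\<lambda>i\<in>heis_index r. int x * e True i)" and "vb = (\<lambda>i\<in>heis_index r. int y * e False i)"
        and "prev = (\<lambda>x\<in>heis_index r. if fst x \<le> j then v x else 0)"
      have "heis_form r \<delta> (e b) (e b) = 0" for b
        by (rule heis_form_eq_0I) (auto simp: e_def)
      hence "reach S (\<one>\<^bsub>A\<^esub> [^]\<^bsub>A\<^esub> int x) va (int x * 0) (x * ma)" "reach S (\<one>\<^bsub>A\<^esub> [^]\<^bsub>A\<^esub> int y) vb (int y * 0) (y * mb)"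
        unfolding va_def vb_def using reach_pow ma mb by blast+
      hence r: "reach S \<one>\<^bsub>A\<^esub> va 0 (x * ma)" "reach S \<one>\<^bsub>A\<^esub> vb 0 (y * mb)" by simp_all
      \<comment> \<open>In the opposite order the form would add
        \<open>\<delta> (Suc j) * x * y\<close> to the centre.\<close>
      have "heis_form r \<delta> vb va = 0"
        by (rule heis_form_eq_0I) (auto simp: va_def vb_def e_def)
      with reach_mult[OF r(2,1)] have "reach S \<one>\<^bsub>A\<^esub> (\<lambda>i\<in>heis_index r. vb i + va i) 0 (y * mb + x * ma)" by simp
      moreover have "reach S \<one>\<^bsub>A\<^esub> prev 0 (\<Lambda> * n)"
        unfolding prev_def by (rule IH[THEN spec, THEN spec, THEN mp, OF v])
      moreover have "heis_form r \<delta> prev (\<lambda>i\<in>heis_index r. vb i + va i) = 0"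
        by (rule heis_form_eq_0I) (auto simp: va_def vb_def e_def prev_def)
      ultimately have "reach S \<one>\<^bsub>A\<^esub> (\<lambda>i\<in>heis_index r. prev i + (\<lambda>i\<in>heis_index r. vb i + va i) i) 0 (\<Lambda> * n + (y * mb + x * ma))"
        using reach_mult[of "\<one>\<^bsub>A\<^esub>" prev 0 "\<Lambda> * n" "\<one>\<^bsub>A\<^esub>" "\<lambda>i\<in>heis_index r. vb i + va i" 0 "y * mb + x * ma"] by simp
      moreover have "(\<lambda>i\<in>heis_index r. prev i + (\<lambda>i\<in>heis_index r. vb i + va i) i)
         = (\<lambda>x\<in>heis_index r. if fst x \<le> Suc j then v x else 0)"
      proof (rule restrict_ext)
        fix i assume i: "i \<in> heis_index r"
        obtain l b where l: "i = (l, b)" by (cases i)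
        show "prev i + (\<lambda>i\<in>heis_index r. vb i + va i) i = (if fst i \<le> Suc j then v i else 0)"
          using i unfolding l by (cases b) (auto simp: prev_def va_def vb_def e_def xy le_Suc_eq)
      qed
      ultimately have "reach S \<one>\<^bsub>A\<^esub> (\<lambda>x\<in>heis_index r. if fst x \<le> Suc j then v x else 0) 0 (\<Lambda> * n + (y * mb + x * ma))"
        by (simp only:)
      thus ?thesis
      proof (rule reach_mono)
        have "x * ma \<le> n * ma" "y * mb \<le> n * mb" using xy by (intro mult_right_mono; simp)+
        moreover have "(\<Lambda> + (mb + ma)) * n = \<Lambda> * n + (n * mb + n * ma)" by (simp add: algebra_simps)
        ultimately show "\<Lambda> * n + (y * mb + x * ma) \<le> (\<Lambda> + (mb + ma)) * n" by linarith
      qed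
    qed
  qed
qed

text \<open>The element is a product of an abelian lift, a word for the vector, and \<open>t\<close>
  copies of a fixed word for the central element; \<open>t \<le> n\<close> keeps the last factor
  linear.\<close>

lemma reach_linear:
  assumes "finite B" "B \<subseteq> carrier A"
  shows "\<exists>\<Lambda>. \<forall>n. \<forall>k::'a \<Rightarrow> nat. \<forall>v t. (\<forall>b\<in>B. k b \<le> n) \<longrightarrow> v \<in> extensional (heis_index r) \<longrightarrow>
     (\<forall>x\<in>heis_index r. 0 \<le> v x \<and> v x \<le> int n) \<longrightarrow> 0 \<le> t \<longrightarrow> t \<le> int n \<longrightarrow>
     reach S (\<Otimes>\<^bsub>A\<^esub>b\<in>B. b [^]\<^bsub>A\<^esub> int (k b)) v t (\<Lambda> * n)"
proof -
  obtain L1 where L1: "\<forall>n. \<forall>k::'a \<Rightarrow> nat. (\<forall>b\<in>B. k b \<le> n) \<longrightarrow>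
     reach S (\<Otimes>\<^bsub>A\<^esub>b\<in>B. b [^]\<^bsub>A\<^esub> int (k b)) (\<lambda>x\<in>heis_index r. 0) 0 (L1 * n)"
    using reach_abelian[OF assms] ..
  obtain L2 where L2: "\<forall>n. \<forall>v. (\<forall>x\<in>heis_index r. 0 \<le> v x \<and> v x \<le> int n) \<longrightarrow>
     reach S \<one>\<^bsub>A\<^esub> (\<lambda>x\<in>heis_index r. if fst x \<le> r then v x else 0) 0 (L2 * n)"
    using reach_heis[of r] ..
  obtain L3 where L3: "reach S \<one>\<^bsub>A\<^esub> (\<lambda>x\<in>heis_index r. 0) 1 L3"
    using reach_exists[OF A.one_closed, of "\<lambda>x\<in>heis_index r. 0"] by auto
  show ?thesis
  proof (intro exI[of _ "L1 + L2 + L3"] allI impI)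
    fix n and k :: "'a \<Rightarrow> nat" and v t
    assume k: "\<forall>b\<in>B. k b \<le> n" and v: "v \<in> extensional (heis_index r)" "\<forall>x\<in>heis_index r. 0 \<le> v x \<and> v x \<le> int n"
      and t: "0 \<le> t" "t \<le> int n"
    define q where "q = (\<Otimes>\<^bsub>A\<^esub>b\<in>B. b [^]\<^bsub>A\<^esub> int (k b))"
    define o0 :: "nat \<times> bool \<Rightarrow> int" where "o0 = (\<lambda>x\<in>heis_index r. 0)"
    have 1: "reach S q o0 0 (L1 * n)" unfolding q_def o0_def using L1[THEN spec, THEN spec, THEN mp, OF k] .
    hence q: "q \<in> carrier A" using reach_closed by blast
    have "(\<lambda>x\<in>heis_index r. if fst x \<le> r then v x else 0) = v"
      using v(1) by (intro extensionalityI[of _ "heis_index r"]) (auto simp: heis_index_def)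
    hence 2: "reach S \<one>\<^bsub>A\<^esub> v 0 (L2 * n)" using L2[THEN spec, THEN spec, THEN mp, OF v(2)] by simp
    have o0: "(\<lambda>x\<in>heis_index r. int c * o0 x) = o0" "(\<lambda>x\<in>heis_index r. o0 x + v x) = v" "(\<lambda>x\<in>heis_index r. v x + o0 x) = v" for c
      using v(1) by (intro extensionalityI[of _ "heis_index r"]; auto simp: o0_def)+
    have F0: "heis_form r \<delta> o0 w = 0" "heis_form r \<delta> w o0 = 0" for w
      unfolding o0_def by (rule heis_form_0)+
    have "reach S (\<one>\<^bsub>A\<^esub> [^]\<^bsub>A\<^esub> int (nat t)) o0 (int (nat t) * 1) (nat t * L3)"
      using reach_pow[OF L3[folded o0_def] F0(1), of "nat t"] unfolding o0 .
    hence 3: "reach S \<one>\<^bsub>A\<^esub> o0 t (nat t * L3)" using t by simp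
    have "reach S q v 0 (L1 * n + L2 * n)"
      using reach_mult[OF 1 2] q unfolding o0 F0 by simp
    from reach_mult[OF this 3] have "reach S q v t (L1 * n + L2 * n + nat t * L3)"
      using q unfolding o0 F0 by simp
    moreover have "nat t * L3 \<le> n * L3" using t by (intro mult_right_mono) auto
    hence "L1 * n + L2 * n + nat t * L3 \<le> (L1 + L2 + L3) * n" by (simp add: algebra_simps)
    ultimately show "reach S (\<Otimes>\<^bsub>A\<^esub>b\<in>B. b [^]\<^bsub>A\<^esub> int (k b)) v t ((L1 + L2 + L3) * n)"
      unfolding q_def by (rule reach_mono)
  qed
qed

end

end

section \<open>Counting classes from below, and the equivalence\<close>

context heis_coordinates
begin

text \<open>Triples with \<open>0 \<le> t < \<tau> v\<close> are pairwise different invariants of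
  short elements, so they can simply be counted. The radius \<open>m\<close> is left free above
  \<open>\<Lambda> * n\<close>, so that a larger dilation can be chosen afterwards.\<close>

lemma conj_growth_lower:
  assumes S: "finite_generating_set G S" and rank: "has_torsion_free_rank A s"
  shows "\<exists>\<Lambda>. \<forall>n m. \<Lambda> * n \<le> m \<longrightarrow>
    real n ^ s * (if r = 1 then real n ^ 2 * ln (real n) / 16 else real n ^ (2 * r)) \<le> real (conj_growth G S m)"
proof -
  obtain B where indep: "int_independent A B" and cB: "card B = s"
    using rank by (auto simp: has_torsion_free_rank_def)
  have B: "finite B" "B \<subseteq> carrier A" using indep by (auto simp: int_independent_def)
  define q where "q k = (\<Otimes>\<^bsub>A\<^esub>b\<in>B. b [^]\<^bsub>A\<^esub> int (k b))" for k :: "'a \<Rightarrow> nat"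
  obtain \<Lambda> where \<Lambda>: "\<forall>n. \<forall>k::'a \<Rightarrow> nat. \<forall>v t. (\<forall>b\<in>B. k b \<le> n) \<longrightarrow> v \<in> extensional (heis_index r) \<longrightarrow>
     (\<forall>x\<in>heis_index r. 0 \<le> v x \<and> v x \<le> int n) \<longrightarrow> 0 \<le> t \<longrightarrow> t \<le> int n \<longrightarrow>
     reach S (q k) v t (\<Lambda> * n)"
    using reach_linear[OF S B] unfolding q_def ..
  \<comment> \<open>For \<open>r = 1\<close> this is the unweighted gcd, which divides the content.
    For larger \<open>r\<close> one class per vector already has the right order.\<close>
  define \<tau> where "\<tau> v = (if r = 1 then gcd (v (1, True)) (v (1, False)) else 1)" for v :: "nat \<times> bool \<Rightarrow> int"
  show ?thesis
  proof (intro exI[of _ \<Lambda>] allI impI)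
    fix n m assume m: "\<Lambda> * n \<le> m"
    define KB where "KB = (B \<rightarrow>\<^sub>E {0..n})"
    \<comment> \<open>Starting the coordinates at 1 keeps the gcd positive and at most
      \<open>n\<close>.\<close>
    define VB where "VB = (heis_index r \<rightarrow>\<^sub>E {1..int n})"
    define Y where "Y = KB \<times> Sigma VB (\<lambda>v. {0..<\<tau> v})"
    define f where "f = (\<lambda>(k, v :: nat \<times> bool \<Rightarrow> int, t :: int). (q k, v, t))"
    have finVB: "finite VB" unfolding VB_def by (intro finite_PiE) auto
    have 1: "1 \<in> {1..r}" using r_pos by simp
    have "f ` Y \<subseteq> conj_invariant ` {g\<in>carrier G. word_length G S g \<le> m}"
    proof
      fix y assume "y \<in> f ` Y"
      then obtain k v t where k: "k \<in> KB" and v: "v \<in> VB" and t: "0 \<le> t" "t < \<tau> v" and y: "y = (q k, v, t)"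
        by (auto simp: f_def Y_def)
      have kn: "\<forall>b\<in>B. k b \<le> n" using k by (auto simp: KB_def PiE_iff)
      have vx: "1 \<le> v x" "v x \<le> int n" if "x \<in> heis_index r" for x
        using PiE_mem[OF v[unfolded VB_def] that] by simp_all
      have vE: "v \<in> extensional (heis_index r)" using v by (simp add: VB_def PiE_def)
      have vn: "\<forall>x\<in>heis_index r. 0 \<le> v x \<and> v x \<le> int n" using vx by (fastforce intro: order.trans[OF zero_le_one])
      have v1: "1 \<le> v (1, e)" "v (1, e) \<le> int n" for e using vx[of "(1, e)"] 1 by simp_all
      have "\<tau> v \<le> int n"
      proof (cases "r = 1")
        case True
        have "gcd (v (1, True)) (v (1, False)) \<le> v (1, True)"
          using v1(1)[of True] by (intro zdvd_imp_le) auto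
        thus ?thesis using True v1(2)[of True] by (simp add: \<tau>_def)
      qed (use v1[of True] in \<open>simp add: \<tau>_def\<close>)
      hence tn: "t \<le> int n" using t by simp
      have "reach S (q k) v t (\<Lambda> * n)"
        by (rule \<Lambda>[THEN spec, THEN spec, THEN spec, THEN spec, THEN mp, THEN mp, THEN mp, THEN mp, THEN mp,
              OF kn vE vn t(1) tn])
      then obtain g where g: "g \<in> carrier G" "p g = q k" "u g = v" "z g = t" "word_length G S g \<le> \<Lambda> * n"
        unfolding reach_def by blast
      \<comment> \<open>The invariant stores \<open>t\<close> only modulo the content; below
        \<open>\<tau> v\<close> the reduction does nothing.\<close>
      have "t mod content r \<delta> v = t"
      proof (cases "r = 1")
        case True
        have c0: "content r \<delta> v \<noteq> 0"
        proof
          assume "content r \<delta> v = 0"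
          hence "\<delta> 1 * v (1, True) = 0" using content_dvd[OF 1, of \<delta> v True] by simp
          thus False using v1(1)[of True] weight_pos[OF 1] by simp
        qed
        moreover have "content r \<delta> v \<ge> 0" by (simp add: content_def)
        ultimately have "content r \<delta> v > 0" by simp
        moreover have "\<tau> v dvd content r \<delta> v"
          unfolding content_def
        proof (rule Gcd_greatest)
          fix a assume "a \<in> (\<lambda>(i, e). \<delta> i * v (i, e)) ` heis_index r"
          then obtain e where "a = \<delta> 1 * v (1, e)" using True by (auto simp: heis_index_def)
          thus "\<tau> v dvd a" using True by (cases e) (auto simp: \<tau>_def intro: dvd_mult)
        qed
        ultimately have "\<tau> v \<le> content r \<delta> v" by (intro zdvd_imp_le)
        thus ?thesis using t by simp
      next
        case False
        hence "t = 0" using t by (simp add: \<tau>_def)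
        thus ?thesis by simp
      qed
      hence "conj_invariant g = y" using g y by (simp add: conj_invariant_def)
      thus "y \<in> conj_invariant ` {g\<in>carrier G. word_length G S g \<le> m}"
        using g m by (intro image_eqI[of _ _ g]) auto
    qed
    moreover have "finite (conj_invariant ` {g\<in>carrier G. word_length G S g \<le> m})"
      using conj_growth_upper[OF S rank] by blast
    ultimately have "card (f ` Y) \<le> conj_growth G S m"
      unfolding conj_growth_eq by (intro card_mono)
    moreover have "inj_on f Y"
    proof (rule inj_onI)
      fix a b assume ab: "a \<in> Y" "b \<in> Y" and eq: "f a = f b"
      obtain k v t where a: "a = (k, v, t)" by (cases a)
      obtain k' v' t' where b: "b = (k', v', t')" by (cases b)
      have "q k = q k'" using eq by (simp add: a b f_def)
      \<comment> \<open>Independence of \<open>B\<close> recovers the exponents from the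
        element.\<close>
      have "int (k x) = int (k' x)" if "x \<in> B" for x
        by (rule A.int_independent_inj[OF indep _ that]) (use \<open>q k = q k'\<close> in \<open>simp add: q_def\<close>)
      hence "k = k'"
        using ab by (intro extensionalityI[of _ B]) (auto simp: a b Y_def KB_def PiE_def)
      thus "a = b" using eq by (simp add: a b f_def)
    qed
    hence "card (f ` Y) = card Y" by (rule card_image)
    moreover have "card Y = (n + 1) ^ s * (\<Sum>v\<in>VB. nat (\<tau> v))"
      unfolding Y_def card_cartesian_product using B cB finVB by (simp add: KB_def card_PiE)
    ultimately have "(n + 1) ^ s * (\<Sum>v\<in>VB. nat (\<tau> v)) \<le> conj_growth G S m" by simp
    hence "real ((n + 1) ^ s * (\<Sum>v\<in>VB. nat (\<tau> v))) \<le> real (conj_growth G S m)" by (rule of_nat_mono)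
    hence le: "(real n + 1) ^ s * real (\<Sum>v\<in>VB. nat (\<tau> v)) \<le> real (conj_growth G S m)"
      by (simp add: add.commute)
    have "(if r = 1 then real n ^ 2 * ln (real n) / 16 else real n ^ (2 * r)) \<le> real (\<Sum>v\<in>VB. nat (\<tau> v))"
    proof (cases "r = 1")
      case False
      have "(\<Sum>v\<in>VB. nat (\<tau> v)) = card VB" using False by (simp add: \<tau>_def)
      also have "\<dots> = n ^ (2 * r)" unfolding VB_def by (simp add: card_PiE card_heis_index)
      finally show ?thesis using False by simp
    next
      case True
      \<comment> \<open>For \<open>r = 1\<close> a vector is a pair of positive numbers, so the gcd
        sum over pairs is carried over to \<open>VB\<close>.\<close>
      define emb where "emb = (\<lambda>(x, y). \<lambda>i\<in>heis_index r. if snd i then int x else int y)"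
      have ev: "emb (x, y) (1, True) = int x" "emb (x, y) (1, False) = int y" for x y
        using 1 by (simp_all add: emb_def)
      have inj: "inj_on emb ({1..n} \<times> {1..n})"
      proof (rule inj_onI)
        fix a b assume "emb a = emb b"
        thus "a = b" using ev[of "fst a" "snd a"] ev[of "fst b" "snd b"] by (simp add: prod_eq_iff)
      qed
      have "real n ^ 2 * ln (real n) / 16 \<le> (\<Sum>(x,y)\<in>{1..n} \<times> {1..n}. real (gcd x y))"
        by (rule sum_gcd_ge)
      also have "\<dots> = real (\<Sum>a\<in>{1..n} \<times> {1..n}. nat (\<tau> (emb a)))"
        unfolding of_nat_sum
      proof (intro sum.cong, simp)
        fix a assume "a \<in> {1..n} \<times> {1..n}"
        obtain x y where a: "a = (x, y)" by (cases a)
        have "\<tau> (emb a) = int (gcd x y)" using True by (simp add: \<tau>_def a ev[unfolded One_nat_def] ev)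
        thus "(case a of (x, y) \<Rightarrow> real (gcd x y)) = real (nat (\<tau> (emb a)))" by (simp add: a)
      qed
      also have "(\<Sum>a\<in>{1..n} \<times> {1..n}. nat (\<tau> (emb a))) = (\<Sum>v\<in>emb ` ({1..n} \<times> {1..n}). nat (\<tau> v))"
        unfolding sum.reindex[OF inj] by simp
      also have "real \<dots> \<le> real (\<Sum>v\<in>VB. nat (\<tau> v))"
        by (intro of_nat_mono sum_mono2 finVB) (auto simp: emb_def VB_def PiE_iff)
      finally show ?thesis using True by simp
    qed
    hence "real n ^ s * (if r = 1 then real n ^ 2 * ln (real n) / 16 else real n ^ (2 * r))
      \<le> (real n + 1) ^ s * real (\<Sum>v\<in>VB. nat (\<tau> v))"
    proof (rule mult_mono[rotated])
      show "real n ^ s \<le> (real n + 1) ^ s" by (intro power_mono) auto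
      show "0 \<le> (if r = 1 then real n ^ 2 * ln (real n) / 16 else real n ^ (2 * r))"
        by (cases "n = 0") auto
    qed simp
    also note le
    finally show "real n ^ s * (if r = 1 then real n ^ 2 * ln (real n) / 16 else real n ^ (2 * r)) \<le> real (conj_growth G S m)"
      by simp
  qed
qed

text \<open>Dilating the argument absorbs the constants, including the one inside the logarithm, and
  the additive constant of the relation covers \<open>n = 0\<close>.\<close>

lemma conj_growth_equiv:
  assumes S: "finite_generating_set G S" and rank: "has_torsion_free_rank A s"
  shows "(\<lambda>n. real (conj_growth G S n)) \<sim>g
    (\<lambda>n. if r = 1 then real n ^ (s + 2) * ln (real n) else real n ^ (s + 2 * r))"
proof -
  obtain C D where C: "C > 0" "D \<ge> 1" and up: "\<And>n. n \<ge> 1 \<Longrightarrow>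
    real (conj_growth G S n) \<le> C * real n ^ (s + 2 * r) * (if r = 1 then 1 + ln (D * real n) else 1)"
    using conj_growth_upper[OF S rank] by blast
  obtain \<Lambda> where low: "\<And>n m. \<Lambda> * n \<le> m \<Longrightarrow>
    real n ^ s * (if r = 1 then real n ^ 2 * ln (real n) / 16 else real n ^ (2 * r)) \<le> real (conj_growth G S m)"
    using conj_growth_lower[OF S rank] by blast
  \<comment> \<open>\<open>3 * D\<close> is at least \<open>exp 1 * D\<close>, which makes
    \<open>1 + ln (D * n)\<close> at most \<open>ln (l * n)\<close>. The growth at 0 is included for
    the case \<open>n = 0\<close>, and the 2 ensures \<open>l > 1\<close>.\<close>
  define l where "l = nat \<lceil>C\<rceil> + nat \<lceil>3 * D\<rceil> + conj_growth G S 0 + 2"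
  have l: "real l \<ge> C" "real l \<ge> 3 * D" "l > 1" "real l \<ge> real (conj_growth G S 0)" "real l \<ge> 1"
    unfolding l_def using real_nat_ceiling_ge[of C] real_nat_ceiling_ge[of "3 * D"] by simp_all
  define F where "F n = (if r = 1 then real n ^ (s + 2) * ln (real n) else real n ^ (s + 2 * r))" for n
  have F0: "F n \<ge> 0" for n by (cases "n = 0") (auto simp: F_def)
  have "real (conj_growth G S n) \<le> real l * F (l * n) + real l" for n
  proof (cases "n = 0")
    case True
    have "real (conj_growth G S n) \<le> 0 + real l" using l(4) True by simp
    also have "\<dots> \<le> real l * F (l * n) + real l" using F0[of "l * n"] by (intro add_right_mono) simp
    finally show ?thesis by simp
  next
    case False
    hence n: "n \<ge> 1" by simp
    have ln_le: "1 + ln (D * real n) \<le> ln (real (l * n))"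
    proof -
      have e: "exp 1 \<le> (3::real)" using exp_le by simp
      have "1 + ln (D * real n) = ln (exp 1 * (D * real n))"
        using C n by (subst ln_mult) auto
      also have "\<dots> \<le> ln (real (l * n))"
      proof (subst ln_le_cancel_iff)
        have "exp 1 * (D * real n) \<le> 3 * (D * real n)" using e C n by (intro mult_right_mono) auto
        also have "\<dots> \<le> real l * real n" using l(2) by (simp flip: mult.assoc add: mult_right_mono)
        finally show "exp 1 * (D * real n) \<le> real (l * n)" by simp
        show "0 < exp 1 * (D * real n)" using C n by simp
        show "0 < real (l * n)" using l(3) n by simp
      qed
      finally show ?thesis by simp
    qed
    have nl: "real n \<le> real (l * n)"
      using mult_right_mono[OF l(5), of "real n"] by simp
    have "real (conj_growth G S n) \<le> C * real n ^ (s + 2 * r) * (if r = 1 then 1 + ln (D * real n) else 1)"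
      by (rule up[OF n])
    also have "\<dots> \<le> C * real (l * n) ^ (s + 2 * r) * (if r = 1 then ln (real (l * n)) else 1)"
    proof (intro mult_mono mult_left_mono power_mono nl)
      show "(if r = 1 then 1 + ln (D * real n) else 1) \<le> (if r = 1 then ln (real (l * n)) else 1)"
        using ln_le by simp
      show "0 \<le> (if r = 1 then 1 + ln (D * real n) else 1)"
        using C n mult_mono[of 1 D 1 "real n"] by simp
    qed (use C in auto)
    also have "\<dots> = C * F (l * n)"
      by (cases "r = 1") (simp_all add: F_def)
    also have "\<dots> \<le> real l * F (l * n)" using l(1) F0 by (intro mult_right_mono)
    also have "\<dots> \<le> real l * F (l * n) + real l" by simp
    finally show ?thesis by simp
  qed
  hence le1: "(\<lambda>n. real (conj_growth G S n)) \<preceq>g F"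
    unfolding growth_le_def using l(3) by blast
  \<comment> \<open>The 16 cancels the constant of the gcd sum and makes \<open>l'\<close> greater
    than 1 even if \<open>\<Lambda> = 0\<close>.\<close>
  define l' where "l' = \<Lambda> + 16"
  have "F n \<le> real l' * real (conj_growth G S (l' * n)) + real l'" for n
  proof -
    have "\<Lambda> * n \<le> l' * n" by (simp add: l'_def)
    note low[OF this]
    moreover have "F n \<le> 16 * (real n ^ s * (if r = 1 then real n ^ 2 * ln (real n) / 16 else real n ^ (2 * r)))"
      by (cases "r = 1") (simp_all add: F_def power_add power2_eq_square mult_ac)
    ultimately have "F n \<le> 16 * real (conj_growth G S (l' * n))" by linarith
    also have "\<dots> \<le> real l' * real (conj_growth G S (l' * n))"
      by (intro mult_right_mono) (auto simp: l'_def)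
    finally show ?thesis by simp
  qed
  moreover have "l' > 1" by (simp add: l'_def)
  ultimately have le2: "F \<preceq>g (\<lambda>n. real (conj_growth G S n))"
    unfolding growth_le_def by blast
  have "(\<lambda>n. real (conj_growth G S n)) \<sim>g F"
    using le1 le2 by (simp add: growth_equiv_def)
  thus ?thesis unfolding F_def .
qed

end

section \<open>Coordinates on the direct product, and the theorem\<close>

lemma heis_coordinates_direct_product:
  assumes "comm_group A" "group H" "\<psi> \<in> iso H (heis_model r \<delta>)"
    and "r \<ge> 1" "\<And>i. i \<in> {1..r} \<Longrightarrow> \<delta> i > 0"
  shows "heis_coordinates (A \<times>\<times> H) A fst (\<lambda>g. fst (\<psi> (snd g))) (\<lambda>g. snd (\<psi> (snd g))) r \<delta>"
proof -
  interpret A: comm_group A by fact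
  interpret H: group H by fact
  have hom: "\<psi> (h \<otimes>\<^bsub>H\<^esub> k) = \<psi> h \<otimes>\<^bsub>heis_model r \<delta>\<^esub> \<psi> k" if "h \<in> carrier H" "k \<in> carrier H" for h k
    using assms(3) that by (auto simp: iso_def hom_def)
  have mult: "\<psi> (h \<otimes>\<^bsub>H\<^esub> k) = (\<lambda>i\<in>heis_index r. fst (\<psi> h) i + fst (\<psi> k) i,
      snd (\<psi> h) + snd (\<psi> k) + heis_form r \<delta> (fst (\<psi> h)) (fst (\<psi> k)))"
    if "h \<in> carrier H" "k \<in> carrier H" for h k
    using hom[OF that] mult_heis_model[of r \<delta> "fst (\<psi> h)" "snd (\<psi> h)" "fst (\<psi> k)" "snd (\<psi> k)"] by simp
  have bij: "bij_betw \<psi> (carrier H) (extensional (heis_index r) \<times> UNIV)"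
    using assms(3) by (simp add: iso_def)
  show ?thesis
  proof (intro heis_coordinates.intro heis_coordinates_axioms.intro assms)
    show "group (A \<times>\<times> H)" by (rule DirProd_group[OF A.is_group H.is_group])
    show "fst \<in> hom (A \<times>\<times> H) A" by (auto simp: hom_def)
    have "bij_betw (map_prod id \<psi>) (carrier A \<times> carrier H) (carrier A \<times> (extensional (heis_index r) \<times> UNIV))"
      by (intro bij_betw_map_prod bij_betw_id bij)
    thus "bij_betw (\<lambda>g. (fst g, fst (\<psi> (snd g)), snd (\<psi> (snd g)))) (carrier (A \<times>\<times> H))
        (carrier A \<times> extensional (heis_index r) \<times> UNIV)"
      by (simp add: map_prod_def case_prod_unfold)
  qed (auto simp: mult)
qed

theorem theorem4p5:
  fixes \<Gamma> :: "'a monoid" and s r :: nat and D :: "nat list"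
  assumes "comm_group \<Gamma>" and "finitely_generated \<Gamma>" and "has_torsion_free_rank \<Gamma> s"
    and "r \<ge> 1" and "length D = r - 1"
    and "\<forall>\<delta>\<in>set D. \<delta> > 0"
    and "\<forall>i. Suc i < length D \<longrightarrow> D ! i dvd D ! Suc i"
  shows "\<forall>S. finite_generating_set (\<Gamma> \<times>\<times> H_D D) S \<longrightarrow>
    (\<lambda>n. real (conj_growth (\<Gamma> \<times>\<times> H_D D) S n)) \<sim>g
    (\<lambda>n. if r = 1 then real n ^ (s + 2) * ln (real n) else real n ^ (s + 2 * r))"
proof (intro allI impI)
  fix S assume S: "finite_generating_set (\<Gamma> \<times>\<times> H_D D) S"
  have r: "length D + 1 = r" using assms(4,5) by simp
  obtain \<psi> where \<psi>: "\<psi> \<in> iso (H_D D) (heis_model r (central_weight D))"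
    using H_D_iso_model(2)[of D] unfolding r by blast
  have "central_weight D i > 0" if "i \<in> {1..r}" for i
    using that assms(5,6) by (auto simp: central_weight_def)
  then interpret heis_coordinates "\<Gamma> \<times>\<times> H_D D" \<Gamma> fst "\<lambda>g. fst (\<psi> (snd g))" "\<lambda>g. snd (\<psi> (snd g))" r "central_weight D"
    by (intro heis_coordinates_direct_product assms(1,4) H_D_iso_model(1) \<psi>)
  show "(\<lambda>n. real (conj_growth (\<Gamma> \<times>\<times> H_D D) S n)) \<sim>g
    (\<lambda>n. if r = 1 then real n ^ (s + 2) * ln (real n) else real n ^ (s + 2 * r))"
    by (rule conj_growth_equiv[OF S assms(3)])
qed

end
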